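(* Let $q\ge 2$ be an integer and $U$ a $q$-step kernel. If $U'$ is a kernel such that $t(H,U')=t(H,U)$ for every graph $H$ with at most $4q^2-q$ vertices, then $U$ and $U'$ are weakly isomorphic.
   Context: Graphs are finite and simple. A kernel is a bounded measurable symmetric function $U:[0,1]^2\to\mathbb{R}$. For a graph $H$, $t(H,U)=\int_{[0,1]^{V(H)}}\prod_{uv\in E(H)}U(x_u,x_v)\,\mathrm{d}x_{V(H)}$. Kernels $U_1,U_2$ are weakly isomorphic if $t(H,U_1)=t(H,U_2)$ for every graph $H$. A $q$-step kernel is a kernel $U$ for which $[0,1]$ can be partitioned into $q$ measurable sets of positive measure $A_1,\ldots,A_q$ such that $U$ is constant on each $A_i\times A_j$, but no such partition into $q-1$ sets exists. *)

theory Defs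
  imports "HOL-Analysis.Analysis"
begin

(* Measurability is Lebesgue measurability throughout; only the values of U on
   the unit square matter. *)
definition is_kernel :: "(real \<times> real \<Rightarrow> real) \<Rightarrow> bool" where
  "is_kernel U \<longleftrightarrow>
     U \<in> borel_measurable (lebesgue_on ({0..1} \<times> {0..1})) \<and>
     bounded (U ` ({0..1} \<times> {0..1})) \<and>
     (\<forall>x\<in>{0..1}. \<forall>y\<in>{0..1}. U (x, y) = U (y, x))"

(* Every finite graph is isomorphic to one whose vertices are natural numbers,
   and homomorphism densities are invariant under isomorphism. *)
definition simple_graph :: "nat set \<Rightarrow> nat set set \<Rightarrow> bool" where
  "simple_graph V E \<longleftrightarrow> finite V \<and> (\<forall>e\<in>E. e \<subseteq> V \<and> card e = 2)"

definition lebesgue_cube :: "nat set \<Rightarrow> (nat \<Rightarrow> real) measure" where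
  "lebesgue_cube V = completion (\<Pi>\<^sub>M v\<in>V. restrict_space lborel {0..1})"

(* The two ends of an edge e are Min e and Max e; since kernels are symmetric,
   the order in which they are passed to U is immaterial. *)
definition hom_density :: "nat set \<Rightarrow> nat set set \<Rightarrow> (real \<times> real \<Rightarrow> real) \<Rightarrow> real" where
  "hom_density V E U = (\<integral>x. (\<Prod>e\<in>E. U (x (Min e), x (Max e))) \<partial>lebesgue_cube V)"

definition weakly_isomorphic :: "(real \<times> real \<Rightarrow> real) \<Rightarrow> (real \<times> real \<Rightarrow> real) \<Rightarrow> bool" where
  "weakly_isomorphic U U' \<longleftrightarrow>
     (\<forall>V E. simple_graph V E \<longrightarrow> hom_density V E U = hom_density V E U')"

definition step_partition :: "(real \<times> real \<Rightarrow> real) \<Rightarrow> real set set \<Rightarrow> bool" where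
  "step_partition U P \<longleftrightarrow>
     partition_on {0..1} P \<and> finite P \<and>
     (\<forall>A\<in>P. A \<in> sets lebesgue \<and> 0 < emeasure lebesgue A) \<and>
     (\<forall>A\<in>P. \<forall>B\<in>P. U constant_on (A \<times> B))"

definition step_kernel :: "nat \<Rightarrow> (real \<times> real \<Rightarrow> real) \<Rightarrow> bool" where
  "step_kernel q U \<longleftrightarrow>
     is_kernel U \<and>
     (\<exists>P. step_partition U P \<and> card P = q) \<and>
     \<not> (\<exists>P. step_partition U P \<and> card P = q - 1)"

end

theory Submission
  imports Defs "HOL-Probability.Infinite_Product_Measure"
begin

text \<open>
  Homomorphism densities of graphs on a fixed vertex set determine the integrals of all polynomials
  that are multi-affine in the edge values, so the number of vertices is the only restriction.

  Let \<open>K x z = \<integral>u. U' (x, u) * U' (u, z)\<close> and \<open>d(x, y) = \<parallel>K x - K y\<parallel>\<^sup>2\<close>. The product of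
  \<open>d(x\<^sub>i, x\<^sub>j)\<close> over all pairs from \<open>q + 1\<close> points is multi-affine on few vertices and has integral zero for
  \<open>U\<close> by the pigeonhole principle, hence also for \<open>U'\<close>. So \<open>K\<close> has at most \<open>q\<close> classes of points, and
  then \<open>U'\<close> itself is almost everywhere a step kernel with at most \<open>q\<close> steps.

  It remains to compare two weighted \<open>q \<times> q\<close> matrices \<open>(a, A)\<close> and \<open>(b, B)\<close>, where \<open>A\<close> has no twins.
  Take \<open>m\<close> clones of each of \<open>q\<close> types, with \<open>m\<close> equal to \<open>q + 1\<close> or \<open>q + 2\<close> and even. Alternating
  sums over \<open>q\<close> vertices, one for each transversal in \<open>q\<close> families of transversals of the clones, each
  family using \<open>q - 1\<close> testers, vanish unless the clones of each group have a common type and these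
  types form a permutation. As there are \<open>m\<^sup>2\<close> edges between two groups, every entry of the permuted
  matrix can be compared with that of \<open>A\<close> by a product of distinct linear factors, and each
  weight by \<open>2q - 1\<close> further vertices. The resulting polynomial is nonnegative, positive somewhere
  on \<open>(a, A)\<close>, and nonzero on \<open>(b, B)\<close> only at an isomorphism. It uses at most
  \<open>q(q + 2) + q(q - 1) + (q - 1)(2q - 1) \<le> 4q\<^sup>2 - q\<close> vertices.
\<close>

section \<open>Multi-affine polynomials\<close>

text \<open>Graphs are simple, so no edge variable may be squared; this obstacle shapes both halves.
  In the comparison of matrices, all Lagrange factors for one entry would read the same edge if
  every type had a single representative; hence the clones. Signs cannot be controlled by squares
  either; they are controlled by \<open>m\<close> equal alternants, whose product is an even power.
  The constants count values. The two data sets together have at most \<open>2 * q\<close> weights,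
  \<open>2 * q\<close> diagonal values and \<open>q * (q - 1)\<close> off-diagonal values. The
  polynomial is tailored to both data sets: it has to separate the two kernels at hand and is no
  universal test. Nothing says beforehand that all \<open>q\<close> types of \<open>U'\<close> have
  positive weight, which explains the asymmetry between positive \<open>a\<close> and merely
  nonnegative \<open>b\<close>.\<close>

definition multiaffine :: "'e set \<Rightarrow> (('e \<Rightarrow> real) \<Rightarrow> real) \<Rightarrow> bool" where
  "multiaffine E \<Phi> \<longleftrightarrow> (\<exists>c. \<forall>X. \<Phi> X = (\<Sum>F\<in>Pow E. c F * (\<Prod>e\<in>F. X e)))"

lemma multiaffine_mono:
  assumes "multiaffine E \<Phi>" "E \<subseteq> E'" "finite E'"
  shows "multiaffine E' \<Phi>"
proof -
  obtain c where c: "\<And>X. \<Phi> X = (\<Sum>F\<in>Pow E. c F * (\<Prod>e\<in>F. X e))"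
    using assms(1) unfolding multiaffine_def by blast
  have "\<Phi> X = (\<Sum>F\<in>Pow E'. (if F \<subseteq> E then c F else 0) * (\<Prod>e\<in>F. X e))" for X
    unfolding c by (rule sum.mono_neutral_cong_left) (use assms in auto)
  then show ?thesis unfolding multiaffine_def
    by (intro exI[of _ "\<lambda>F. if F \<subseteq> E then c F else 0"]) auto
qed

lemma multiaffine_const: "finite E \<Longrightarrow> multiaffine E (\<lambda>_. c)"
proof -
  assume E: "finite E"
  have "(\<Sum>F\<in>Pow E. (if F = {} then c else 0) * (\<Prod>e\<in>F. X e)) =
    (\<Sum>F\<in>Pow E. if F = {} then c else 0)" for X :: "'a \<Rightarrow> real"
    by (rule sum.cong) auto
  then show ?thesis using E unfolding multiaffine_def
    by (intro exI[of _ "\<lambda>F. if F = {} then c else 0"]) simp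
qed

lemma multiaffine_var:
  fixes e :: 'e
  assumes "e \<in> E" "finite E"
  shows "multiaffine E (\<lambda>X. X e)"
proof -
  have "(\<Sum>F\<in>Pow E. (if F = {e} then 1 else 0) * (\<Prod>e\<in>F. X e)) =
    (\<Sum>F\<in>Pow E. if F = {e} then X e else 0)" for X :: "'e \<Rightarrow> real"
    by (rule sum.cong) auto
  then have "X e = (\<Sum>F\<in>Pow E. (if F = {e} then 1 else 0) * (\<Prod>e\<in>F. X e))" for X :: "'e \<Rightarrow> real"
    using assms by simp
  then show ?thesis unfolding multiaffine_def
    by (intro exI[of _ "\<lambda>F. if F = {e} then 1 else 0"]) auto
qed

lemma multiaffine_add:
  assumes "multiaffine E \<Phi>" "multiaffine E \<Psi>"
  shows "multiaffine E (\<lambda>X. \<Phi> X + \<Psi> X)"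
proof -
  obtain c d where "\<And>X. \<Phi> X = (\<Sum>F\<in>Pow E. c F * (\<Prod>e\<in>F. X e))"
    "\<And>X. \<Psi> X = (\<Sum>F\<in>Pow E. d F * (\<Prod>e\<in>F. X e))"
    using assms unfolding multiaffine_def by metis
  then have "\<Phi> X + \<Psi> X = (\<Sum>F\<in>Pow E. (c F + d F) * (\<Prod>e\<in>F. X e))" for X
    by (simp add: sum.distrib distrib_right)
  then show ?thesis unfolding multiaffine_def by (intro exI[of _ "\<lambda>F. c F + d F"]) auto
qed

lemma multiaffine_cmult:
  assumes "multiaffine E \<Phi>"
  shows "multiaffine E (\<lambda>X. b * \<Phi> X)"
proof -
  obtain c where "\<And>X. \<Phi> X = (\<Sum>F\<in>Pow E. c F * (\<Prod>e\<in>F. X e))"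
    using assms unfolding multiaffine_def by metis
  then have "b * \<Phi> X = (\<Sum>F\<in>Pow E. (b * c F) * (\<Prod>e\<in>F. X e))" for X
    by (simp add: sum_distrib_left mult.assoc)
  then show ?thesis unfolding multiaffine_def by (intro exI[of _ "\<lambda>F. b * c F"]) auto
qed

lemma multiaffine_diff:
  assumes "multiaffine E \<Phi>" "multiaffine E \<Psi>"
  shows "multiaffine E (\<lambda>X. \<Phi> X - \<Psi> X)"
  using multiaffine_add[OF assms(1) multiaffine_cmult[OF assms(2), of "-1"]] by simp

lemma multiaffine_sum:
  assumes "\<And>i. i \<in> I \<Longrightarrow> multiaffine E (\<Phi> i)" "finite E"
  shows "multiaffine E (\<lambda>X. \<Sum>i\<in>I. \<Phi> i X)"
  using assms
  by (induction I rule: infinite_finite_induct) (auto intro: multiaffine_const multiaffine_add)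

text \<open>Disjoint variable sets keep every variable at degree one. A subset \<open>F\<close> of
  \<open>E \<union> E'\<close> splits uniquely into its traces on \<open>E\<close> and
  \<open>E'\<close>, so its coefficient is
  \<open>c (F \<inter> E) * d (F \<inter> E')\<close>.\<close>

lemma multiaffine_mult:
  assumes "multiaffine E \<Phi>" "multiaffine E' \<Psi>" "E \<inter> E' = {}" "finite E" "finite E'"
  shows "multiaffine (E \<union> E') (\<lambda>X. \<Phi> X * \<Psi> X)"
proof -
  obtain c d where c: "\<And>X. \<Phi> X = (\<Sum>F\<in>Pow E. c F * (\<Prod>e\<in>F. X e))"
    and d: "\<And>X. \<Psi> X = (\<Sum>F\<in>Pow E'. d F * (\<Prod>e\<in>F. X e))"
    using assms unfolding multiaffine_def by metis
  have "\<Phi> X * \<Psi> X = (\<Sum>F\<in>Pow (E \<union> E'). (c (F \<inter> E) * d (F \<inter> E')) * (\<Prod>e\<in>F. X e))" for X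
  proof -
    have "\<Phi> X * \<Psi> X = (\<Sum>(F, F')\<in>Pow E \<times> Pow E'. (c F * (\<Prod>e\<in>F. X e)) * (d F' * (\<Prod>e\<in>F'. X e)))"
      unfolding c d by (simp add: sum_product sum.cartesian_product)
    also have "\<dots> = (\<Sum>F\<in>Pow (E \<union> E'). (c (F \<inter> E) * d (F \<inter> E')) * (\<Prod>e\<in>F. X e))"
    proof (rule sum.reindex_bij_witness[where j = "\<lambda>(F, F'). F \<union> F'" and i = "\<lambda>F. (F \<inter> E, F \<inter> E')"], goal_cases)
      case (5 FF)
      then obtain F F' where FF: "FF = (F, F')" and sub: "F \<subseteq> E" "F' \<subseteq> E'" by auto
      have "(F \<union> F') \<inter> E = F" "(F \<union> F') \<inter> E' = F'" using sub assms(3) by auto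
      moreover have "(\<Prod>e\<in>F \<union> F'. X e) = (\<Prod>e\<in>F. X e) * (\<Prod>e\<in>F'. X e)"
        by (rule prod.union_disjoint) (use sub assms in \<open>auto intro: finite_subset\<close>)
      ultimately show ?case unfolding FF by simp
    qed (use assms(3) in auto)
    finally show ?thesis .
  qed
  then show ?thesis unfolding multiaffine_def
    by (intro exI[of _ "\<lambda>F. c (F \<inter> E) * d (F \<inter> E')"]) auto
qed

lemma multiaffine_prod:
  assumes "finite I" "\<And>i. i \<in> I \<Longrightarrow> multiaffine (E i) (\<Phi> i)" "\<And>i. i \<in> I \<Longrightarrow> finite (E i)"
    "disjoint_family_on E I"
  shows "multiaffine (\<Union>i\<in>I. E i) (\<lambda>X. \<Prod>i\<in>I. \<Phi> i X)"
  using assms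
proof (induction I)
  case empty
  then show ?case by (simp add: multiaffine_const)
next
  case (insert j I)
  have "multiaffine (E j \<union> (\<Union>i\<in>I. E i)) (\<lambda>X. \<Phi> j X * (\<Prod>i\<in>I. \<Phi> i X))"
  proof (rule multiaffine_mult)
    show "multiaffine (\<Union>i\<in>I. E i) (\<lambda>X. \<Prod>i\<in>I. \<Phi> i X)"
      using insert by (intro insert.IH) (auto simp: disjoint_family_on_def)
    show "E j \<inter> (\<Union>i\<in>I. E i) = {}"
      using insert.prems(3) insert.hyps unfolding disjoint_family_on_def by fastforce
  qed (use insert in auto)
  then show ?case using insert.hyps by simp
qed

text \<open>Injectivity of \<open>r\<close> on \<open>E\<close> matters: identifying two variables
  would turn their product into a square.\<close>

lemma multiaffine_subst:
  assumes "multiaffine E \<Phi>" "inj_on r E"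
  shows "multiaffine (r ` E) (\<lambda>X. \<Phi> (\<lambda>e. X (r e)))"
proof -
  obtain c where c: "\<And>X. \<Phi> X = (\<Sum>F\<in>Pow E. c F * (\<Prod>e\<in>F. X e))"
    using assms(1) unfolding multiaffine_def by metis
  have "\<Phi> (\<lambda>e. X (r e)) = (\<Sum>F\<in>Pow (r ` E). c {e\<in>E. r e \<in> F} * (\<Prod>e\<in>F. X e))" for X
    unfolding c
  proof (rule sum.reindex_bij_witness[where j = "\<lambda>F. r ` F" and i = "\<lambda>F. {e\<in>E. r e \<in> F}"], goal_cases)
    case (1 F)
    then show ?case using assms(2) by (auto simp: inj_on_def)
  next
    case (5 F)
    then have "inj_on r F" "{e \<in> E. r e \<in> r ` F} = F"
      using assms(2) by (auto simp: inj_on_def)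
    then show ?case by (simp add: prod.reindex)
  qed (use assms(2) in auto)
  then show ?thesis unfolding multiaffine_def
    by (intro exI[of _ "\<lambda>F. c {e\<in>E. r e \<in> F}"]) auto
qed

lemma multiaffine_cong_var:
  assumes "multiaffine E \<Phi>" "\<And>e. e \<in> E \<Longrightarrow> X e = Y e"
  shows "\<Phi> X = \<Phi> Y"
proof -
  obtain c where c: "\<And>X. \<Phi> X = (\<Sum>F\<in>Pow E. c F * (\<Prod>e\<in>F. X e))"
    using assms(1) unfolding multiaffine_def by metis
  show ?thesis unfolding c using assms(2)
    by (intro sum.cong refl arg_cong2[where f = "(*)"] prod.cong) auto
qed

text \<open>A new point \<open>t\<close> costs only one tester \<open>w\<close>: if some old Lagrange function \<open>g\<^sub>i\<close> does not
  vanish at \<open>t\<close>, then \<open>g\<^sub>i * (A w - A w i)\<close> vanishes at all old points but not at \<open>t\<close>;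
  otherwise \<open>1 - (\<Sum>i. g\<^sub>i)\<close> does.\<close>

lemma lagrange_testers:
  fixes A :: "nat \<Rightarrow> nat \<Rightarrow> real"
  assumes dist: "\<And>i j. i < q \<Longrightarrow> j < q \<Longrightarrow> i \<noteq> j \<Longrightarrow> \<exists>w<q. A w i \<noteq> A w j"
    and "k < q"
  shows "\<exists>w G. (\<forall>j<k. w j < q) \<and> (\<forall>i\<le>k. multiaffine {..<k} (G i)) \<and>
    (\<forall>i\<le>k. \<forall>t\<le>k. G i (\<lambda>j. A (w j) t) = (if i = t then 1 else (0::real)))"
  using assms(2)
proof (induction k)
  case 0
  show ?case
    by (rule exI[of _ "\<lambda>_. 0"], rule exI[of _ "\<lambda>_ _. 1"]) (simp add: multiaffine_const)
next
  case (Suc k)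
  from Suc.IH[OF Suc_lessD[OF Suc.prems]] obtain w G where w: "\<forall>j<k. w j < q" and G: "\<forall>i\<le>k. multiaffine {..<k} (G i)"
    and L: "\<forall>i\<le>k. \<forall>t\<le>k. G i (\<lambda>j. A (w j) t) = (if i = t then 1 else (0::real))"
    by (elim exE conjE)
  let ?t = "Suc k"
  define g where "g i s = G i (\<lambda>j. A (w j) s)" for i s
  have GS: "multiaffine {..<Suc k} (G i)" if "i \<le> k" for i
    by (rule multiaffine_mono[of "{..<k}"]) (use G that in simp_all)
  have "\<exists>v H. v < q \<and> multiaffine {..<Suc k} H \<and>
    (\<forall>s\<le>k. H (\<lambda>j. A ((w(k := v)) j) s) = 0) \<and> H (\<lambda>j. A ((w(k := v)) j) ?t) \<noteq> 0"
  proof (cases "\<exists>i\<le>k. g i ?t \<noteq> 0")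
    case True
    then obtain i where i: "i \<le> k" "g i ?t \<noteq> 0" by auto
    obtain v where v: "v < q" "A v i \<noteq> A v ?t"
      using dist[of i ?t] i Suc.prems by auto
    define H where "H X = G i X * (X k - A v i)" for X
    have "multiaffine ({..<k} \<union> {k}) H"
      unfolding H_def
      by (rule multiaffine_mult) (use G i in \<open>auto intro!: multiaffine_diff multiaffine_var multiaffine_const\<close>)
    then have H: "multiaffine {..<Suc k} H" by (simp add: lessThan_Suc)
    have ev: "H (\<lambda>j. A ((w(k := v)) j) s) = g i s * (A v s - A v i)" for s
    proof -
      have "G i (\<lambda>j. A ((w(k := v)) j) s) = g i s"
        unfolding g_def by (rule multiaffine_cong_var[of "{..<k}"]) (use G i in auto)
      then show ?thesis unfolding H_def by simp
    qed
    show ?thesis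
    proof (rule exI[of _ v], rule exI[of _ H], intro conjI allI impI)
      show "H (\<lambda>j. A ((w(k := v)) j) s) = 0" if "s \<le> k" for s
        using L i that unfolding ev g_def by (cases "i = s") simp_all
      show "H (\<lambda>j. A ((w(k := v)) j) ?t) \<noteq> 0" unfolding ev using v i by simp
    qed (use v H in simp_all)
  next
    case False
    define H where "H X = 1 - (\<Sum>i\<le>k. G i X)" for X
    have H: "multiaffine {..<Suc k} H"
      unfolding H_def by (intro multiaffine_diff multiaffine_const multiaffine_sum GS) auto
    have ev: "H (\<lambda>j. A ((w(k := 0)) j) s) = 1 - (\<Sum>i\<le>k. g i s)" for s
    proof -
      have "G i (\<lambda>j. A ((w(k := 0)) j) s) = g i s" if "i \<le> k" for i
        unfolding g_def by (rule multiaffine_cong_var[of "{..<k}"]) (use G that in auto)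
      then show ?thesis unfolding H_def by simp
    qed
    have "(\<Sum>i\<le>k. g i s) = 1" if "s \<le> k" for s
      using L that by (simp add: g_def sum.delta)
    moreover have "(\<Sum>i\<le>k. g i ?t) = 0" using False by simp
    ultimately have "\<forall>s\<le>k. H (\<lambda>j. A ((w(k := 0)) j) s) = 0" "H (\<lambda>j. A ((w(k := 0)) j) ?t) \<noteq> 0"
      unfolding ev by simp_all
    then show ?thesis using H Suc.prems by (intro exI[of _ "0::nat"] exI[of _ H] conjI) simp_all
  qed
  then obtain v H where v: "v < q" and H: "multiaffine {..<Suc k} H"
    and H0: "\<And>s. s \<le> k \<Longrightarrow> H (\<lambda>j. A ((w(k := v)) j) s) = 0"
    and Ht: "H (\<lambda>j. A ((w(k := v)) j) ?t) \<noteq> 0" by blast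
  \<comment> \<open>\<open>H / h\<close> is the Lagrange function of the new point. The old
    functions keep their values at the old points, where \<open>H\<close> vanishes, and are
    corrected by a multiple of \<open>H\<close> so as to vanish at the new one.\<close>
  define h where "h = H (\<lambda>j. A ((w(k := v)) j) ?t)"
  define G' where "G' i X = (if i = ?t then H X / h else G i X - (g i ?t / h) * H X)" for i X
  have ev: "G i (\<lambda>j. A ((w(k := v)) j) s) = g i s" if "i \<le> k" for i s
    unfolding g_def by (rule multiaffine_cong_var[of "{..<k}"]) (use G that in auto)
  show ?case
  proof (intro exI conjI allI impI)
    show "(w(k := v)) j < q" if "j < Suc k" for j using that w v by auto
    show "multiaffine {..<Suc k} (G' i)" if "i \<le> Suc k" for i
    proof (cases "i = ?t")
      case True
      then show ?thesis unfolding G'_def using multiaffine_cmult[OF H, of "1/h"] by simp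
    next
      case False
      then have "G' i = (\<lambda>X. G i X - (g i ?t / h) * H X)" by (simp add: G'_def fun_eq_iff)
      moreover have "i \<le> k" using that False by simp
      ultimately show ?thesis by (metis multiaffine_diff[OF GS multiaffine_cmult[OF H]])
    qed
    show "G' i (\<lambda>j. A ((w(k := v)) j) t) = (if i = t then 1 else 0)"
      if "i \<le> Suc k" "t \<le> Suc k" for i t
    proof -
      have gi: "g i t = (if i = t then 1 else 0)" if "i \<le> k" "t \<le> k" using L that unfolding g_def by simp
      consider "i = ?t" "t = ?t" | "i = ?t" "t \<le> k" | "i \<le> k" "t = ?t" | "i \<le> k" "t \<le> k"
        using \<open>i \<le> Suc k\<close> \<open>t \<le> Suc k\<close> by linarith
      then show ?thesis
      proof cases
        case 1
        show ?thesis unfolding G'_def 1 h_def using Ht by simp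
      next
        case 2
        then show ?thesis unfolding G'_def H0[OF 2(2)] by simp
      next
        case 3
        show ?thesis unfolding G'_def 3(2) h_def ev[OF 3(1)] using Ht 3(1) by simp
      next
        case 4
        then show ?thesis unfolding G'_def ev[OF 4(1)] H0[OF 4(2)] gi[OF 4] by simp
      qed
    qed
  qed
qed

text \<open>The determinant of the matrix with entries \<open>g r (y i)\<close>, as a Leibniz sum:
  every term has exactly one factor per point, so multi-affinity can be read off term by
  term.\<close>

definition alternant :: "nat \<Rightarrow> (nat \<Rightarrow> 'x \<Rightarrow> real) \<Rightarrow> (nat \<Rightarrow> 'x) \<Rightarrow> real" where
  "alternant q g y = (\<Sum>\<rho> | \<rho> permutes {..<q}. of_int (sign \<rho>) * (\<Prod>i<q. g (\<rho> i) (y i)))"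

text \<open>A determinant with two equal columns. Composing \<rho> with the transposition of
  \<open>i\<close> and \<open>j\<close> flips the sign and leaves the product unchanged, so the
  alternant equals its own negative.\<close>

lemma alternant_eq_0:
  assumes "i < q" "j < q" "i \<noteq> j" "y i = y j"
  shows "alternant q g y = 0"
proof -
  let ?\<tau> = "Transposition.transpose i j"
  have \<tau>: "?\<tau> permutes {..<q}" using assms by (simp add: permutes_swap_id)
  have yt: "y (?\<tau> l) = y l" for l using assms(4) by (auto simp: Transposition.transpose_def)
  have "alternant q g y =
    (\<Sum>\<rho> | \<rho> permutes {..<q}. of_int (sign (\<rho> \<circ> ?\<tau>)) * (\<Prod>l<q. g ((\<rho> \<circ> ?\<tau>) l) (y l)))"
    unfolding alternant_def by (rule sum_permutations_compose_right[OF \<tau>])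
  also have "\<dots> = (\<Sum>\<rho> | \<rho> permutes {..<q}. - (of_int (sign \<rho>) * (\<Prod>l<q. g (\<rho> l) (y l))))"
  proof (rule sum.cong[OF refl])
    fix \<rho> assume "\<rho> \<in> {\<rho>. \<rho> permutes {..<q}}"
    then have \<rho>: "permutation \<rho>" by (auto intro: permutes_imp_permutation)
    have "sign (\<rho> \<circ> ?\<tau>) = - sign \<rho>"
      using \<rho> assms(3) by (simp add: sign_compose permutation_swap_id sign_swap_id)
    moreover have "(\<Prod>l<q. g ((\<rho> \<circ> ?\<tau>) l) (y l)) = (\<Prod>l<q. g (\<rho> l) (y l))"
    proof -
      have "(\<Prod>l<q. g ((\<rho> \<circ> ?\<tau>) l) (y l)) = (\<Prod>l<q. (\<lambda>l. g (\<rho> l) (y l)) (?\<tau> l))"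
        by (simp add: yt)
      also have "\<dots> = (\<Prod>l<q. g (\<rho> l) (y l))"
        using prod.permute[OF \<tau>, of "\<lambda>l. g (\<rho> l) (y l)"] by (simp add: o_def)
      finally show ?thesis .
    qed
    ultimately show "of_int (sign (\<rho> \<circ> ?\<tau>)) * (\<Prod>l<q. g ((\<rho> \<circ> ?\<tau>) l) (y l)) =
      - (of_int (sign \<rho>) * (\<Prod>l<q. g (\<rho> l) (y l)))" by simp
  qed
  also have "\<dots> = - alternant q g y" unfolding alternant_def by (simp add: sum_negf)
  finally show ?thesis by simp
qed

lemma alternant_id:
  assumes "\<And>i j. i < q \<Longrightarrow> j < q \<Longrightarrow> g i (y j) = (if i = j then 1 else 0)"
  shows "alternant q g y = 1"
proof -
  have "of_int (sign \<rho>) * (\<Prod>i<q. g (\<rho> i) (y i)) = (if \<rho> = id then 1 else 0)"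
    if "\<rho> permutes {..<q}" for \<rho>
  proof (cases "\<rho> = id")
    case True
    then show ?thesis using assms by simp
  next
    case False
    then obtain i where i: "\<rho> i \<noteq> i" by (auto simp: fun_eq_iff)
    then have iq: "i < q" using that by (auto simp: permutes_def)
    then have "\<rho> i < q" using permutes_in_image[OF that, of i] by simp
    then have "(\<Prod>i<q. g (\<rho> i) (y i)) = 0"
      using i iq assms by (intro prod_zero) (auto intro!: bexI[of _ i])
    then show ?thesis using False by simp
  qed
  then have "alternant q g y = (\<Sum>\<rho> | \<rho> permutes {..<q}. if \<rho> = id then 1 else 0)"
    unfolding alternant_def by (intro sum.cong) auto
  also have "\<dots> = 1"
    by (subst sum.delta) (auto simp: finite_permutations permutes_id)
  finally show ?thesis .
qed

section \<open>Weighted matrices\<close>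

text \<open>The Lagrange basis polynomial of \<open>t\<close>, with one linear factor per competing
  value. The target \<open>t\<close> may lie outside \<open>S\<close>; then no \<open>x\<close> in
  \<open>S\<close> equals it and both sides are 0.\<close>

lemma prod_kill:
  assumes "finite S" "x \<in> S"
  shows "(\<Prod>v\<in>S - {t}. (x - v) / (t - v)) = (if x = t then 1 else (0::real))"
proof (cases "x = t")
  case True
  then show ?thesis by (auto intro!: prod.neutral)
next
  case False
  then show ?thesis using assms by (auto intro!: prod_zero bexI[of _ x])
qed

text \<open>Once the values on \<open>V\<close> are fixed, the vertices of \<open>Z\<close> do not
  see each other, because \<open>h \<sigma> z\<close> reads \<sigma> only on \<open>V\<close>. By
  distributivity each of them can be summed inside the product.\<close>

lemma sum_PiE_split:
  fixes F :: "('v \<Rightarrow> 's) \<Rightarrow> real"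
  assumes "finite V" "finite Z" "V \<inter> Z = {}"
    and F: "\<And>\<sigma> \<tau>. (\<And>v. v \<in> V \<Longrightarrow> \<sigma> v = \<tau> v) \<Longrightarrow> F \<sigma> = F \<tau>"
    and h: "\<And>\<sigma> \<tau> z \<zeta>. (\<And>v. v \<in> V \<Longrightarrow> \<sigma> v = \<tau> v) \<Longrightarrow> h \<sigma> z \<zeta> = h \<tau> z \<zeta>"
  shows "(\<Sum>\<sigma>\<in>(V \<union> Z) \<rightarrow>\<^sub>E S. F \<sigma> * (\<Prod>z\<in>Z. h \<sigma> z (\<sigma> z))) =
    (\<Sum>\<sigma>\<in>V \<rightarrow>\<^sub>E S. F \<sigma> * (\<Prod>z\<in>Z. \<Sum>\<zeta>\<in>S. h \<sigma> z \<zeta>))"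
  using assms(2,3) F
proof (induction Z arbitrary: F)
  case empty
  show ?case by simp
next
  case (insert x Z)
  have x: "x \<notin> V \<union> Z" using insert.hyps insert.prems(1) by auto
  let ?P = "\<lambda>\<sigma>. F \<sigma> * (\<Prod>z\<in>Z. h \<sigma> z (\<sigma> z))"
  have upd: "F (g(x := \<zeta>)) = F g" "h (g(x := \<zeta>)) z \<xi> = h g z \<xi>" for g \<zeta> z \<xi>
    using x by (intro insert.prems(2) h; auto)+
  have "(\<Sum>\<sigma>\<in>(V \<union> insert x Z) \<rightarrow>\<^sub>E S. F \<sigma> * (\<Prod>z\<in>insert x Z. h \<sigma> z (\<sigma> z))) =
    (\<Sum>\<sigma>\<in>(\<lambda>(\<zeta>, g). g(x := \<zeta>)) ` (S \<times> ((V \<union> Z) \<rightarrow>\<^sub>E S)). ?P \<sigma> * h \<sigma> x (\<sigma> x))"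
    using insert.hyps by (simp add: PiE_insert_eq mult_ac)
  also have "\<dots> = (\<Sum>(\<zeta>, g)\<in>S \<times> ((V \<union> Z) \<rightarrow>\<^sub>E S). ?P (g(x := \<zeta>)) * h g x \<zeta>)"
    by (subst sum.reindex[OF inj_combinator[OF x]]) (auto simp: upd intro!: sum.cong)
  also have "\<dots> = (\<Sum>(\<zeta>, g)\<in>S \<times> ((V \<union> Z) \<rightarrow>\<^sub>E S). ?P g * h g x \<zeta>)"
  proof -
    have "(\<Prod>z\<in>Z. h g z ((g(x := \<zeta>)) z)) = (\<Prod>z\<in>Z. h g z (g z))" for g \<zeta>
      using insert.hyps by (intro prod.cong) auto
    then show ?thesis by (simp add: upd)
  qed
  also have "\<dots> = (\<Sum>g\<in>(V \<union> Z) \<rightarrow>\<^sub>E S. (F g * (\<Sum>\<zeta>\<in>S. h g x \<zeta>)) * (\<Prod>z\<in>Z. h g z (g z)))"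
    by (subst sum.cartesian_product[symmetric], subst sum.swap)
      (simp add: sum_distrib_left sum_distrib_right mult_ac)
  also have "\<dots> = (\<Sum>g\<in>V \<rightarrow>\<^sub>E S. (F g * (\<Sum>\<zeta>\<in>S. h g x \<zeta>)) * (\<Prod>z\<in>Z. \<Sum>\<zeta>\<in>S. h g z \<zeta>))"
  proof (rule insert.IH)
    fix \<sigma> \<tau> :: "'v \<Rightarrow> 's"
    assume *: "\<And>v. v \<in> V \<Longrightarrow> \<sigma> v = \<tau> v"
    show "F \<sigma> * (\<Sum>\<zeta>\<in>S. h \<sigma> x \<zeta>) = F \<tau> * (\<Sum>\<zeta>\<in>S. h \<tau> x \<zeta>)"
      using insert.prems(2)[OF *] h[OF *] by simp
  qed (use insert.prems(1) in auto)
  also have "\<dots> = (\<Sum>g\<in>V \<rightarrow>\<^sub>E S. F g * (\<Prod>z\<in>insert x Z. \<Sum>\<zeta>\<in>S. h g z \<zeta>))"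
    using insert.hyps by (simp add: mult_ac)
  finally show ?case .
qed

definition edge_value :: "(nat \<Rightarrow> nat \<Rightarrow> real) \<Rightarrow> (nat \<Rightarrow> nat) \<Rightarrow> nat set \<Rightarrow> real" where
  "edge_value C \<sigma> e = C (\<sigma> (Min e)) (\<sigma> (Max e))"

lemma edge_value_doubleton:
  assumes "\<And>i j. C i j = C j i"
  shows "edge_value C \<sigma> {u, v} = C (\<sigma> u) (\<sigma> v)"
  using assms by (cases "u \<le> v") (auto simp: edge_value_def min_def max_def)

text \<open>The homomorphism density into the weighted graph with vertex weights \<open>c\<close>
  and edge weights \<open>C\<close>, that is, the density of a step kernel computed from its finite
  data.\<close>

definition step_density ::
  "nat \<Rightarrow> (nat \<Rightarrow> real) \<Rightarrow> (nat \<Rightarrow> nat \<Rightarrow> real) \<Rightarrow> nat set \<Rightarrow> nat set set \<Rightarrow> real" where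
  "step_density q c C V E =
    (\<Sum>\<sigma>\<in>V \<rightarrow>\<^sub>E {..<q}. (\<Prod>v\<in>V. c (\<sigma> v)) * (\<Prod>e\<in>E. edge_value C \<sigma> e))"

lemma step_density_multiaffine:
  assumes "multiaffine E \<Phi>" "\<And>F. F \<subseteq> E \<Longrightarrow> step_density q b B V F = step_density q a A V F"
  shows "(\<Sum>\<sigma>\<in>V \<rightarrow>\<^sub>E {..<q}. (\<Prod>v\<in>V. b (\<sigma> v)) * \<Phi> (edge_value B \<sigma>)) =
    (\<Sum>\<sigma>\<in>V \<rightarrow>\<^sub>E {..<q}. (\<Prod>v\<in>V. a (\<sigma> v)) * \<Phi> (edge_value A \<sigma>))"
proof -
  obtain c where c: "\<And>X. \<Phi> X = (\<Sum>F\<in>Pow E. c F * (\<Prod>e\<in>F. X e))"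
    using assms(1) unfolding multiaffine_def by metis
  have "(\<Sum>\<sigma>\<in>V \<rightarrow>\<^sub>E {..<q}. (\<Prod>v\<in>V. d (\<sigma> v)) * \<Phi> (edge_value D \<sigma>)) =
    (\<Sum>F\<in>Pow E. c F * step_density q d D V F)" for d D
    unfolding c step_density_def by (simp add: sum_distrib_left mult_ac) (rule sum.swap)
  then show ?thesis using assms(2) by simp
qed

lemma injection_if_card_le:
  fixes S :: "'a set"
  assumes "finite S" "card S \<le> card T" "finite T"
  obtains r where "inj_on r S" "r ` S \<subseteq> T"
  using card_le_inj[OF assms(1,3,2)] by blast

section \<open>The separating polynomial and the edges it reads\<close>

definition vV :: "nat \<Rightarrow> nat \<Rightarrow> nat" where "vV i k = to_nat (0::nat, i, k)"
definition vW :: "nat \<Rightarrow> nat \<Rightarrow> nat" where "vW i k = to_nat (1::nat, i, k)"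
definition vZ :: "nat \<Rightarrow> nat \<Rightarrow> nat" where "vZ i k = to_nat (2::nat, i, k)"

lemma vertex_simps [simp]:
  "vV i k = vV i' k' \<longleftrightarrow> i = i' \<and> k = k'" "vW i k = vW i' k' \<longleftrightarrow> i = i' \<and> k = k'"
  "vZ i k = vZ i' k' \<longleftrightarrow> i = i' \<and> k = k'"
  "vV i k \<noteq> vW i' k'" "vW i k \<noteq> vV i' k'" "vV i k \<noteq> vZ i' k'" "vZ i k \<noteq> vV i' k'"
  "vW i k \<noteq> vZ i' k'" "vZ i k \<noteq> vW i' k'"
  by (auto simp: vV_def vW_def vZ_def)

text \<open>The graphs have clones \<open>vV i k\<close> of the types, testers \<open>vW l j\<close> and, for the weights,
  leaves \<open>vZ i s\<close>. The factors \<open>D\<close> force the clones of each group to have a common type, different for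
  different groups. Since clones are interchangeable, the values \<open>v\<close> that differ from the entry
  \<open>A i j\<close> can then be killed on pairwise distinct edges between clones of \<open>i\<close> and \<open>j\<close>, which keeps
  the polynomial multi-affine. In \<open>Kweight\<close> the product is the indicator that the leaf has the type of
  group \<open>i\<close>, so that averaging over the leaf gives the weight of this type. The last weight is
  determined by the others, hence \<open>q - 1\<close> in \<open>Iweight\<close>.\<close>

locale separating_polynomial =
  fixes q m :: nat and a :: "nat \<Rightarrow> real" and A :: "nat \<Rightarrow> nat \<Rightarrow> real"
    and weights diags offs :: "real set" and G :: "nat \<Rightarrow> (nat \<Rightarrow> real) \<Rightarrow> real"
    and ro rd :: "real \<Rightarrow> nat \<times> nat" and rz :: "real \<Rightarrow> nat" and jt :: "nat \<Rightarrow> nat \<Rightarrow> nat"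
  assumes q: "q \<ge> 2" and m_even: "even m" and m_ge: "q \<le> m"
    and A_sym: "A i j = A j i"
    and fin: "finite weights" "finite diags" "finite offs"
    and G: "i < q \<Longrightarrow> multiaffine {..<q - 1} (G i)"
    and ro: "inj_on ro offs" "ro ` offs \<subseteq> {..<m} \<times> {..<m}"
    and rd: "inj_on rd diags" "rd ` diags \<subseteq> {(k, k'). k < k' \<and> k' < m}"
    and rz: "inj_on rz weights"
    and jt: "i < q \<Longrightarrow> i' < q \<Longrightarrow> i \<noteq> i' \<Longrightarrow> jt i i' < q \<and> A (jt i i') i \<noteq> A (jt i i') i'"
begin

text \<open>Family \<open>l\<close> consists of the \<open>m\<close> transversals in which group
  \<open>l\<close> is shifted by one step. Family 0 has no shift: it supplies the plain transversals
  with which the shifted ones are compared. Group 0 is therefore never shifted.\<close>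

definition clone :: "nat \<Rightarrow> nat \<Rightarrow> nat \<Rightarrow> nat" where
  "clone l i k = (if i = l \<and> l \<noteq> 0 then Suc k mod m else k)"

text \<open>The determinant for one transversal, with tester edges substituted into the Lagrange
  functions. Every clone occurs once in each family, so testers can be shared within a family, but
  sharing them between families would repeat edges.\<close>

definition D :: "nat \<times> nat \<Rightarrow> (nat set \<Rightarrow> real) \<Rightarrow> real" where
  "D = (\<lambda>(l, k) X. alternant q (\<lambda>r y. G r (\<lambda>j. X {vW l j, y})) (\<lambda>i. vV i (clone l i k)))"

definition Koff :: "nat \<times> nat \<times> real \<Rightarrow> (nat set \<Rightarrow> real) \<Rightarrow> real" where
  "Koff = (\<lambda>(i, j, v) X. (X {vV i (fst (ro v)), vV j (snd (ro v))} - v) / (A i j - v))"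

definition Kdiag :: "nat \<times> real \<Rightarrow> (nat set \<Rightarrow> real) \<Rightarrow> real" where
  "Kdiag = (\<lambda>(i, v) X. (X {vV i (fst (rd v)), vV i (snd (rd v))} - v) / (A i i - v))"

text \<open>The type \<open>jt i i'\<close> separates \<open>i\<close> from \<open>i'\<close>, so an
  edge to a clone of that group can rule out \<open>i'\<close>. Taking the clone with number
  \<open>i'\<close> keeps the edges at one leaf distinct even if several \<open>i'\<close> share the
  same group; \<open>q \<le> m\<close> provides this clone.\<close>

definition Kweight :: "nat \<times> real \<Rightarrow> (nat set \<Rightarrow> real) \<Rightarrow> real" where
  "Kweight = (\<lambda>(i, v) X. ((\<Prod>i'\<in>{..<q} - {i}.
     (X {vZ i (rz v), vV (jt i i') i'} - A (jt i i') i') / (A (jt i i') i - A (jt i i') i')) - v) / (a i - v))"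

definition "Ioff = (SIGMA i:{..<q}. SIGMA j:{i<..<q}. offs - {A i j})"
definition "Idiag = (SIGMA i:{..<q}. diags - {A i i})"
definition "Iweight = (SIGMA i:{..<q - 1}. weights - {a i})"

text \<open>The factors that read only edges between roots, kept apart because they stay constant
  while the leaves are summed out.\<close>

definition "rigid X = (\<Prod>p\<in>{..<q} \<times> {..<m}. D p X) * ((\<Prod>p\<in>Ioff. Koff p X) * (\<Prod>p\<in>Idiag. Kdiag p X))"

definition "roots = (\<lambda>(i, k). vV i k) ` ({..<q} \<times> {..<m}) \<union> (\<lambda>(l, j). vW l j) ` ({..<q} \<times> {..<q - 1})"
definition "leaves = (\<lambda>(i, v). vZ i (rz v)) ` Iweight"
definition "all_edges = {e. e \<subseteq> roots \<union> leaves \<and> card e = 2}"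

lemma fin_I: "finite Ioff" "finite Idiag" "finite Iweight"
  unfolding Ioff_def Idiag_def Iweight_def using fin by (auto intro!: finite_SigmaI)

lemma fin_V: "finite roots" "finite leaves"
  unfolding roots_def leaves_def using fin_I by auto

lemma roots_leaves: "roots \<inter> leaves = {}"
  unfolding roots_def leaves_def by auto

lemma clone_less: "k < m \<Longrightarrow> clone l i k < m"
  unfolding clone_def using q m_ge by auto

lemma vV_roots: "i < q \<Longrightarrow> k < m \<Longrightarrow> vV i k \<in> roots"
  and vW_roots: "l < q \<Longrightarrow> j < q - 1 \<Longrightarrow> vW l j \<in> roots"
  unfolding roots_def by force+

text \<open>The variables of the individual factors. That no edge is used twice in the whole
  polynomial amounts to disjointness of these sets.\<close>

definition "ED = (\<lambda>(l, k). \<Union>i<q. (\<lambda>j. {vW l j, vV i (clone l i k)}) ` {..<q - 1})"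
definition "Eoff = (\<lambda>(i, j, v). {{vV i (fst (ro v)), vV j (snd (ro v))}})"
definition "Ediag = (\<lambda>(i, v). {{vV i (fst (rd v)), vV i (snd (rd v))}})"
definition "Eweight = (\<lambda>(i, v). (\<lambda>i'. {vZ i (rz v), vV (jt i i') i'}) ` ({..<q} - {i}))"

text \<open>Every Leibniz term is a product over the points of the transversal, and its factor for
  point \<open>i\<close> reads only the edges from the testers to that point. These stars are
  disjoint.\<close>

lemma D_multiaffine: "multiaffine (ED p) (D p)"
proof -
  obtain l k where p: "p = (l, k)" by force
  have "multiaffine (ED p) (\<lambda>X. of_int (sign \<rho>) * (\<Prod>i<q. G (\<rho> i) (\<lambda>j. X {vW l j, vV i (clone l i k)})))"
    if \<rho>: "\<rho> permutes {..<q}" for \<rho>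
    unfolding ED_def p prod.case
  proof (intro multiaffine_cmult multiaffine_prod)
    fix i assume i: "i \<in> {..<q}"
    have "\<rho> i < q" using permutes_in_image[OF \<rho>, of i] i by simp
    then show "multiaffine ((\<lambda>j. {vW l j, vV i (clone l i k)}) ` {..<q - 1})
        (\<lambda>X. G (\<rho> i) (\<lambda>j. X {vW l j, vV i (clone l i k)}))"
      by (intro multiaffine_subst[of _ "G (\<rho> i)"] G) (auto simp: inj_on_def doubleton_eq_iff)
  qed (auto simp: disjoint_family_on_def doubleton_eq_iff)
  then show ?thesis
    unfolding D_def p prod.case alternant_def
    by (intro multiaffine_sum) (auto simp: ED_def)
qed

lemma Koff_multiaffine: "multiaffine (Eoff p) (Koff p)"
proof -
  obtain i j v where p: "p = (i, j, v)" by (cases p) auto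
  have "multiaffine (Eoff p) (\<lambda>X. (1 / (A i j - v)) * (X {vV i (fst (ro v)), vV j (snd (ro v))} - v))"
    unfolding p Eoff_def by (intro multiaffine_cmult multiaffine_diff multiaffine_var multiaffine_const) auto
  then show ?thesis unfolding Koff_def p by simp
qed

lemma Kdiag_multiaffine: "multiaffine (Ediag p) (Kdiag p)"
proof -
  obtain i v where p: "p = (i, v)" by (cases p) auto
  have "multiaffine (Ediag p) (\<lambda>X. (1 / (A i i - v)) * (X {vV i (fst (rd v)), vV i (snd (rd v))} - v))"
    unfolding p Ediag_def by (intro multiaffine_cmult multiaffine_diff multiaffine_var multiaffine_const) auto
  then show ?thesis unfolding Kdiag_def p by simp
qed

lemma Kweight_multiaffine: "multiaffine (Eweight p) (Kweight p)"
proof -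
  obtain i v where p: "p = (i, v)" by (cases p) auto
  let ?e = "\<lambda>i'. {vZ i (rz v), vV (jt i i') i'}"
  have E: "Eweight p = (\<Union>i'\<in>{..<q} - {i}. {?e i'})" unfolding p Eweight_def by auto
  have "multiaffine (Eweight p) (\<lambda>X. \<Prod>i'\<in>{..<q} - {i}. (1 / (A (jt i i') i - A (jt i i') i')) * (X (?e i') - A (jt i i') i'))"
    unfolding E
    by (intro multiaffine_prod multiaffine_cmult multiaffine_diff multiaffine_var multiaffine_const)
      (auto simp: disjoint_family_on_def doubleton_eq_iff)
  then have "multiaffine (Eweight p) (\<lambda>X. (1 / (a i - v)) *
    ((\<Prod>i'\<in>{..<q} - {i}. (1 / (A (jt i i') i - A (jt i i') i')) * (X (?e i') - A (jt i i') i')) - v))"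
    by (intro multiaffine_cmult multiaffine_diff multiaffine_const) (auto simp: E)
  then show ?thesis unfolding Kweight_def p by simp
qed

lemma fin_E: "finite (ED p)" "finite (Eoff p')" "finite (Ediag p'')" "finite (Eweight p'')"
  unfolding ED_def Eoff_def Ediag_def Eweight_def by (auto split: prod.splits)

lemma ro_less: "v \<in> offs \<Longrightarrow> fst (ro v) < m" "v \<in> offs \<Longrightarrow> snd (ro v) < m"
  using ro(2) by auto

lemma rd_less: "v \<in> diags \<Longrightarrow> fst (rd v) < snd (rd v)" "v \<in> diags \<Longrightarrow> snd (rd v) < m"
  using rd(2) by auto

lemma clone_inj: "clone l i k = clone l i k' \<Longrightarrow> k < m \<Longrightarrow> k' < m \<Longrightarrow> k = k'"
  unfolding clone_def by (auto split: if_splits simp: mod_Suc)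

lemma disjoint_ED: "disjoint_family_on ED ({..<q} \<times> {..<m})"
  unfolding disjoint_family_on_def ED_def by (auto simp: doubleton_eq_iff dest: clone_inj)

lemma disjoint_Eoff: "disjoint_family_on Eoff Ioff"
  using ro(1) unfolding disjoint_family_on_def Eoff_def Ioff_def
  by (auto simp: doubleton_eq_iff inj_on_def prod_eq_iff)

text \<open>An edge inside a group determines only an unordered pair of clones. Since the pairs
  \<open>rd v\<close> are increasing, the edge still determines \<open>rd v\<close> and therefore
  \<open>v\<close>.\<close>

lemma disjoint_Ediag: "disjoint_family_on Ediag Idiag"
proof -
  have "v = w" if "v \<in> diags" "w \<in> diags" "{vV i (fst (rd v)), vV i (snd (rd v))} = {vV i (fst (rd w)), vV i (snd (rd w))}" for i v w
  proof -
    have "rd v = rd w" using that(3) rd_less(1)[OF that(1)] rd_less(1)[OF that(2)]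
      by (auto simp: doubleton_eq_iff prod_eq_iff)
    then show ?thesis using rd(1) that by (auto dest: inj_onD)
  qed
  then show ?thesis unfolding disjoint_family_on_def Ediag_def Idiag_def
    by (auto simp: doubleton_eq_iff)
qed

lemma disjoint_Eweight: "disjoint_family_on Eweight Iweight"
  using rz unfolding disjoint_family_on_def Eweight_def Iweight_def
  by (auto simp: doubleton_eq_iff inj_on_def)

lemma rigid_multiaffine:
  "multiaffine ((\<Union>p\<in>{..<q} \<times> {..<m}. ED p) \<union> ((\<Union>p\<in>Ioff. Eoff p) \<union> (\<Union>p\<in>Idiag. Ediag p))) rigid"
  unfolding rigid_def
  by (intro multiaffine_mult multiaffine_prod D_multiaffine Koff_multiaffine Kdiag_multiaffine
      disjoint_ED disjoint_Eoff disjoint_Ediag finite_UN_I finite_UnI fin_E fin_I)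
    (auto simp: ED_def Eoff_def Ediag_def Ioff_def doubleton_eq_iff)

text \<open>The four kinds of factors read edges of four different shapes: tester to clone, between
  two groups, inside one group, and leaf to clone. Hence disjointness is only an issue among factors
  of the same kind.\<close>

lemma full_multiaffine: "multiaffine all_edges (\<lambda>X. rigid X * (\<Prod>p\<in>Iweight. Kweight p X))"
proof (rule multiaffine_mono)
  let ?R = "(\<Union>p\<in>{..<q} \<times> {..<m}. ED p) \<union> ((\<Union>p\<in>Ioff. Eoff p) \<union> (\<Union>p\<in>Idiag. Ediag p))"
  show "multiaffine (?R \<union> (\<Union>p\<in>Iweight. Eweight p)) (\<lambda>X. rigid X * (\<Prod>p\<in>Iweight. Kweight p X))"
    by (intro multiaffine_mult rigid_multiaffine multiaffine_prod Kweight_multiaffine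
        disjoint_Eweight finite_UN_I finite_UnI fin_E fin_I)
      (auto simp: ED_def Eoff_def Ediag_def Eweight_def doubleton_eq_iff)
  have "ED p \<subseteq> all_edges" if "p \<in> {..<q} \<times> {..<m}" for p
    using that unfolding ED_def all_edges_def
    by (auto intro!: vV_roots vW_roots clone_less simp: card_insert_if)
  moreover have "Eoff p \<subseteq> all_edges" if "p \<in> Ioff" for p
    using that unfolding Eoff_def all_edges_def Ioff_def
    by (auto intro!: vV_roots ro_less simp: card_insert_if)
  moreover have "Ediag p \<subseteq> all_edges" if "p \<in> Idiag" for p
  proof -
    obtain i v where p: "p = (i, v)" "i < q" "v \<in> diags" using \<open>p \<in> Idiag\<close> by (auto simp: Idiag_def)
    have "fst (rd v) \<noteq> snd (rd v)" "fst (rd v) < m" "snd (rd v) < m"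
      using rd_less[OF p(3)] by auto
    then show ?thesis using p(2) unfolding Ediag_def all_edges_def p(1)
      by (auto intro!: vV_roots simp: card_insert_if)
  qed
  moreover have "Eweight p \<subseteq> all_edges" if "p \<in> Iweight" for p
  proof -
    obtain i v where p: "p = (i, v)" "i < q - 1" using \<open>p \<in> Iweight\<close> by (auto simp: Iweight_def)
    have "vV (jt i i') i' \<in> roots" if "i' < q" "i' \<noteq> i" for i'
      using jt[of i i'] that p m_ge by (intro vV_roots) auto
    moreover have "vZ i (rz v) \<in> leaves" using \<open>p \<in> Iweight\<close> p by (force simp: leaves_def)
    ultimately show ?thesis unfolding Eweight_def all_edges_def p by (auto simp: card_insert_if)
  qed
  ultimately show "?R \<union> (\<Union>p\<in>Iweight. Eweight p) \<subseteq> all_edges" by blast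
  show "finite all_edges"
    by (rule finite_subset[of _ "Pow (roots \<union> leaves)"]) (auto simp: all_edges_def fin_V)
qed

end

text \<open>Evaluation of the polynomial built from \<open>(a, A)\<close> on data
  \<open>(c, C)\<close>; it is used for \<open>(a, A)\<close> itself and for \<open>(b, B)\<close>.
  The membership assumptions on the values are what turns products of linear factors into
  indicators.\<close>

locale weighted_matrix = separating_polynomial +
  fixes c :: "nat \<Rightarrow> real" and C :: "nat \<Rightarrow> nat \<Rightarrow> real"
  assumes c_nonneg: "i < q \<Longrightarrow> 0 \<le> c i" and c_sum: "(\<Sum>i<q. c i) = 1" and C_sym: "C i j = C j i"
    and c_val: "i < q \<Longrightarrow> c i \<in> weights" and C_diag: "i < q \<Longrightarrow> C i i \<in> diags"
    and C_off: "i < q \<Longrightarrow> j < q \<Longrightarrow> i \<noteq> j \<Longrightarrow> C i j \<in> offs"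
begin

lemmas ev = edge_value_doubleton[of C, OF C_sym]

definition "leaf = (\<lambda>(i, v). vZ i (rz v))"

definition "root_term \<sigma> = (\<Prod>v\<in>roots. c (\<sigma> v)) * rigid (edge_value C \<sigma>) *
  (\<Prod>p\<in>Iweight. \<Sum>\<zeta><q. c \<zeta> * Kweight p (edge_value C (\<sigma>(leaf p := \<zeta>))))"

lemma leaf_inj: "inj_on leaf Iweight"
  using rz unfolding leaf_def Iweight_def by (auto simp: inj_on_def)

text \<open>Each leaf occurs in one factor \<open>Kweight p\<close> only, and the other ends of the
  edges read by this factor are roots. So for fixed types of the roots the leaves can be averaged
  independently.\<close>

lemma sum_eq_root_terms:
  "(\<Sum>\<sigma>\<in>(roots \<union> leaves) \<rightarrow>\<^sub>E {..<q}. (\<Prod>v\<in>roots \<union> leaves. c (\<sigma> v)) *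
      (rigid (edge_value C \<sigma>) * (\<Prod>p\<in>Iweight. Kweight p (edge_value C \<sigma>)))) =
   (\<Sum>\<sigma>\<in>roots \<rightarrow>\<^sub>E {..<q}. root_term \<sigma>)"
proof -
  let ?inv = "inv_into Iweight leaf"
  define h where "h \<sigma> z \<zeta> = c \<zeta> * Kweight (?inv z) (edge_value C (\<sigma>(z := \<zeta>)))" for \<sigma> z \<zeta>
  define F where "F \<sigma> = (\<Prod>v\<in>roots. c (\<sigma> v)) * rigid (edge_value C \<sigma>)" for \<sigma>
  have lv: "leaves = leaf ` Iweight" unfolding leaves_def leaf_def ..
  have inv: "?inv (leaf p) = p" if "p \<in> Iweight" for p using leaf_inj that by simp
  have rig: "rigid (edge_value C \<sigma>) = rigid (edge_value C \<tau>)"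
    if "\<And>v. v \<in> roots \<Longrightarrow> \<sigma> v = \<tau> v" for \<sigma> \<tau>
  proof (rule multiaffine_cong_var[OF rigid_multiaffine])
    fix e assume "e \<in> (\<Union>p\<in>{..<q} \<times> {..<m}. ED p) \<union> ((\<Union>p\<in>Ioff. Eoff p) \<union> (\<Union>p\<in>Idiag. Ediag p))"
    then consider p where "p \<in> {..<q} \<times> {..<m}" "e \<in> ED p" | p where "p \<in> Ioff" "e \<in> Eoff p"
      | p where "p \<in> Idiag" "e \<in> Ediag p" by blast
    then consider (D) l k i j where "e = {vW l j, vV i (clone l i k)}" "l < q" "k < m" "i < q" "j < q - 1"
      | (off) i j v where "e = {vV i (fst (ro v)), vV j (snd (ro v))}" "i < q" "j < q" "v \<in> offs"
      | (diag) i v where "e = {vV i (fst (rd v)), vV i (snd (rd v))}" "i < q" "v \<in> diags"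
    proof cases
      case (1 p)
      then show ?thesis unfolding ED_def by (auto intro: D)
    next
      case (2 p)
      then show ?thesis unfolding Eoff_def Ioff_def by (auto intro: off)
    next
      case (3 p)
      then show ?thesis unfolding Ediag_def Idiag_def by (auto intro: diag)
    qed
    then have "\<exists>u v. e = {u, v} \<and> u \<in> roots \<and> v \<in> roots"
    proof cases
      case D
      then show ?thesis using vV_roots vW_roots clone_less by blast
    next
      case off
      then show ?thesis using vV_roots ro_less by blast
    next
      case diag
      then show ?thesis using vV_roots rd_less less_trans by blast
    qed
    then obtain u v where "e = {u, v}" "u \<in> roots" "v \<in> roots" by blast
    then show "edge_value C \<sigma> e = edge_value C \<tau> e" using that by (simp add: ev)
  qed
  have kw: "Kweight p (edge_value C (\<sigma>(leaf p := \<zeta>))) = Kweight p (edge_value C (\<tau>(leaf p := \<zeta>)))"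
    if "p \<in> Iweight" "\<And>v. v \<in> roots \<Longrightarrow> \<sigma> v = \<tau> v" for p \<sigma> \<tau> \<zeta>
  proof (rule multiaffine_cong_var[OF Kweight_multiaffine])
    fix e assume e: "e \<in> Eweight p"
    obtain i v where p: "p = (i, v)" "i < q - 1" using \<open>p \<in> Iweight\<close> by (auto simp: Iweight_def)
    obtain i' where i': "i' < q" "i' \<noteq> i" "e = {leaf p, vV (jt i i') i'}"
      using e unfolding p Eweight_def leaf_def by auto
    have "vV (jt i i') i' \<in> roots" using jt[of i i'] i' p m_ge by (intro vV_roots) auto
    then show "edge_value C (\<sigma>(leaf p := \<zeta>)) e = edge_value C (\<tau>(leaf p := \<zeta>)) e"
      unfolding i'(3) ev using that(2) by simp
  qed
  have "(\<Sum>\<sigma>\<in>(roots \<union> leaves) \<rightarrow>\<^sub>E {..<q}. (\<Prod>v\<in>roots \<union> leaves. c (\<sigma> v)) *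
      (rigid (edge_value C \<sigma>) * (\<Prod>p\<in>Iweight. Kweight p (edge_value C \<sigma>)))) =
    (\<Sum>\<sigma>\<in>(roots \<union> leaves) \<rightarrow>\<^sub>E {..<q}. F \<sigma> * (\<Prod>z\<in>leaves. h \<sigma> z (\<sigma> z)))"
  proof (rule sum.cong[OF refl])
    fix \<sigma>
    have "(\<Prod>v\<in>roots \<union> leaves. c (\<sigma> v)) = (\<Prod>v\<in>roots. c (\<sigma> v)) * (\<Prod>v\<in>leaves. c (\<sigma> v))"
      by (rule prod.union_disjoint[OF fin_V roots_leaves])
    moreover have "(\<Prod>p\<in>Iweight. Kweight p (edge_value C \<sigma>)) = (\<Prod>z\<in>leaves. Kweight (?inv z) (edge_value C \<sigma>))"
      unfolding lv by (subst prod.reindex[OF leaf_inj]) (simp add: inv)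
    ultimately show "(\<Prod>v\<in>roots \<union> leaves. c (\<sigma> v)) *
      (rigid (edge_value C \<sigma>) * (\<Prod>p\<in>Iweight. Kweight p (edge_value C \<sigma>))) = F \<sigma> * (\<Prod>z\<in>leaves. h \<sigma> z (\<sigma> z))"
      unfolding F_def h_def by (simp add: prod.distrib mult_ac)
  qed
  \<comment> \<open>Away from \<open>leaves\<close> the inverse \<open>?inv z\<close> is arbitrary,
    while \<open>sum_PiE_split\<close> asks for independence at every \<open>z\<close>; the guard
    makes those terms 0.\<close>
  also have "\<dots> = (\<Sum>\<sigma>\<in>(roots \<union> leaves) \<rightarrow>\<^sub>E {..<q}. F \<sigma> * (\<Prod>z\<in>leaves. (if z \<in> leaves then h \<sigma> z (\<sigma> z) else 0)))"
    by simp
  also have "\<dots> = (\<Sum>\<sigma>\<in>roots \<rightarrow>\<^sub>E {..<q}. F \<sigma> * (\<Prod>z\<in>leaves. \<Sum>\<zeta><q. (if z \<in> leaves then h \<sigma> z \<zeta> else 0)))"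
  proof (rule sum_PiE_split[OF fin_V roots_leaves])
    fix \<sigma> \<tau> :: "nat \<Rightarrow> nat" assume *: "\<And>v. v \<in> roots \<Longrightarrow> \<sigma> v = \<tau> v"
    show "F \<sigma> = F \<tau>" unfolding F_def using rig[of \<sigma> \<tau>] * by simp
    show "(if z \<in> leaves then h \<sigma> z \<zeta> else 0) = (if z \<in> leaves then h \<tau> z \<zeta> else 0)" for z \<zeta>
      using kw[OF _ *] inv unfolding h_def lv by auto
  qed
  also have "\<dots> = (\<Sum>\<sigma>\<in>roots \<rightarrow>\<^sub>E {..<q}. root_term \<sigma>)"
  proof (rule sum.cong[OF refl])
    fix \<sigma>
    have "(\<Prod>z\<in>leaves. \<Sum>\<zeta><q. (if z \<in> leaves then h \<sigma> z \<zeta> else 0)) = (\<Prod>z\<in>leaves. \<Sum>\<zeta><q. h \<sigma> z \<zeta>)"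
      by simp
    also have "\<dots> = (\<Prod>p\<in>Iweight. \<Sum>\<zeta><q. c \<zeta> * Kweight p (edge_value C (\<sigma>(leaf p := \<zeta>))))"
      unfolding lv h_def by (subst prod.reindex[OF leaf_inj]) (simp add: inv)
    finally show "F \<sigma> * (\<Prod>z\<in>leaves. \<Sum>\<zeta><q. (if z \<in> leaves then h \<sigma> z \<zeta> else 0)) = root_term \<sigma>"
      unfolding F_def root_term_def by simp
  qed
  finally show ?thesis .
qed

lemma D_edge_value:
  "D (l, k) (edge_value C \<sigma>) =
    alternant q (\<lambda>r t. G r (\<lambda>j. C (\<sigma> (vW l j)) t)) (\<lambda>i. \<sigma> (vV i (clone l i k)))"
  unfolding D_def alternant_def by (simp add: ev)

text \<open>The alternants vanish unless every transversal of clones hits each type once. Shifting the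
  clones of a single group \<open>l\<close> cyclically by one leaves the rest of the transversal fixed, so the
  shifted clone must have the type of the original one.\<close>

lemma clones_consistent:
  assumes \<sigma>: "\<sigma> \<in> roots \<rightarrow>\<^sub>E {..<q}" and nz: "(\<Prod>p\<in>{..<q} \<times> {..<m}. D p (edge_value C \<sigma>)) \<noteq> 0"
  obtains \<pi> where "bij_betw \<pi> {..<q} {..<q}" "\<And>i k. i < q \<Longrightarrow> k < m \<Longrightarrow> \<sigma> (vV i k) = \<pi> i"
proof -
  have m: "0 < m" using q m_ge by simp
  have ran: "\<sigma> (vV i k) < q" if "i < q" "k < m" for i k
    using PiE_mem[OF \<sigma> vV_roots[OF that]] by simp
  have inj: "inj_on (\<lambda>i. \<sigma> (vV i (clone l i k))) {..<q}" if "l < q" "k < m" for l k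
  proof (rule inj_onI, rule ccontr)
    fix i j assume ij: "i \<in> {..<q}" "j \<in> {..<q}" "\<sigma> (vV i (clone l i k)) = \<sigma> (vV j (clone l j k))" "i \<noteq> j"
    then have "D (l, k) (edge_value C \<sigma>) = 0"
      unfolding D_edge_value by (intro alternant_eq_0[of i _ j]) auto
    then show False using nz that fin_E by (simp add: prod_zero_iff)
  qed
  have bij: "bij_betw (\<lambda>i. \<sigma> (vV i (clone l i k))) {..<q} {..<q}" if "l < q" "k < m" for l k
    unfolding bij_betw_def
    using inj[OF that] ran clone_less[OF that(2)] by (intro conjI endo_inj_surj) auto
  have step: "\<sigma> (vV l (Suc k mod m)) = \<sigma> (vV l k)" if l: "l < q" "l \<noteq> 0" and k: "k < m" for l k
  proof -
    have "\<sigma> (vV l (Suc k mod m)) \<in> {..<q}" using ran l k m by simp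
    also have "{..<q} = (\<lambda>i. \<sigma> (vV i k)) ` {..<q}"
      using bij[of 0 k] l k unfolding bij_betw_def clone_def by simp
    finally have "\<sigma> (vV l (Suc k mod m)) \<in> (\<lambda>i. \<sigma> (vV i k)) ` {..<q}" .
    then obtain i where i: "i \<in> {..<q}" "\<sigma> (vV l (Suc k mod m)) = \<sigma> (vV i k)" unfolding image_iff by (elim bexE) (rule that)
    have "i = l"
    proof (rule ccontr)
      assume "i \<noteq> l"
      then have "clone l i k = k" "clone l l k = Suc k mod m" using l(2) by (simp_all add: clone_def)
      then have "\<sigma> (vV i (clone l i k)) = \<sigma> (vV l (clone l l k))" by (simp only: i(2))
      then have "i = l" by (rule inj_onD[OF inj[OF l(1) k]]) (use i(1) l(1) in simp_all)
      then show False using \<open>i \<noteq> l\<close> by simp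
    qed
    then show ?thesis using i by simp
  qed
  have const: "\<sigma> (vV l k) = \<sigma> (vV l 0)" if "l < q" "l \<noteq> 0" "k < m" for l k
    using that(3)
  proof (induction k)
    case (Suc k)
    then show ?case using step[OF that(1,2), of k] by simp
  qed simp
  define \<pi> where "\<pi> i = \<sigma> (vV i 0)" for i
  have b: "bij_betw \<pi> {..<q} {..<q}" using bij[of 0 0] m q unfolding \<pi>_def clone_def by simp
  \<comment> \<open>Group 0 is never shifted. Its clone number \<open>k\<close> has one of the types
    of \<pi>, and family 0 excludes the types of the other groups, which are already known to be
    constant.\<close>
  have zero: "\<sigma> (vV 0 k) = \<sigma> (vV 0 0)" if k: "k < m" for k
  proof -
    have "\<sigma> (vV 0 k) \<in> \<pi> ` {..<q}" using b ran[of 0 k] k q by (simp add: bij_betw_def)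
    then obtain i where i: "i < q" "\<sigma> (vV 0 k) = \<sigma> (vV i 0)" unfolding \<pi>_def by auto
    have "i = 0"
    proof (rule ccontr)
      assume "i \<noteq> 0"
      then have "\<sigma> (vV i k) = \<sigma> (vV 0 k)" using const[OF i(1) _ k] i by simp
      then show False using inj_onD[OF inj[of 0 k], of i 0] i k q \<open>i \<noteq> 0\<close> by (simp add: clone_def)
    qed
    then show ?thesis using i by simp
  qed
  show thesis
  proof (rule that[OF b])
    show "\<sigma> (vV i k) = \<pi> i" if "i < q" "k < m" for i k
      unfolding \<pi>_def using const[OF that(1) _ that(2)] zero[OF that(2)] by (cases "i = 0") blast+
  qed
qed

lemma D_consistent:
  assumes "\<And>i k. i < q \<Longrightarrow> k < m \<Longrightarrow> \<sigma> (vV i k) = \<pi> i" "k < m"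
  shows "D (l, k) (edge_value C \<sigma>) = alternant q (\<lambda>r t. G r (\<lambda>j. C (\<sigma> (vW l j)) t)) \<pi>"
  unfolding D_edge_value alternant_def using assms(1) clone_less[OF assms(2)] by simp

text \<open>For clones of constant type \<open>D (l, k)\<close> no longer depends on
  \<open>k\<close>, so family \<open>l\<close> contributes an \<open>m\<close>-th power, and
  \<open>m\<close> is even.\<close>

lemma D_prod_nonneg:
  assumes "\<And>i k. i < q \<Longrightarrow> k < m \<Longrightarrow> \<sigma> (vV i k) = \<pi> i"
  shows "0 \<le> (\<Prod>p\<in>{..<q} \<times> {..<m}. D p (edge_value C \<sigma>))"
proof -
  have "(\<Prod>p\<in>{..<q} \<times> {..<m}. D p (edge_value C \<sigma>)) =
    (\<Prod>l<q. (alternant q (\<lambda>r t. G r (\<lambda>j. C (\<sigma> (vW l j)) t)) \<pi>) ^ m)"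
  proof -
    have "(\<Prod>p\<in>{..<q} \<times> {..<m}. D p (edge_value C \<sigma>)) = (\<Prod>l<q. \<Prod>k<m. D (l, k) (edge_value C \<sigma>))"
      by (simp add: prod.cartesian_product case_prod_beta)
    also have "\<dots> = (\<Prod>l<q. \<Prod>k<m. alternant q (\<lambda>r t. G r (\<lambda>j. C (\<sigma> (vW l j)) t)) \<pi>)"
      by (intro prod.cong refl D_consistent) (use assms in auto)
    finally show ?thesis by simp
  qed
  also have "\<dots> \<ge> 0" using m_even by (intro prod_nonneg) (auto simp: zero_le_even_power)
  finally show ?thesis .
qed

text \<open>The edges reserved for the different values \<open>v\<close> join clones of the same two
  types, so all of them carry \<open>C (\<pi> i) (\<pi> j)\<close>. The product over
  \<open>v\<close> is then a single Lagrange polynomial at this number, a value in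
  \<open>offs\<close> since \<pi> is injective.\<close>

lemma Koff_consistent:
  assumes cons: "\<And>i k. i < q \<Longrightarrow> k < m \<Longrightarrow> \<sigma> (vV i k) = \<pi> i" and \<pi>: "bij_betw \<pi> {..<q} {..<q}"
  shows "(\<Prod>p\<in>Ioff. Koff p (edge_value C \<sigma>)) =
    (if \<forall>i j. i < j \<and> j < q \<longrightarrow> C (\<pi> i) (\<pi> j) = A i j then 1 else 0)"
proof -
  have K: "Koff (i, j, v) (edge_value C \<sigma>) = (C (\<pi> i) (\<pi> j) - v) / (A i j - v)"
    if "i < j" "j < q" "v \<in> offs" for i j v
    unfolding Koff_def using cons that ro_less[OF that(3)] by (simp add: ev)
  have val: "C (\<pi> i) (\<pi> j) \<in> offs" if "i < j" "j < q" for i j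
  proof (rule C_off)
    show "\<pi> i < q" "\<pi> j < q" using bij_betwE[OF \<pi>] that by auto
    show "\<pi> i \<noteq> \<pi> j" using bij_betw_imp_inj_on[OF \<pi>] that by (auto simp: inj_on_def)
  qed
  have "(\<Prod>p\<in>Ioff. Koff p (edge_value C \<sigma>)) =
    (\<Prod>i<q. \<Prod>j\<in>{i<..<q}. \<Prod>v\<in>offs - {A i j}. Koff (i, j, v) (edge_value C \<sigma>))"
    unfolding Ioff_def using fin by (simp add: prod.Sigma case_prod_beta)
  also have "\<dots> = (\<Prod>i<q. \<Prod>j\<in>{i<..<q}. if C (\<pi> i) (\<pi> j) = A i j then 1 else 0)"
    by (intro prod.cong refl) (simp add: K prod_kill[OF fin(3)] val)
  also have "\<dots> = (if \<forall>i j. i < j \<and> j < q \<longrightarrow> C (\<pi> i) (\<pi> j) = A i j then 1 else 0)"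
  proof (cases "\<forall>i j. i < j \<and> j < q \<longrightarrow> C (\<pi> i) (\<pi> j) = A i j")
    case False
    then obtain i j where ij: "i < j" "j < q" "C (\<pi> i) (\<pi> j) \<noteq> A i j" by auto
    have "(\<Prod>j\<in>{i<..<q}. if C (\<pi> i) (\<pi> j) = A i j then 1 else (0::real)) = 0"
      by (rule prod_zero, simp, rule bexI[of _ j]) (use ij in auto)
    then have "\<exists>i\<in>{..<q}. (\<Prod>j\<in>{i<..<q}. if C (\<pi> i) (\<pi> j) = A i j then 1 else (0::real)) = 0"
      using ij by (intro bexI[of _ i]) auto
    then have "(\<Prod>i<q. \<Prod>j\<in>{i<..<q}. if C (\<pi> i) (\<pi> j) = A i j then 1 else (0::real)) = 0"
      by (intro prod_zero) auto
    then show ?thesis using False by auto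
  qed (auto intro!: prod.neutral)
  finally show ?thesis .
qed

lemma Kdiag_consistent:
  assumes cons: "\<And>i k. i < q \<Longrightarrow> k < m \<Longrightarrow> \<sigma> (vV i k) = \<pi> i" and \<pi>: "bij_betw \<pi> {..<q} {..<q}"
  shows "(\<Prod>p\<in>Idiag. Kdiag p (edge_value C \<sigma>)) =
    (if \<forall>i<q. C (\<pi> i) (\<pi> i) = A i i then 1 else 0)"
proof -
  have K: "Kdiag (i, v) (edge_value C \<sigma>) = (C (\<pi> i) (\<pi> i) - v) / (A i i - v)"
    if "i < q" "v \<in> diags" for i v
    unfolding Kdiag_def using cons[OF that(1)] rd_less[OF that(2)] by (simp add: ev)
  have val: "C (\<pi> i) (\<pi> i) \<in> diags" if "i < q" for i
    using bij_betwE[OF \<pi>] that by (intro C_diag) auto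
  have "(\<Prod>p\<in>Idiag. Kdiag p (edge_value C \<sigma>)) = (\<Prod>i<q. \<Prod>v\<in>diags - {A i i}. Kdiag (i, v) (edge_value C \<sigma>))"
    unfolding Idiag_def using fin by (simp add: prod.Sigma case_prod_beta)
  also have "\<dots> = (\<Prod>i<q. if C (\<pi> i) (\<pi> i) = A i i then 1 else 0)"
    by (intro prod.cong refl) (simp add: K prod_kill[OF fin(2)] val)
  also have "\<dots> = (if \<forall>i<q. C (\<pi> i) (\<pi> i) = A i i then 1 else 0)"
    by (auto intro!: prod.neutral prod_zero)
  finally show ?thesis .
qed

text \<open>A leaf of type \<open>\<pi> t\<close> sees the value \<open>A (jt i i') t\<close> on its
  edges, and the factor for \<open>i' = t\<close> vanishes unless \<open>t = i\<close>. Averaging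
  the indicator gives \<open>c (\<pi> i)\<close>; averaging the constant \<open>v\<close> gives
  \<open>v\<close>, since the weights add up to 1.\<close>

lemma Kweight_consistent:
  assumes cons: "\<And>i k. i < q \<Longrightarrow> k < m \<Longrightarrow> \<sigma> (vV i k) = \<pi> i" and \<pi>: "bij_betw \<pi> {..<q} {..<q}"
    and match: "\<And>i j. i < q \<Longrightarrow> j < q \<Longrightarrow> C (\<pi> i) (\<pi> j) = A i j"
  shows "(\<Prod>p\<in>Iweight. \<Sum>\<zeta><q. c \<zeta> * Kweight p (edge_value C (\<sigma>(leaf p := \<zeta>)))) =
    (if \<forall>i<q - 1. c (\<pi> i) = a i then 1 else 0)"
proof -
  have K: "(\<Sum>\<zeta><q. c \<zeta> * Kweight (i, v) (edge_value C (\<sigma>(leaf (i, v) := \<zeta>)))) = (c (\<pi> i) - v) / (a i - v)"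
    if i: "i < q" for i v
  proof -
    have sel: "(\<Prod>i'\<in>{..<q} - {i}. (C (\<pi> t) (\<sigma> (vV (jt i i') i')) - A (jt i i') i') / (A (jt i i') i - A (jt i i') i')) =
      (if t = i then 1 else 0)" if t: "t < q" for t
    proof -
      have e: "C (\<pi> t) (\<sigma> (vV (jt i i') i')) = A (jt i i') t" if "i' < q" "i' \<noteq> i" for i'
        using jt[of i i'] that i t m_ge by (simp add: cons match A_sym[of t])
      show ?thesis
      proof (cases "t = i")
        case True
        then show ?thesis using e jt[OF i] by (auto intro!: prod.neutral)
      next
        case False
        then have "(\<Prod>i'\<in>{..<q} - {i}. (C (\<pi> t) (\<sigma> (vV (jt i i') i')) - A (jt i i') i') / (A (jt i i') i - A (jt i i') i')) = 0"
          using e[of t] t by (intro prod_zero) (auto intro!: bexI[of _ t])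
        then show ?thesis using False by simp
      qed
    qed
    have "(\<Sum>\<zeta><q. c \<zeta> * Kweight (i, v) (edge_value C (\<sigma>(leaf (i, v) := \<zeta>)))) =
      (\<Sum>\<zeta><q. c \<zeta> * (((\<Prod>i'\<in>{..<q} - {i}. (C \<zeta> (\<sigma> (vV (jt i i') i')) - A (jt i i') i') / (A (jt i i') i - A (jt i i') i')) - v) / (a i - v)))"
      by (simp add: Kweight_def leaf_def ev)
    also have "\<dots> = (\<Sum>t<q. c (\<pi> t) * (((\<Prod>i'\<in>{..<q} - {i}. (C (\<pi> t) (\<sigma> (vV (jt i i') i')) - A (jt i i') i') / (A (jt i i') i - A (jt i i') i')) - v) / (a i - v)))"
      by (rule sum.reindex_bij_betw[OF \<pi>, symmetric])
    also have "\<dots> = (\<Sum>t<q. c (\<pi> t) * (((if t = i then 1 else 0) - v) / (a i - v)))"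
      by (intro sum.cong refl) (simp only: sel lessThan_iff)
    also have "\<dots> = (\<Sum>t<q. (if t = i then c (\<pi> t) else 0) - c (\<pi> t) * v) / (a i - v)"
      by (simp add: sum_divide_distrib) (auto intro!: sum.cong simp: algebra_simps diff_divide_distrib)
    also have "\<dots> = (c (\<pi> i) - (\<Sum>t<q. c (\<pi> t)) * v) / (a i - v)"
      using i by (simp add: sum_subtractf sum_distrib_right)
    also have "\<dots> = (c (\<pi> i) - v) / (a i - v)"
      using sum.reindex_bij_betw[OF \<pi>, of c] c_sum by simp
    finally show ?thesis .
  qed
  have val: "c (\<pi> i) \<in> weights" if "i < q" for i
    using bij_betwE[OF \<pi>] that by (intro c_val) auto
  have "(\<Prod>p\<in>Iweight. \<Sum>\<zeta><q. c \<zeta> * Kweight p (edge_value C (\<sigma>(leaf p := \<zeta>)))) =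
    (\<Prod>i<q - 1. \<Prod>v\<in>weights - {a i}. \<Sum>\<zeta><q. c \<zeta> * Kweight (i, v) (edge_value C (\<sigma>(leaf (i, v) := \<zeta>))))"
    unfolding Iweight_def using fin by (simp add: prod.Sigma case_prod_beta)
  also have "\<dots> = (\<Prod>i<q - 1. if c (\<pi> i) = a i then 1 else 0)"
    by (intro prod.cong refl) (simp add: K prod_kill[OF fin(1)] val)
  also have "\<dots> = (if \<forall>i<q - 1. c (\<pi> i) = a i then 1 else 0)"
    by (auto intro!: prod.neutral prod_zero)
  finally show ?thesis .
qed

text \<open>If \<open>rigid\<close> does not vanish, the clones are consistent, the factors other
  than the alternants become indicators, and the alternants multiply to a nonnegative number.
  Nonnegative terms cannot cancel, so a nonzero sum has a nonzero term, which exhibits a matching of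
  the data.\<close>

lemma root_term_nonneg_iso:
  assumes \<sigma>: "\<sigma> \<in> roots \<rightarrow>\<^sub>E {..<q}"
  shows "0 \<le> root_term \<sigma>"
    and "root_term \<sigma> \<noteq> 0 \<Longrightarrow> \<exists>\<pi>. bij_betw \<pi> {..<q} {..<q} \<and>
      (\<forall>i<q. \<forall>j<q. C (\<pi> i) (\<pi> j) = A i j) \<and> (\<forall>i<q - 1. c (\<pi> i) = a i)"
proof -
  have "0 \<le> root_term \<sigma> \<and> (root_term \<sigma> \<noteq> 0 \<longrightarrow> (\<exists>\<pi>. bij_betw \<pi> {..<q} {..<q} \<and>
      (\<forall>i<q. \<forall>j<q. C (\<pi> i) (\<pi> j) = A i j) \<and> (\<forall>i<q - 1. c (\<pi> i) = a i)))"
  proof (cases "rigid (edge_value C \<sigma>) = 0")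
    case False
    then have "(\<Prod>p\<in>{..<q} \<times> {..<m}. D p (edge_value C \<sigma>)) \<noteq> 0" unfolding rigid_def by auto
    then obtain \<pi> where \<pi>: "bij_betw \<pi> {..<q} {..<q}"
      and cons: "\<And>i k. i < q \<Longrightarrow> k < m \<Longrightarrow> \<sigma> (vV i k) = \<pi> i"
      using clones_consistent[OF \<sigma>] by blast
    have koff: "(\<Prod>p\<in>Ioff. Koff p (edge_value C \<sigma>)) =
        (if \<forall>i j. i < j \<and> j < q \<longrightarrow> C (\<pi> i) (\<pi> j) = A i j then 1 else 0)"
      by (rule Koff_consistent) (use cons \<pi> in auto)
    have kdiag: "(\<Prod>p\<in>Idiag. Kdiag p (edge_value C \<sigma>)) =
        (if \<forall>i<q. C (\<pi> i) (\<pi> i) = A i i then 1 else 0)"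
      by (rule Kdiag_consistent) (use cons \<pi> in auto)
    have off: "C (\<pi> i) (\<pi> j) = A i j" if "i < j" "j < q" for i j
      using False koff that unfolding rigid_def by (auto split: if_splits)
    have diag: "C (\<pi> i) (\<pi> i) = A i i" if "i < q" for i
      using False kdiag that unfolding rigid_def by (auto split: if_splits)
    have match: "C (\<pi> i) (\<pi> j) = A i j" if "i < q" "j < q" for i j
      using off[of i j] off[of j i] diag[of i] that A_sym C_sym by (cases i j rule: linorder_cases) auto
    have kweight: "(\<Prod>p\<in>Iweight. \<Sum>\<zeta><q. c \<zeta> * Kweight p (edge_value C (\<sigma>(leaf p := \<zeta>)))) =
        (if \<forall>i<q - 1. c (\<pi> i) = a i then 1 else 0)"
      by (rule Kweight_consistent) (use cons \<pi> match in auto)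
    have rig: "0 \<le> rigid (edge_value C \<sigma>)"
      unfolding rigid_def koff kdiag
      using D_prod_nonneg[of \<sigma> \<pi>] cons by simp
    have "\<sigma> v < q" if "v \<in> roots" for v using PiE_mem[OF \<sigma> that] by simp
    then have "0 \<le> (\<Prod>v\<in>roots. c (\<sigma> v))" by (intro prod_nonneg) (auto intro: c_nonneg)
    then show ?thesis
      unfolding root_term_def kweight
      using rig \<pi> match by auto
  qed (auto simp: root_term_def)
  then show "0 \<le> root_term \<sigma>" "root_term \<sigma> \<noteq> 0 \<Longrightarrow> \<exists>\<pi>. bij_betw \<pi> {..<q} {..<q} \<and>
      (\<forall>i<q. \<forall>j<q. C (\<pi> i) (\<pi> j) = A i j) \<and> (\<forall>i<q - 1. c (\<pi> i) = a i)" by auto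
qed

text \<open>The assignment for which every alternant is the determinant of an identity matrix and
  every indicator equals 1.\<close>

lemma root_term_pos:
  assumes \<sigma>: "\<sigma> \<in> roots \<rightarrow>\<^sub>E {..<q}" and cons: "\<And>i k. i < q \<Longrightarrow> k < m \<Longrightarrow> \<sigma> (vV i k) = i"
    and match: "\<And>i j. C i j = A i j" "\<And>i. c i = a i" and pos: "\<And>i. i < q \<Longrightarrow> 0 < c i"
    and lagr: "\<And>l i t. l < q \<Longrightarrow> i < q \<Longrightarrow> t < q \<Longrightarrow> G i (\<lambda>j. C (\<sigma> (vW l j)) t) = (if i = t then 1 else 0)"
  shows "root_term \<sigma> > 0"
proof -
  have id: "bij_betw id {..<q} {..<q}" by simp
  have cons': "\<sigma> (vV i k) = id i" if "i < q" "k < m" for i k using cons that by simp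
  have "D (l, k) (edge_value C \<sigma>) = 1" if "l < q" "k < m" for l k
  proof -
    have "D (l, k) (edge_value C \<sigma>) = alternant q (\<lambda>r t. G r (\<lambda>j. C (\<sigma> (vW l j)) t)) id"
      by (rule D_consistent) (use cons' that in auto)
    also have "\<dots> = 1" using lagr[OF that(1)] by (intro alternant_id) auto
    finally show ?thesis .
  qed
  then have Dp: "(\<Prod>p\<in>{..<q} \<times> {..<m}. D p (edge_value C \<sigma>)) = 1" by (intro prod.neutral) auto
  have koff: "(\<Prod>p\<in>Ioff. Koff p (edge_value C \<sigma>)) =
      (if \<forall>i j. i < j \<and> j < q \<longrightarrow> C (id i) (id j) = A i j then 1 else 0)"
    by (rule Koff_consistent[OF _ id]) (rule cons')
  have kdiag: "(\<Prod>p\<in>Idiag. Kdiag p (edge_value C \<sigma>)) =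
      (if \<forall>i<q. C (id i) (id i) = A i i then 1 else 0)"
    by (rule Kdiag_consistent[OF _ id]) (rule cons')
  have kweight: "(\<Prod>p\<in>Iweight. \<Sum>\<zeta><q. c \<zeta> * Kweight p (edge_value C (\<sigma>(leaf p := \<zeta>)))) =
      (if \<forall>i<q - 1. c (id i) = a i then 1 else 0)"
    by (rule Kweight_consistent[OF _ id]) (auto simp: cons' match)
  have "rigid (edge_value C \<sigma>) = 1"
    unfolding rigid_def koff kdiag Dp using match by simp
  moreover have "(\<Prod>v\<in>roots. c (\<sigma> v)) > 0"
    using PiE_mem[OF \<sigma>] by (intro prod_pos) (auto intro: pos)
  ultimately show ?thesis
    unfolding root_term_def kweight using match by simp
qed

end

section \<open>Choice of the parameters and comparison of two weighted matrices\<close>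

lemma card_less_pairs: "2 * card {(k, k'). k < k' \<and> k' < (m::nat)} = m * (m - 1)"
proof (induction m)
  case (Suc m)
  let ?S = "{(k, k'). k < k' \<and> k' < m}"
  have fin: "finite ?S" by (rule finite_subset[of _ "{..<m} \<times> {..<m}"]) auto
  have "{(k, k'). k < k' \<and> k' < Suc m} = ?S \<union> (\<lambda>k. (k, m)) ` {..<m}" by (auto simp: less_Suc_eq)
  moreover have "card (?S \<union> (\<lambda>k. (k, m)) ` {..<m}) = card ?S + card ((\<lambda>k. (k, m)) ` {..<m})"
    using fin by (intro card_Un_disjoint) auto
  ultimately have "card {(k, k'). k < k' \<and> k' < Suc m} = card ?S + m"
    by (simp add: card_image inj_on_def)
  then show ?case using Suc by (cases m) (auto simp: algebra_simps)
qed simp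

text \<open>Positivity is assumed for \<open>a\<close> and absence of twins for \<open>A\<close>;
  both properties pass to \<open>(b, B)\<close> through \<pi>.\<close>

lemma step_data_determined:
  fixes a b :: "nat \<Rightarrow> real" and A B :: "nat \<Rightarrow> nat \<Rightarrow> real"
  assumes q: "q \<ge> 2"
    and a: "\<And>i. i < q \<Longrightarrow> 0 < a i" "(\<Sum>i<q. a i) = 1"
    and b: "\<And>i. i < q \<Longrightarrow> 0 \<le> b i" "(\<Sum>i<q. b i) = 1"
    and sym: "\<And>i j. A i j = A j i" "\<And>i j. B i j = B j i"
    and dist: "\<And>i j. i < q \<Longrightarrow> j < q \<Longrightarrow> i \<noteq> j \<Longrightarrow> \<exists>w<q. A w i \<noteq> A w j"
    and dens: "\<And>V E. simple_graph V E \<Longrightarrow> card V \<le> 4 * q\<^sup>2 - q \<Longrightarrow>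
      step_density q b B V E = step_density q a A V E"
  obtains \<pi> where "bij_betw \<pi> {..<q} {..<q}" "\<And>i j. i < q \<Longrightarrow> j < q \<Longrightarrow> B (\<pi> i) (\<pi> j) = A i j"
    "\<And>i. i < q \<Longrightarrow> b (\<pi> i) = a i"
proof -
  \<comment> \<open>The least even number above \<open>q\<close>. Evenness makes the alternants
    contribute nonnegative powers; the size provides enough edges inside a group for up to
    \<open>2 * q\<close> diagonal values.\<close>
  define m where "m = 2 * (q div 2 + 1)"
  have m: "even m" "q + 1 \<le> m" "m \<le> q + 2" "4 \<le> m" unfolding m_def using q by auto
  \<comment> \<open>Values of both data sets are collected, so that the factors exclude every
    competing value occurring in either of them.\<close>
  define weights where "weights = a ` {..<q} \<union> b ` {..<q}"
  define diags where "diags = (\<lambda>i. A i i) ` {..<q} \<union> (\<lambda>i. B i i) ` {..<q}"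
  define P where "P = {(i, j). i < j \<and> j < q}"
  define offs where "offs = (\<lambda>(i, j). A i j) ` P \<union> (\<lambda>(i, j). B i j) ` P"
  have finP: "finite P" unfolding P_def by (rule finite_subset[of _ "{..<q} \<times> {..<q}"]) auto
  have fin: "finite weights" "finite diags" "finite offs"
    unfolding weights_def diags_def offs_def using finP by auto
  have un: "card (f ` S \<union> g ` S) \<le> 2 * card S" if "finite S" for f g :: "'x \<Rightarrow> real" and S
    using card_Un_le[of "f ` S" "g ` S"] card_image_le[OF that, of f] card_image_le[OF that, of g] by linarith
  have card_w: "card weights \<le> 2 * q" unfolding weights_def using un[of "{..<q}" a b] by simp
  have "card diags \<le> 2 * q" unfolding diags_def using un[of "{..<q}"] by simp
  also have "2 * q \<le> card {(k, k'). k < k' \<and> k' < m}"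
  proof -
    \<comment> \<open>The estimate by \<open>(q + 1) * q\<close> works from \<open>q = 3\<close> on;
      for \<open>q = 2\<close> one has \<open>m = 4\<close> exactly.\<close>
    have "4 * q \<le> m * (m - 1)"
    proof (cases "q = 2")
      case False
      have "(q + 1) * q \<le> m * (m - 1)" using m by (intro mult_le_mono) auto
      moreover have "4 * q \<le> (q + 1) * q" using q False by (intro mult_le_mono) auto
      ultimately show ?thesis by linarith
    qed (simp add: m_def)
    then show ?thesis using card_less_pairs[of m] by linarith
  qed
  finally have "card diags \<le> card {(k, k'). k < k' \<and> k' < m}" .
  moreover have "finite {(k, k'). k < k' \<and> k' < m}" by (rule finite_subset[of _ "{..<m} \<times> {..<m}"]) auto
  ultimately obtain rd where rd: "inj_on rd diags" "rd ` diags \<subseteq> {(k, k'). k < k' \<and> k' < m}"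
    by (rule injection_if_card_le[OF fin(2)])
  have "card offs \<le> 2 * card P" unfolding offs_def by (rule un[OF finP])
  also have "\<dots> = q * (q - 1)" unfolding P_def by (rule card_less_pairs)
  also have "\<dots> \<le> card ({..<m} \<times> {..<m})" using m by (simp, intro mult_le_mono) auto
  finally obtain ro where ro: "inj_on ro offs" "ro ` offs \<subseteq> {..<m} \<times> {..<m}"
    by (rule injection_if_card_le[OF fin(3)]) auto
  obtain rz :: "real \<Rightarrow> nat" where rz: "inj_on rz weights"
    using finite_imp_inj_to_nat_seg[OF fin(1)] by blast
  have "\<exists>w. w < q \<and> A w i \<noteq> A w i'" if "i < q" "i' < q" "i \<noteq> i'" for i i' using dist[OF that] by auto
  then obtain jt where jt: "\<And>i i'. i < q \<Longrightarrow> i' < q \<Longrightarrow> i \<noteq> i' \<Longrightarrow> jt i i' < q \<and> A (jt i i') i \<noteq> A (jt i i') i'"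
    by metis
  have "\<exists>w G. (\<forall>j<q - 1. w j < q) \<and> (\<forall>i\<le>q - 1. multiaffine {..<q - 1} (G i)) \<and>
    (\<forall>i\<le>q - 1. \<forall>t\<le>q - 1. G i (\<lambda>j. A (w j) t) = (if i = t then 1 else (0::real)))"
    by (rule lagrange_testers[OF dist]) (use q in auto)
  then obtain w G where w: "\<forall>j<q - 1. w j < q" and G: "\<forall>i\<le>q - 1. multiaffine {..<q - 1} (G i)"
    and L: "\<forall>i\<le>q - 1. \<forall>t\<le>q - 1. G i (\<lambda>j. A (w j) t) = (if i = t then 1 else (0::real))"
    by (elim exE conjE)
  interpret sp: separating_polynomial q m a A weights diags offs G ro rd rz jt
    by unfold_locales (use q m sym fin G ro rd rz jt in auto)
  have off: "A i j \<in> offs" "B i j \<in> offs" if "i < q" "j < q" "i \<noteq> j" for i j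
  proof -
    have P: "C i j \<in> (\<lambda>(i, j). C i j) ` P" if "C i j = C j i" for C :: "nat \<Rightarrow> nat \<Rightarrow> real"
    proof -
      have "(i, j) \<in> P \<or> (j, i) \<in> P" using \<open>i < q\<close> \<open>j < q\<close> \<open>i \<noteq> j\<close> by (auto simp: P_def)
      then show ?thesis
      proof
        assume "(i, j) \<in> P"
        then show ?thesis by (intro image_eqI[of _ _ "(i, j)"]) simp_all
      next
        assume "(j, i) \<in> P"
        then show ?thesis by (intro image_eqI[of _ _ "(j, i)"]) (simp_all only: that split)
      qed
    qed
    show "A i j \<in> offs" "B i j \<in> offs" unfolding offs_def
      using P[of A, OF sym(1)[of i j]] P[of B, OF sym(2)[of i j]] by simp_all
  qed
  interpret wa: weighted_matrix q m a A weights diags offs G ro rd rz jt a A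
    by unfold_locales (use a sym off in \<open>auto simp: less_imp_le weights_def diags_def\<close>)
  interpret wb: weighted_matrix q m a A weights diags offs G ro rd rz jt b B
    by unfold_locales (use b sym off in \<open>auto simp: weights_def diags_def\<close>)
  let ?V = "sp.roots \<union> sp.leaves"
  have "card sp.Iweight = (\<Sum>i<q - 1. card (weights - {a i}))"
    unfolding sp.Iweight_def using fin by simp
  also have "\<dots> \<le> (\<Sum>i<q - 1. 2 * q - 1)"
  proof (rule sum_mono)
    fix i assume "i \<in> {..<q - 1}"
    then have "a i \<in> weights" unfolding weights_def by auto
    then show "card (weights - {a i}) \<le> 2 * q - 1" using card_w by (simp add: card_Diff_singleton)
  qed
  finally have "card sp.Iweight \<le> (q - 1) * (2 * q - 1)" by simp
  moreover have "card sp.leaves \<le> card sp.Iweight"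
    unfolding sp.leaves_def by (rule card_image_le[OF sp.fin_I(3)])
  moreover have "card sp.roots \<le> q * m + q * (q - 1)"
  proof -
    have "card ((\<lambda>(i, k). vV i k) ` ({..<q} \<times> {..<m})) \<le> q * m"
      using card_image_le[of "{..<q} \<times> {..<m}" "\<lambda>(i, k). vV i k"] by simp
    moreover have "card ((\<lambda>(i, k). vW i k) ` ({..<q} \<times> {..<q - 1})) \<le> q * (q - 1)"
      using card_image_le[of "{..<q} \<times> {..<q - 1}" "\<lambda>(i, k). vW i k"] by simp
    ultimately show ?thesis unfolding sp.roots_def
      by (intro order_trans[OF card_Un_le] add_mono)
  qed
  ultimately have "card ?V \<le> q * m + q * (q - 1) + (q - 1) * (2 * q - 1)"
    using card_Un_le[of sp.roots sp.leaves] by linarith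
  also have "\<dots> \<le> q * (q + 2) + q * (q - 1) + (q - 1) * (2 * q - 1)"
    by (intro add_mono mult_le_mono order_refl m(3))
  \<comment> \<open>The left-hand side equals \<open>4 * q\<^sup>2 - 2 * q + 1\<close>.\<close>
  also have "\<dots> \<le> 4 * q\<^sup>2 - q"
  proof -
    obtain n where "q = Suc n" using q by (cases q) auto
    then show ?thesis by (simp add: power2_eq_square algebra_simps)
  qed
  finally have card_V: "card ?V \<le> 4 * q\<^sup>2 - q" .
  have "step_density q b B ?V F = step_density q a A ?V F" if "F \<subseteq> sp.all_edges" for F
    using that card_V sp.fin_V by (intro dens) (auto simp: simple_graph_def sp.all_edges_def)
  from step_density_multiaffine[OF sp.full_multiaffine this]
  have eq: "(\<Sum>\<sigma>\<in>sp.roots \<rightarrow>\<^sub>E {..<q}. wb.root_term \<sigma>) = (\<Sum>\<sigma>\<in>sp.roots \<rightarrow>\<^sub>E {..<q}. wa.root_term \<sigma>)"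
    unfolding wa.sum_eq_root_terms wb.sum_eq_root_terms .
  \<comment> \<open>The positive term: clones get the type of their group, testers the types chosen
    by \<open>lagrange_testers\<close>. Decoding the tag of a vertex tells the two kinds
    apart.\<close>
  define \<sigma>0 where "\<sigma>0 = (\<lambda>v\<in>sp.roots. case from_nat v :: nat \<times> nat \<times> nat of (t, i, k) \<Rightarrow> if t = 0 then i else w k)"
  have \<sigma>V: "\<sigma>0 (vV i k) = i" if "i < q" "k < m" for i k
    using sp.vV_roots[OF that] by (simp add: \<sigma>0_def vV_def)
  have \<sigma>W: "\<sigma>0 (vW l j) = w j" if "l < q" "j < q - 1" for l j
    using sp.vW_roots[OF that] by (simp add: \<sigma>0_def vW_def)
  have \<sigma>0: "\<sigma>0 \<in> sp.roots \<rightarrow>\<^sub>E {..<q}"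
  proof (rule PiE_I)
    fix v assume "v \<in> sp.roots"
    then show "\<sigma>0 v \<in> {..<q}" unfolding sp.roots_def using \<sigma>V \<sigma>W w by auto
  qed (simp add: \<sigma>0_def)
  have "wa.root_term \<sigma>0 > 0"
  proof (rule wa.root_term_pos[OF \<sigma>0 \<sigma>V])
    fix l i t assume "l < q" "i < q" "t < q"
    have "G i (\<lambda>j. A (\<sigma>0 (vW l j)) t) = G i (\<lambda>j. A (w j) t)"
      by (rule multiaffine_cong_var[of "{..<q - 1}"]) (use G \<open>i < q\<close> \<open>l < q\<close> \<sigma>W in auto)
    then show "G i (\<lambda>j. A (\<sigma>0 (vW l j)) t) = (if i = t then 1 else 0)"
      using L \<open>i < q\<close> \<open>t < q\<close> by simp
  qed (use a in auto)
  moreover have "finite (sp.roots \<rightarrow>\<^sub>E {..<q})" using sp.fin_V by (intro finite_PiE) auto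
  ultimately have "(\<Sum>\<sigma>\<in>sp.roots \<rightarrow>\<^sub>E {..<q}. wa.root_term \<sigma>) > 0"
    using \<sigma>0 wa.root_term_nonneg_iso(1) by (intro sum_pos2[of _ \<sigma>0]) auto
  then have "(\<Sum>\<sigma>\<in>sp.roots \<rightarrow>\<^sub>E {..<q}. wb.root_term \<sigma>) \<noteq> 0" using eq by simp
  then obtain \<sigma> where "\<sigma> \<in> sp.roots \<rightarrow>\<^sub>E {..<q}" "wb.root_term \<sigma> \<noteq> 0"
    by (meson sum.neutral)
  then obtain \<pi> where \<pi>: "bij_betw \<pi> {..<q} {..<q}" "\<forall>i<q. \<forall>j<q. B (\<pi> i) (\<pi> j) = A i j"
    and bp: "\<forall>i<q - 1. b (\<pi> i) = a i"
    using wb.root_term_nonneg_iso(2) by blast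
  \<comment> \<open>The polynomial checks \<open>q - 1\<close> weights; the last one follows because
    both families sum to 1.\<close>
  have "(\<Sum>i<q. b (\<pi> i)) = (\<Sum>i<q. a i)"
    using sum.reindex_bij_betw[OF \<pi>(1), of b] a b by simp
  moreover have "{..<q} = insert (q - 1) {..<q - 1}" using q by auto
  ultimately have "b (\<pi> (q - 1)) = a (q - 1)" using bp by simp
  then have "b (\<pi> i) = a i" if "i < q" for i
    using bp that by (cases "i = q - 1") auto
  then show thesis using \<pi> by (intro that) auto
qed

section \<open>Sampling\<close>

definition kernel_value :: "('a \<times> 'a \<Rightarrow> real) \<Rightarrow> (nat \<Rightarrow> 'a) \<Rightarrow> nat set \<Rightarrow> real" where
  "kernel_value g x e = g (x (Min e), x (Max e))"

text \<open>A copy of \<^locale>\<open>prob_space\<close>, since \<^locale>\<open>prob_space\<close> itself cannot have its product as a sublocale.\<close>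

locale sampling_space = prob_space M for M :: "'a measure"

sublocale sampling_space \<subseteq> pair: pair_prob_space M M ..

sublocale sampling_space \<subseteq> product: product_prob_space "\<lambda>_. M" UNIV ..

context sampling_space
begin

lemma prob_space_power: "prob_space (Pi\<^sub>M V (\<lambda>_. M))"
  by (intro prob_space_PiM prob_space_axioms)

definition hom :: "('a \<times> 'a \<Rightarrow> real) \<Rightarrow> nat set \<Rightarrow> nat set set \<Rightarrow> real" where
  "hom g V E = (\<integral>x. (\<Prod>e\<in>E. kernel_value g x e) \<partial>Pi\<^sub>M V (\<lambda>_. M))"

text \<open>Different coordinates of the power are independent. This carries null sets of pairs over
  to finite powers along an edge; with equal coordinates it would fail, since the diagonal can be a
  null set.\<close>

lemma distr_two_components:
  assumes "finite V" "i \<in> V" "j \<in> V" "i \<noteq> j"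
  shows "distr (Pi\<^sub>M V (\<lambda>_. M)) (M \<Otimes>\<^sub>M M) (\<lambda>x. (x i, x j)) = M \<Otimes>\<^sub>M M"
proof (rule sym, rule pair_measure_eqI)
  have meas: "(\<lambda>x. (x i, x j)) \<in> measurable (Pi\<^sub>M V (\<lambda>_. M)) (M \<Otimes>\<^sub>M M)"
    using assms by measurable
  fix A B assume A: "A \<in> sets M" and B: "B \<in> sets M"
  let ?F = "\<lambda>k. if k = i then A else if k = j then B else space M"
  have F: "?F k \<in> sets M" for k using A B by auto
  have "emeasure (distr (Pi\<^sub>M V (\<lambda>_. M)) (M \<Otimes>\<^sub>M M) (\<lambda>x. (x i, x j))) (A \<times> B) =
    emeasure (Pi\<^sub>M V (\<lambda>_. M)) ((\<lambda>x. (x i, x j)) -` (A \<times> B) \<inter> space (Pi\<^sub>M V (\<lambda>_. M)))"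
    using A B by (intro emeasure_distr meas) auto
  also have "(\<lambda>x. (x i, x j)) -` (A \<times> B) \<inter> space (Pi\<^sub>M V (\<lambda>_. M)) = Pi\<^sub>E V ?F"
  proof (intro equalityI subsetI)
    fix x assume "x \<in> (\<lambda>x. (x i, x j)) -` (A \<times> B) \<inter> space (Pi\<^sub>M V (\<lambda>_. M))"
    then show "x \<in> Pi\<^sub>E V ?F" by (auto simp: space_PiM PiE_iff)
  next
    fix x assume x: "x \<in> Pi\<^sub>E V ?F"
    have "x k \<in> space M" if "k \<in> V" for k
      using PiE_mem[OF x that] sets.sets_into_space[OF F[of k]] by blast
    moreover have "x i \<in> A" "x j \<in> B"
      using PiE_mem[OF x assms(2)] PiE_mem[OF x assms(3)] assms(4) by auto
    ultimately show "x \<in> (\<lambda>x. (x i, x j)) -` (A \<times> B) \<inter> space (Pi\<^sub>M V (\<lambda>_. M))"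
      using x by (auto simp: space_PiM PiE_iff)
  qed
  also have "emeasure (Pi\<^sub>M V (\<lambda>_. M)) (Pi\<^sub>E V ?F) = (\<Prod>k\<in>V. emeasure M (?F k))"
    using assms(1) F by (intro product.emeasure_PiM) auto
  also have "\<dots> = (\<Prod>k\<in>{i, j}. emeasure M (?F k))"
    using assms by (intro prod.mono_neutral_right) (auto simp: emeasure_space_1)
  also have "\<dots> = emeasure M A * emeasure M B" using assms by simp
  finally show "emeasure M A * emeasure M B =
    emeasure (distr (Pi\<^sub>M V (\<lambda>_. M)) (M \<Otimes>\<^sub>M M) (\<lambda>x. (x i, x j))) (A \<times> B)" by simp
qed (auto intro: sigma_finite_measure_axioms)

lemma AE_two_components:
  assumes "finite V" "i \<in> V" "j \<in> V" "i \<noteq> j" and P: "AE z in M \<Otimes>\<^sub>M M. P z"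
  shows "AE x in Pi\<^sub>M V (\<lambda>_. M). P (x i, x j)"
proof -
  have meas: "(\<lambda>x. (x i, x j)) \<in> measurable (Pi\<^sub>M V (\<lambda>_. M)) (M \<Otimes>\<^sub>M M)"
    using assms by measurable
  from P obtain N where N: "N \<in> null_sets (M \<Otimes>\<^sub>M M)" "{z \<in> space (M \<Otimes>\<^sub>M M). \<not> P z} \<subseteq> N"
    by (auto elim!: AE_E simp: null_sets_def)
  have "AE z in distr (Pi\<^sub>M V (\<lambda>_. M)) (M \<Otimes>\<^sub>M M) (\<lambda>x. (x i, x j)). z \<notin> N"
    unfolding distr_two_components[OF assms(1-4)] using N(1) by (rule AE_not_in)
  then have "AE x in Pi\<^sub>M V (\<lambda>_. M). (x i, x j) \<notin> N"
    using meas N(1) by (subst (asm) AE_distr_iff) auto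
  moreover have "AE x in Pi\<^sub>M V (\<lambda>_. M). (x i, x j) \<in> space (M \<Otimes>\<^sub>M M)"
    using measurable_space[OF meas] by auto
  ultimately show ?thesis by eventually_elim (use N(2) in auto)
qed

lemma min_max_edge:
  assumes "e \<subseteq> V" "card e = (2::nat)"
  shows "Min e \<in> V" "Max e \<in> V" "Min e \<noteq> (Max e :: nat)"
proof -
  obtain u v where e: "e = {u, v}" "u \<noteq> v" using assms(2) by (meson card_2_iff)
  then show "Min e \<in> V" "Max e \<in> V" "Min e \<noteq> Max e"
    using assms(1) by (cases "u \<le> v"; auto simp: min_def max_def)+
qed

lemma hom_cong_AE:
  assumes VE: "simple_graph V E" and gh: "AE z in M \<Otimes>\<^sub>M M. g z = h z"
  shows "AE x in Pi\<^sub>M V (\<lambda>_. M). (\<Prod>e\<in>E. kernel_value g x e) = (\<Prod>e\<in>E. kernel_value h x e)"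
proof -
  have fin: "finite V" "finite E"
    using VE finite_subset[of E "Pow V"] unfolding simple_graph_def by auto
  have "AE x in Pi\<^sub>M V (\<lambda>_. M). \<forall>e\<in>E. kernel_value g x e = kernel_value h x e"
  proof (intro AE_finite_allI fin)
    fix e assume "e \<in> E"
    then have "e \<subseteq> V" "card e = 2" using VE unfolding simple_graph_def by auto
    then show "AE x in Pi\<^sub>M V (\<lambda>_. M). kernel_value g x e = kernel_value h x e"
      unfolding kernel_value_def
      by (intro AE_two_components[OF fin(1), where P = "\<lambda>z. g z = h z"] min_max_edge gh)
  qed
  then show ?thesis by eventually_elim (auto intro: prod.cong)
qed

lemma kernel_value_measurable:
  assumes "simple_graph V E" "e \<in> E" "g \<in> borel_measurable (M \<Otimes>\<^sub>M M)"
  shows "(\<lambda>x. kernel_value g x e) \<in> borel_measurable (Pi\<^sub>M V (\<lambda>_. M))"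
proof -
  have "e \<subseteq> V" "card e = 2" using assms unfolding simple_graph_def by auto
  note min_max_edge(1,2)[OF this, measurable] and assms(3)[measurable]
  show ?thesis unfolding kernel_value_def by measurable
qed

lemma kernel_value_prod_integrable:
  assumes VE: "simple_graph V E" and g: "g \<in> borel_measurable (M \<Otimes>\<^sub>M M)"
    and bound: "\<And>x y. x \<in> space M \<Longrightarrow> y \<in> space M \<Longrightarrow> \<bar>g (x, y)\<bar> \<le> C"
  shows "integrable (Pi\<^sub>M V (\<lambda>_. M)) (\<lambda>x. \<Prod>e\<in>E. kernel_value g x e)"
proof -
  interpret V: prob_space "Pi\<^sub>M V (\<lambda>_. M)" by (rule prob_space_power)
  show ?thesis
  proof (rule V.integrable_const_bound[of _ "C ^ card E"])
    show "(\<lambda>x. \<Prod>e\<in>E. kernel_value g x e) \<in> borel_measurable (Pi\<^sub>M V (\<lambda>_. M))"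
      using kernel_value_measurable[OF VE _ g] by (intro borel_measurable_prod) auto
    show "AE x in Pi\<^sub>M V (\<lambda>_. M). norm (\<Prod>e\<in>E. kernel_value g x e) \<le> C ^ card E"
    proof (rule AE_I2)
      fix x assume x: "x \<in> space (Pi\<^sub>M V (\<lambda>_. M))"
      have "(\<Prod>e\<in>E. \<bar>kernel_value g x e\<bar>) \<le> (\<Prod>e\<in>E. C)"
      proof (rule prod_mono)
        fix e assume "e \<in> E"
        then have "e \<subseteq> V" "card e = 2" using VE unfolding simple_graph_def by auto
        note m = min_max_edge(1,2)[OF this]
        show "0 \<le> \<bar>kernel_value g x e\<bar> \<and> \<bar>kernel_value g x e\<bar> \<le> C"
          unfolding kernel_value_def using x m by (auto simp: space_PiM PiE_iff intro: bound)
      qed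
      then show "norm (\<Prod>e\<in>E. kernel_value g x e) \<le> C ^ card E" by (simp add: abs_prod)
    qed
  qed
qed

text \<open>A labelling instead of a partition: labels below \<open>q\<close> may be taken on null
  sets only, or never, so kernels with fewer than \<open>q\<close> steps are included.\<close>

definition step_type :: "nat \<Rightarrow> ('a \<Rightarrow> nat) \<Rightarrow> bool" where
  "step_type q \<tau> \<longleftrightarrow> \<tau> \<in> measurable M (count_space UNIV) \<and> (\<forall>x\<in>space M. \<tau> x < q)"

definition type_weight :: "('a \<Rightarrow> nat) \<Rightarrow> nat \<Rightarrow> real" where
  "type_weight \<tau> i = measure M {x\<in>space M. \<tau> x = i}"

lemma type_weight_sum:
  assumes "step_type q \<tau>"
  shows "(\<Sum>i<q. type_weight \<tau> i) = 1"
proof -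
  have [measurable]: "\<tau> \<in> measurable M (count_space UNIV)" using assms unfolding step_type_def by auto
  have "(\<Sum>i<q. type_weight \<tau> i) = measure M (\<Union>i<q. {x\<in>space M. \<tau> x = i})"
    unfolding type_weight_def
    by (intro finite_measure_finite_Union[symmetric]) (auto simp: disjoint_family_on_def)
  also have "(\<Union>i<q. {x\<in>space M. \<tau> x = i}) = space M" using assms unfolding step_type_def by auto
  finally show ?thesis by (simp add: prob_space)
qed

text \<open>Sorting the sample points by type writes the integrand as a finite sum of constants
  times products of indicators, and each such product integrates to the product of the type
  weights.\<close>

lemma hom_step:
  assumes VE: "simple_graph V E" and \<tau>: "step_type q \<tau>"
    and g: "AE z in M \<Otimes>\<^sub>M M. g z = A (\<tau> (fst z)) (\<tau> (snd z))" "g \<in> borel_measurable (M \<Otimes>\<^sub>M M)"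
  shows "hom g V E = step_density q (type_weight \<tau>) A V E"
proof -
  have \<tau>m [measurable]: "\<tau> \<in> measurable M (count_space UNIV)" using \<tau> unfolding step_type_def by auto
  have fin: "finite V" using VE unfolding simple_graph_def by auto
  let ?M = "Pi\<^sub>M V (\<lambda>_. M)"
  let ?h = "\<lambda>z. A (\<tau> (fst z)) (\<tau> (snd z))"
  have h [measurable]: "?h \<in> borel_measurable (M \<Otimes>\<^sub>M M)"
    by measurable
  let ?S = "V \<rightarrow>\<^sub>E {..<q}"
  define f where "f \<sigma> = (\<Prod>e\<in>E. edge_value A \<sigma> e)" for \<sigma>
  have finS: "finite ?S" using fin by (intro finite_PiE) auto
  have "hom g V E = (\<integral>x. (\<Prod>e\<in>E. kernel_value ?h x e) \<partial>?M)"
    unfolding hom_def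
    by (intro integral_cong_AE hom_cong_AE[OF VE] g borel_measurable_prod kernel_value_measurable[OF VE] h) auto
  also have "\<dots> = (\<integral>x. (\<Sum>\<sigma>\<in>?S. f \<sigma> * (\<Prod>v\<in>V. indicator {y\<in>space M. \<tau> y = \<sigma> v} (x v))) \<partial>?M)"
  proof (rule Bochner_Integration.integral_cong[OF refl])
    fix x assume x: "x \<in> space ?M"
    define \<sigma>x where "\<sigma>x = (\<lambda>v\<in>V. \<tau> (x v))"
    have mem: "\<sigma>x \<in> ?S" using x \<tau> by (auto simp: \<sigma>x_def space_PiM PiE_iff step_type_def)
    have ind: "(\<Prod>v\<in>V. indicator {y\<in>space M. \<tau> y = \<sigma> v} (x v)) = (if \<sigma> = \<sigma>x then 1 else (0::real))"
      if \<sigma>: "\<sigma> \<in> ?S" for \<sigma>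
    proof (cases "\<sigma> = \<sigma>x")
      case True
      then show ?thesis using x by (auto simp: \<sigma>x_def space_PiM PiE_iff intro!: prod.neutral)
    next
      case False
      then obtain v where "v \<in> V" "\<sigma> v \<noteq> \<tau> (x v)"
        using PiE_ext[OF \<sigma> mem] by (auto simp: \<sigma>x_def)
      then show ?thesis using fin False by (auto intro!: prod_zero bexI[of _ v])
    qed
    have "(\<Sum>\<sigma>\<in>?S. f \<sigma> * (\<Prod>v\<in>V. indicator {y\<in>space M. \<tau> y = \<sigma> v} (x v))) =
      (\<Sum>\<sigma>\<in>?S. if \<sigma> = \<sigma>x then f \<sigma> else 0)"
      by (intro sum.cong refl) (simp add: ind)
    also have "\<dots> = f \<sigma>x" using mem finS by simp
    also have "\<dots> = (\<Prod>e\<in>E. kernel_value ?h x e)"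
      unfolding f_def
    proof (rule prod.cong[OF refl])
      fix e assume "e \<in> E"
      then have "e \<subseteq> V" "card e = 2" using VE unfolding simple_graph_def by auto
      from min_max_edge(1,2)[OF this] show "edge_value A \<sigma>x e = kernel_value ?h x e"
        unfolding edge_value_def kernel_value_def \<sigma>x_def by simp
    qed
    finally show "(\<Prod>e\<in>E. kernel_value ?h x e) =
      (\<Sum>\<sigma>\<in>?S. f \<sigma> * (\<Prod>v\<in>V. indicator {y\<in>space M. \<tau> y = \<sigma> v} (x v)))" by simp
  qed
  also have "\<dots> = (\<Sum>\<sigma>\<in>?S. f \<sigma> * (\<integral>x. (\<Prod>v\<in>V. indicator {y\<in>space M. \<tau> y = \<sigma> v} (x v)) \<partial>?M))"
    using fin by (subst Bochner_Integration.integral_sum)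
      (auto intro!: integrable_mult_right product.product_integrable_prod simp: emeasure_eq_measure)
  also have "\<dots> = (\<Sum>\<sigma>\<in>?S. f \<sigma> * (\<Prod>v\<in>V. type_weight \<tau> (\<sigma> v)))"
  proof (rule sum.cong[OF refl])
    fix \<sigma>
    have "(\<integral>x. (\<Prod>v\<in>V. indicator {y\<in>space M. \<tau> y = \<sigma> v} (x v)) \<partial>?M) =
      (\<Prod>v\<in>V. (\<integral>y. indicator {y\<in>space M. \<tau> y = \<sigma> v} y \<partial>M) :: real)"
      using fin by (intro product.product_integral_prod) (auto simp: emeasure_eq_measure)
    also have "\<dots> = (\<Prod>v\<in>V. type_weight \<tau> (\<sigma> v))"
      unfolding type_weight_def by (intro prod.cong refl) (auto simp: Int_def intro!: arg_cong[where f = prob])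
    finally show "f \<sigma> * (\<integral>x. (\<Prod>v\<in>V. indicator {y\<in>space M. \<tau> y = \<sigma> v} (x v)) \<partial>?M) =
      f \<sigma> * (\<Prod>v\<in>V. type_weight \<tau> (\<sigma> v))" by simp
  qed
  also have "\<dots> = step_density q (type_weight \<tau>) A V E"
    unfolding step_density_def f_def by (simp add: mult.commute)
  finally show ?thesis .
qed

text \<open>On the left stands a kernel known only through its densities, on the right a finite sum
  over types, where vanishing can be verified term by term. The two agree monomial by monomial,
  every monomial being a graph on the same vertices.\<close>

lemma integral_multiaffine:
  assumes \<Phi>: "multiaffine E \<Phi>" and VE: "simple_graph V E" and g: "g \<in> borel_measurable (M \<Otimes>\<^sub>M M)"
    and bound: "\<And>x y. x \<in> space M \<Longrightarrow> y \<in> space M \<Longrightarrow> \<bar>g (x, y)\<bar> \<le> C"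
    and dens: "\<And>F. F \<subseteq> E \<Longrightarrow> hom g V F = step_density q a A V F"
  shows "(\<integral>x. \<Phi> (kernel_value g x) \<partial>Pi\<^sub>M V (\<lambda>_. M)) =
    (\<Sum>\<sigma>\<in>V \<rightarrow>\<^sub>E {..<q}. (\<Prod>v\<in>V. a (\<sigma> v)) * \<Phi> (edge_value A \<sigma>))"
proof -
  obtain c where c: "\<And>X. \<Phi> X = (\<Sum>F\<in>Pow E. c F * (\<Prod>e\<in>F. X e))"
    using \<Phi> unfolding multiaffine_def by metis
  have sub: "simple_graph V F" if "F \<subseteq> E" for F using VE that unfolding simple_graph_def by auto
  have "(\<integral>x. \<Phi> (kernel_value g x) \<partial>Pi\<^sub>M V (\<lambda>_. M)) = (\<Sum>F\<in>Pow E. c F * hom g V F)"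
    unfolding c hom_def
    by (subst Bochner_Integration.integral_sum)
      (auto intro!: integrable_mult_right kernel_value_prod_integrable[OF sub g bound])
  also have "\<dots> = (\<Sum>F\<in>Pow E. c F * step_density q a A V F)" using dens by simp
  also have "\<dots> = (\<Sum>\<sigma>\<in>V \<rightarrow>\<^sub>E {..<q}. (\<Prod>v\<in>V. a (\<sigma> v)) * \<Phi> (edge_value A \<sigma>))"
    unfolding c step_density_def by (simp add: sum_distrib_left mult_ac) (rule sum.swap)
  finally show ?thesis .
qed

end

section \<open>Kernels with finitely many classes\<close>

locale bounded_kernel = sampling_space M for M :: "'a measure" +
  fixes g :: "'a \<times> 'a \<Rightarrow> real" and C :: real
  assumes g_meas [measurable]: "g \<in> borel_measurable (M \<Otimes>\<^sub>M M)"
    and g_bound: "x \<in> space M \<Longrightarrow> y \<in> space M \<Longrightarrow> \<bar>g (x, y)\<bar> \<le> C"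
    and g_sym: "x \<in> space M \<Longrightarrow> y \<in> space M \<Longrightarrow> g (x, y) = g (y, x)"
begin

lemma bounded_integrable:
  fixes f :: "'a \<Rightarrow> real"
  assumes "f \<in> borel_measurable M" "\<And>x. x \<in> space M \<Longrightarrow> \<bar>f x\<bar> \<le> B"
  shows "integrable M f"
  using assms by (intro integrable_const_bound[of _ B]) auto

lemma bounded_integrable_pair:
  fixes f :: "'a \<times> 'a \<Rightarrow> real"
  assumes "f \<in> borel_measurable (M \<Otimes>\<^sub>M M)" "\<And>x y. x \<in> space M \<Longrightarrow> y \<in> space M \<Longrightarrow> \<bar>f (x, y)\<bar> \<le> B"
  shows "integrable (M \<Otimes>\<^sub>M M) f"
  using assms by (intro pair.P.integrable_const_bound[of _ B]) (auto simp: space_pair_measure)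

lemma integral_abs_le:
  fixes f :: "'a \<Rightarrow> real"
  assumes "f \<in> borel_measurable M" "\<And>x. x \<in> space M \<Longrightarrow> \<bar>f x\<bar> \<le> B"
  shows "\<bar>\<integral>x. f x \<partial>M\<bar> \<le> B"
proof -
  have "\<bar>\<integral>x. f x \<partial>M\<bar> \<le> (\<integral>x. \<bar>f x\<bar> \<partial>M)" by (rule integral_abs_bound)
  also have "\<dots> \<le> (\<integral>x. B \<partial>M)"
    using bounded_integrable[OF assms] assms(2) by (intro integral_mono) auto
  finally show ?thesis by (simp add: prob_space)
qed

lemma swap_integral:
  fixes f :: "'a \<Rightarrow> 'a \<Rightarrow> real"
  assumes "case_prod f \<in> borel_measurable (M \<Otimes>\<^sub>M M)"
    "\<And>x y. x \<in> space M \<Longrightarrow> y \<in> space M \<Longrightarrow> \<bar>f x y\<bar> \<le> B"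
  shows "(\<integral>x. (\<integral>y. f x y \<partial>M) \<partial>M) = (\<integral>y. (\<integral>x. f x y \<partial>M) \<partial>M)"
  using pair.Fubini_integral[of f] bounded_integrable_pair[of "case_prod f" B] assms by simp

lemma C_nonneg: "0 \<le> C"
proof -
  obtain x where "x \<in> space M" using not_empty by blast
  then show ?thesis using g_bound[of x x] by linarith
qed

definition K :: "'a \<Rightarrow> 'a \<Rightarrow> real" where
  "K x z = (\<integral>u. g (x, u) * g (u, z) \<partial>M)"

lemma K_meas [measurable]: "case_prod K \<in> borel_measurable (M \<Otimes>\<^sub>M M)"
  unfolding K_def by measurable

lemma gg_bound: "x \<in> space M \<Longrightarrow> u \<in> space M \<Longrightarrow> z \<in> space M \<Longrightarrow> \<bar>g (x, u) * g (u, z)\<bar> \<le> C * C"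
  using g_bound[of x u] g_bound[of u z] C_nonneg unfolding abs_mult by (intro mult_mono) auto

lemma K_bound: "x \<in> space M \<Longrightarrow> z \<in> space M \<Longrightarrow> \<bar>K x z\<bar> \<le> C * C"
  unfolding K_def by (intro integral_abs_le gg_bound) measurable

definition kdist :: "'a \<Rightarrow> 'a \<Rightarrow> real" where
  "kdist x y = (\<integral>z. (K x z - K y z)\<^sup>2 \<partial>M)"

lemma kdist_meas [measurable]: "case_prod kdist \<in> borel_measurable (M \<Otimes>\<^sub>M M)"
  unfolding kdist_def by measurable

lemma K_diff_bound:
  assumes "x \<in> space M" "y \<in> space M" "z \<in> space M"
  shows "\<bar>K x z - K y z\<bar> \<le> 2 * (C * C)"
  using K_bound[of x z] K_bound[of y z] assms by linarith

lemma kdist_nonneg: "0 \<le> kdist x y"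
  unfolding kdist_def by simp

lemma kdist_bound:
  assumes "x \<in> space M" "y \<in> space M"
  shows "\<bar>kdist x y\<bar> \<le> (2 * (C * C))\<^sup>2"
  unfolding kdist_def
proof (rule integral_abs_le)
  show "(\<lambda>z. (K x z - K y z)\<^sup>2) \<in> borel_measurable M" using assms by measurable
  show "\<bar>(K x z - K y z)\<^sup>2\<bar> \<le> (2 * (C * C))\<^sup>2" if "z \<in> space M" for z
    using power_mono[OF K_diff_bound[OF assms that] abs_ge_zero, of 2] by simp
qed

lemma kdist_eq_0_iff:
  assumes "x \<in> space M" "y \<in> space M"
  shows "kdist x y = 0 \<longleftrightarrow> (AE z in M. K x z = K y z)"
proof -
  have "integrable M (\<lambda>z. (K x z - K y z)\<^sup>2)"
  proof (rule bounded_integrable)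
    show "(\<lambda>z. (K x z - K y z)\<^sup>2) \<in> borel_measurable M" using assms by measurable
    show "\<bar>(K x z - K y z)\<^sup>2\<bar> \<le> (2 * (C * C))\<^sup>2" if "z \<in> space M" for z
      using power_mono[OF K_diff_bound[OF assms that] abs_ge_zero, of 2] by simp
  qed
  then show ?thesis unfolding kdist_def by (subst integral_nonneg_eq_0_iff_AE) auto
qed

text \<open>The two factors of the square are integrated over different middle vertices
  \<open>u\<close> and \<open>w\<close>, joined only through \<open>z\<close>. In this form no edge
  occurs twice, unlike in the square of \<open>g (x, u) - g (y, u)\<close>.\<close>

lemma kdist_expand:
  assumes x: "x \<in> space M" "y \<in> space M"
  shows "kdist x y = (\<integral>z. (\<integral>u. (g (x, u) - g (y, u)) * g (u, z) \<partial>M) * (\<integral>w. g (z, w) * (g (x, w) - g (y, w)) \<partial>M) \<partial>M)"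
  unfolding kdist_def
proof (rule Bochner_Integration.integral_cong[OF refl])
  fix z assume z: "z \<in> space M"
  have int: "integrable M (\<lambda>u. g (v, u) * g (u, z))" if "v \<in> space M" for v
    using that z by (intro bounded_integrable[OF _ gg_bound]) auto
  have 1: "(\<integral>u. (g (x, u) - g (y, u)) * g (u, z) \<partial>M) = K x z - K y z"
    unfolding K_def left_diff_distrib
    by (rule Bochner_Integration.integral_diff) (intro int x)+
  have "(\<integral>w. g (z, w) * (g (x, w) - g (y, w)) \<partial>M) = (\<integral>u. (g (x, u) - g (y, u)) * g (u, z) \<partial>M)"
    by (intro Bochner_Integration.integral_cong refl) (simp add: g_sym[OF _ z] mult.commute)
  then show "(K x z - K y z)\<^sup>2 = (\<integral>u. (g (x, u) - g (y, u)) * g (u, z) \<partial>M) *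
      (\<integral>w. g (z, w) * (g (x, w) - g (y, w)) \<partial>M)"
    using 1 by (simp add: power2_eq_square)
qed

text \<open>The integrand that one pair of points contributes to the polynomial. The outer vertices
  \<open>u0\<close> and \<open>u2\<close> are integrated out first, giving the two inner integrals
  of \<open>kdist_expand\<close> at the middle vertex \<open>u1\<close>.\<close>

lemma path_integral:
  assumes x: "x \<in> space M" "y \<in> space M" and u: "distinct [u0, u1, u2]"
  shows "(\<integral>v. (g (x, v u0) - g (y, v u0)) * g (v u0, v u1) * (g (v u1, v u2) * (g (x, v u2) - g (y, v u2)))
      \<partial>Pi\<^sub>M {u0, u1, u2} (\<lambda>_. M)) = kdist x y" (is "integral\<^sup>L _ ?F = _")
proof -
  note x [measurable]
  have meas: "?F \<in> borel_measurable (Pi\<^sub>M I (\<lambda>_. M))" if "{u0, u1, u2} \<subseteq> I" for I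
  proof -
    have [measurable]: "u0 \<in> I" "u1 \<in> I" "u2 \<in> I" using that by auto
    show ?thesis by measurable
  qed
  let ?B = "(2 * C) * C * (C * (2 * C))"
  have bnd: "\<bar>(g (x, a) - g (y, a)) * g (a, b) * (g (b, c) * (g (x, c) - g (y, c)))\<bar> \<le> ?B"
    if "a \<in> space M" "b \<in> space M" "c \<in> space M" for a b c
  proof -
    have "\<bar>g (x, a) - g (y, a)\<bar> \<le> 2 * C" "\<bar>g (x, c) - g (y, c)\<bar> \<le> 2 * C"
      using g_bound[of x a] g_bound[of y a] g_bound[of x c] g_bound[of y c] x that by linarith+
    then show ?thesis unfolding abs_mult
      using that C_nonneg g_bound by (intro mult_mono) auto
  qed
  have int: "integrable (Pi\<^sub>M {u0, u1, u2} (\<lambda>_. M)) ?F"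
  proof -
    interpret V: prob_space "Pi\<^sub>M {u0, u1, u2} (\<lambda>_. M)" by (rule prob_space_power)
    show ?thesis
    proof (rule V.integrable_const_bound[of _ ?B])
      show "AE v in Pi\<^sub>M {u0, u1, u2} (\<lambda>_. M). norm (?F v) \<le> ?B"
        unfolding real_norm_def by (intro AE_I2 bnd) (auto simp: space_PiM PiE_iff)
    qed (rule meas, simp)
  qed
  let ?p = "\<lambda>z. (\<integral>u. (g (x, u) - g (y, u)) * g (u, z) \<partial>M)"
  let ?r = "\<lambda>z. (\<integral>w. g (z, w) * (g (x, w) - g (y, w)) \<partial>M)"
  let ?G = "\<lambda>v. ?p (v u1) * (g (v u1, v u2) * (g (x, v u2) - g (y, v u2)))"
  have "integral\<^sup>L (Pi\<^sub>M {u0, u1, u2} (\<lambda>_. M)) ?F =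
    (\<integral>v. (\<integral>a. ?F (v(u0 := a)) \<partial>M) \<partial>Pi\<^sub>M {u2, u1} (\<lambda>_. M))"
    using product.product_integral_insert[of "{u1, u2}" u0 ?F] u int by (simp add: insert_commute)
  also have "\<dots> = (\<integral>v. ?G v \<partial>Pi\<^sub>M {u2, u1} (\<lambda>_. M))"
  proof (rule Bochner_Integration.integral_cong[OF refl])
    fix v assume "v \<in> space (Pi\<^sub>M {u2, u1} (\<lambda>_. M))"
    have "u1 \<noteq> u0" "u2 \<noteq> u0" using u by auto
    then show "(\<integral>a. ?F (v(u0 := a)) \<partial>M) = ?G v" by simp
  qed
  also have "\<dots> = (\<integral>v. (\<integral>c. ?G (v(u2 := c)) \<partial>M) \<partial>Pi\<^sub>M {u1} (\<lambda>_. M))"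
  proof (rule product.product_integral_insert)
    interpret V: prob_space "Pi\<^sub>M {u2, u1} (\<lambda>_. M)" by (rule prob_space_power)
    have pb: "\<bar>?p b\<bar> \<le> 2 * C * C" if "b \<in> space M" for b
    proof (rule integral_abs_le)
      show "(\<lambda>u. (g (x, u) - g (y, u)) * g (u, b)) \<in> borel_measurable M" using that by measurable
      show "\<bar>(g (x, u) - g (y, u)) * g (u, b)\<bar> \<le> 2 * C * C" if "u \<in> space M" for u
      proof -
        have "\<bar>g (x, u) - g (y, u)\<bar> \<le> 2 * C" using g_bound[of x u] g_bound[of y u] x that by linarith
        then show ?thesis unfolding abs_mult using that \<open>b \<in> space M\<close> C_nonneg g_bound by (intro mult_mono) auto
      qed
    qed
    have b2: "\<bar>?p b * (g (b, c) * (g (x, c) - g (y, c)))\<bar> \<le> ?B" if "b \<in> space M" "c \<in> space M" for b c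
    proof -
      have "\<bar>g (x, c) - g (y, c)\<bar> \<le> 2 * C"
        using g_bound[of x c] g_bound[of y c] x that by linarith
      then show ?thesis unfolding abs_mult[of "?p b"] abs_mult[of "g (b, c)"]
        using that C_nonneg g_bound pb by (intro mult_mono) auto
    qed
    show "integrable (Pi\<^sub>M {u2, u1} (\<lambda>_. M)) ?G"
    proof (rule V.integrable_const_bound[of _ ?B])
      show "AE v in Pi\<^sub>M {u2, u1} (\<lambda>_. M). norm (?G v) \<le> ?B"
        unfolding real_norm_def by (intro AE_I2 b2) (auto simp: space_PiM PiE_iff)
    qed measurable
  qed (use u in auto)
  also have "\<dots> = (\<integral>v. ?p (v u1) * ?r (v u1) \<partial>Pi\<^sub>M {u1} (\<lambda>_. M))"
  proof -
    have "u1 \<noteq> u2" using u by auto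
    then show ?thesis by simp
  qed
  also have "\<dots> = (\<integral>z. ?p z * ?r z \<partial>M)"
    by (rule product.product_integral_singleton) measurable
  also have "\<dots> = kdist x y" using kdist_expand[OF x] by simp
  finally show ?thesis .
qed

end

text \<open>Functions of disjoint blocks of coordinates are independent. Measurability and bounds
  are asked over every index set containing the block, because in the induction a block sits inside
  growing products.\<close>

lemma (in sampling_space) integral_blocks:
  fixes h :: "'p \<Rightarrow> (nat \<Rightarrow> 'a) \<Rightarrow> real"
  assumes "finite P" "\<And>p. p \<in> P \<Longrightarrow> finite (B p)" "disjoint_family_on B P"
    and dep: "\<And>p v w. p \<in> P \<Longrightarrow> (\<And>i. i \<in> B p \<Longrightarrow> v i = w i) \<Longrightarrow> h p v = h p w"
    and meas: "\<And>p I. p \<in> P \<Longrightarrow> B p \<subseteq> I \<Longrightarrow> h p \<in> borel_measurable (Pi\<^sub>M I (\<lambda>_. M))"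
    and bnd: "\<And>p I v. p \<in> P \<Longrightarrow> B p \<subseteq> I \<Longrightarrow> v \<in> space (Pi\<^sub>M I (\<lambda>_. M)) \<Longrightarrow> \<bar>h p v\<bar> \<le> D"
  shows "(\<integral>v. (\<Prod>p\<in>P. h p v) \<partial>Pi\<^sub>M (\<Union>p\<in>P. B p) (\<lambda>_. M)) = (\<Prod>p\<in>P. \<integral>v. h p v \<partial>Pi\<^sub>M (B p) (\<lambda>_. M))"
  using assms
proof (induction P)
  case empty
  interpret V: prob_space "Pi\<^sub>M ({}::nat set) (\<lambda>_. M)" by (rule prob_space_power)
  show ?case by (simp add: V.prob_space)
next
  case (insert q P)
  let ?U = "\<Union>p\<in>P. B p"
  have fin: "finite ?U" "finite (B q)" using insert.hyps(1) insert.prems(1) by auto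
  have disj: "?U \<inter> B q = {}"
    using insert.prems(2) insert.hyps unfolding disjoint_family_on_def by fastforce
  let ?M = "\<lambda>I. Pi\<^sub>M I (\<lambda>_. M)"
  have int: "integrable (?M (?U \<union> B q)) (\<lambda>v. (\<Prod>p\<in>P. h p v) * h q v)"
  proof -
    interpret V: prob_space "?M (?U \<union> B q)" by (rule prob_space_power)
    show ?thesis
    proof (rule V.integrable_const_bound[of _ "(\<Prod>p\<in>P. D) * D"])
      show "AE v in ?M (?U \<union> B q). norm ((\<Prod>p\<in>P. h p v) * h q v) \<le> (\<Prod>p\<in>P. D) * D"
      proof (rule AE_I2)
        fix v assume v: "v \<in> space (?M (?U \<union> B q))"
        have b: "\<bar>h p v\<bar> \<le> D" if "p \<in> insert q P" for p
          by (rule insert.prems(5)[OF that _ v]) (use that in auto)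
        then have "0 \<le> D" using b[of q] by (auto intro: order_trans[OF abs_ge_zero])
        then show "norm ((\<Prod>p\<in>P. h p v) * h q v) \<le> (\<Prod>p\<in>P. D) * D"
          unfolding real_norm_def abs_mult abs_prod
          by (intro mult_mono prod_mono) (auto intro: b)
      qed
      show "(\<lambda>v. (\<Prod>p\<in>P. h p v) * h q v) \<in> borel_measurable (?M (?U \<union> B q))"
        by (intro borel_measurable_times borel_measurable_prod insert.prems(4)) auto
    qed
  qed
  have mq: "h q (merge ?U (B q) (v, w)) = h q w" for v w
    by (rule insert.prems(3)) (use disj in \<open>auto simp: merge_def\<close>)
  have mp: "h p (merge ?U (B q) (v, w)) = h p v" if "p \<in> P" for p v w
    by (rule insert.prems(3)) (use that in \<open>auto simp: merge_def\<close>)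
  have "(\<integral>v. (\<Prod>p\<in>insert q P. h p v) \<partial>?M (\<Union>p\<in>insert q P. B p)) =
    (\<integral>v. (\<Prod>p\<in>P. h p v) * h q v \<partial>?M (?U \<union> B q))"
    using insert.hyps by (simp add: mult.commute Un_commute)
  also have "\<dots> = (\<integral>v. (\<integral>w. (\<Prod>p\<in>P. h p (merge ?U (B q) (v, w))) * h q (merge ?U (B q) (v, w)) \<partial>?M (B q)) \<partial>?M ?U)"
    by (rule product.product_integral_fold[OF disj fin int])
  also have "\<dots> = (\<integral>v. (\<Prod>p\<in>P. h p v) * (\<integral>w. h q w \<partial>?M (B q)) \<partial>?M ?U)"
    by (simp add: mq mp)
  also have "\<dots> = (\<integral>v. (\<Prod>p\<in>P. h p v) \<partial>?M ?U) * (\<integral>w. h q w \<partial>?M (B q))" by simp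
  also have "(\<integral>v. (\<Prod>p\<in>P. h p v) \<partial>?M ?U) = (\<Prod>p\<in>P. \<integral>v. h p v \<partial>?M (B p))"
  proof (rule insert.IH)
    show "disjoint_family_on B P" using insert.prems(2) by (auto simp: disjoint_family_on_def)
    show "h p v = h p w" if "p \<in> P" "\<And>i. i \<in> B p \<Longrightarrow> v i = w i" for p v w
      by (rule insert.prems(3)) (use that in auto)
    show "h p \<in> borel_measurable (?M I)" if "p \<in> P" "B p \<subseteq> I" for p I
      by (rule insert.prems(4)) (use that in auto)
    show "\<bar>h p v\<bar> \<le> D" if "p \<in> P" "B p \<subseteq> I" "v \<in> space (?M I)" for p I v
      by (rule insert.prems(5)[OF _ that(2,3)]) (use that in auto)
  qed (use insert.prems(1) in auto)
  finally show ?case using insert.hyps by (simp add: mult.commute)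
qed

section \<open>Almost everywhere statements and finitely many classes\<close>

lemma AE_mono_space:
  assumes "AE x in M. P x" "\<And>x. x \<in> space M \<Longrightarrow> P x \<Longrightarrow> Q x"
  shows "AE x in M. Q x"
  using assms(1) by (rule AE_mp) (use assms(2) in auto)

text \<open>Fubini for a single coordinate: the exceptional set is null, so almost all of its
  sections are null.\<close>

lemma (in sampling_space) AE_PiM_insert:
  assumes I: "finite I" "k \<notin> I" and Q: "{x \<in> space (Pi\<^sub>M (insert k I) (\<lambda>_. M)). Q x} \<in> sets (Pi\<^sub>M (insert k I) (\<lambda>_. M))"
    and AE: "AE x in Pi\<^sub>M (insert k I) (\<lambda>_. M). Q x"
  shows "AE x in Pi\<^sub>M I (\<lambda>_. M). AE y in M. Q (x(k := y))"
proof -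
  let ?M = "\<lambda>I. Pi\<^sub>M I (\<lambda>_. M)"
  let ?N = "{x \<in> space (?M (insert k I)). \<not> Q x}"
  have N [measurable]: "?N \<in> sets (?M (insert k I))" using Q by (rule sets.sets_Collect_neg)
  interpret I: prob_space "?M I" by (rule prob_space_power)
  have upd [measurable]: "(\<lambda>(x, y). x(k := y)) \<in> measurable (?M I \<Otimes>\<^sub>M M) (?M (insert k I))"
    by (rule measurable_add_dim)
  have meas: "(\<lambda>(x, y). indicator ?N (x(k := y)) :: ennreal) \<in> borel_measurable (?M I \<Otimes>\<^sub>M M)"
  proof -
    have "(\<lambda>z. indicator ?N ((\<lambda>(x, y). x(k := y)) z) :: ennreal) \<in> borel_measurable (?M I \<Otimes>\<^sub>M M)"
      by (rule measurable_compose[OF upd]) simp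
    then show ?thesis by (simp add: split_beta')
  qed
  have "0 = emeasure (?M (insert k I)) ?N"
    using AE N by (subst (asm) AE_iff_measurable[OF N]) auto
  also have "\<dots> = (\<integral>\<^sup>+ x. indicator ?N x \<partial>?M (insert k I))" using N by simp
  also have "\<dots> = (\<integral>\<^sup>+ x. (\<integral>\<^sup>+ y. indicator ?N (x(k := y)) \<partial>M) \<partial>?M I)"
    by (rule product.product_nn_integral_insert[OF I]) measurable
  finally have "AE x in ?M I. (\<integral>\<^sup>+ y. indicator ?N (x(k := y)) \<partial>M) = 0"
    using borel_measurable_nn_integral[OF meas] by (subst (asm) eq_commute, subst (asm) nn_integral_0_iff_AE) auto
  then show ?thesis
  proof (rule AE_mono_space)
    fix x assume x: "x \<in> space (?M I)" and 0: "(\<integral>\<^sup>+ y. indicator ?N (x(k := y)) \<partial>M) = 0"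
    have "(\<lambda>y. indicator ?N (x(k := y)) :: ennreal) \<in> borel_measurable M"
      using measurable_compose[OF measurable_Pair1'[OF x] meas] by simp
    then have "AE y in M. indicator ?N (x(k := y)) = (0::ennreal)"
      using 0 by (subst (asm) nn_integral_0_iff_AE) auto
    then show "AE y in M. Q (x(k := y))"
    proof (rule AE_mono_space)
      fix y assume "y \<in> space M" and i: "indicator ?N (x(k := y)) = (0::ennreal)"
      then have "x(k := y) \<in> space (?M (insert k I))"
        using x by (auto simp: space_PiM PiE_iff extensional_def)
      then show "Q (x(k := y))" using i by (auto simp: indicator_def split: if_splits)
    qed
  qed
qed

context bounded_kernel
begin

text \<open>If at most \<open>q\<close> classes never exhaust the space, then coincidence-free
  tuples are non-null for every length up to \<open>q + 1\<close>: otherwise, by Fubini, some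
  shorter coincidence-free tuple would have almost every new point in one of its classes. Length
  \<open>q + 1\<close> contradicts the assumption.\<close>

lemma finitely_many_classes:
  assumes "AE x in Pi\<^sub>M {..<Suc q} (\<lambda>_. M). \<exists>i j. i < j \<and> j \<le> q \<and> kdist (x i) (x j) = 0"
  shows "\<exists>k x. k \<le> q \<and> (\<forall>i<k. x i \<in> space M) \<and> (AE y in M. \<exists>i<k. kdist (x i) y = 0)"
proof (rule ccontr)
  assume neg: "\<not> ?thesis"
  have no: "\<not> (AE y in M. \<exists>i<k. kdist (x i) y = 0)" if "k \<le> q" "\<And>i. i < k \<Longrightarrow> x i \<in> space M" for k x
    using that neg by blast
  have "\<not> (AE x in Pi\<^sub>M {..<k} (\<lambda>_. M). \<exists>i j. i < j \<and> j < k \<and> kdist (x i) (x j) = 0)" if "k \<le> Suc q" for k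
    using that
  proof (induction k)
    case 0
    interpret V: prob_space "Pi\<^sub>M {..<0::nat} (\<lambda>_. M)" by (rule prob_space_power)
    show ?case using V.AE_False by simp
  next
    case (Suc k)
    show ?case
    proof
      assume AE: "AE x in Pi\<^sub>M {..<Suc k} (\<lambda>_. M). \<exists>i j. i < j \<and> j < Suc k \<and> kdist (x i) (x j) = 0"
      have kd: "(\<lambda>x. kdist (x i) (x j)) \<in> borel_measurable (Pi\<^sub>M {..<Suc k} (\<lambda>_. M))"
        if "i < Suc k" "j < Suc k" for i j
      proof -
        have [measurable]: "i \<in> {..<Suc k}" "j \<in> {..<Suc k}" using that by auto
        show ?thesis by measurable
      qed
      have "{x \<in> space (Pi\<^sub>M {..<Suc k} (\<lambda>_. M)). \<exists>i j. i < j \<and> j < Suc k \<and> kdist (x i) (x j) = 0} =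
        (\<Union>i\<in>{..<Suc k}. \<Union>j\<in>{i<..<Suc k}. {x \<in> space (Pi\<^sub>M {..<Suc k} (\<lambda>_. M)). kdist (x i) (x j) = 0})"
        (is "?L = ?R")
      proof (intro equalityI subsetI)
        fix x assume "x \<in> ?L"
        then obtain i j where "x \<in> space (Pi\<^sub>M {..<Suc k} (\<lambda>_. M))" "i < j" "j < Suc k" "kdist (x i) (x j) = 0" by blast
        then show "x \<in> ?R" by (intro UN_I[of i] UN_I[of j]) auto
      next
        fix x assume "x \<in> ?R"
        then obtain i j where "x \<in> space (Pi\<^sub>M {..<Suc k} (\<lambda>_. M))" "i < j" "j < Suc k" "kdist (x i) (x j) = 0"
          by auto
        then show "x \<in> ?L" by blast
      qed
      also have "\<dots> \<in> sets (Pi\<^sub>M {..<Suc k} (\<lambda>_. M))"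
        by (intro sets.finite_UN borel_measurable_eq kd borel_measurable_const) auto
      finally have sets: "{x \<in> space (Pi\<^sub>M {..<Suc k} (\<lambda>_. M)). \<exists>i j. i < j \<and> j < Suc k \<and> kdist (x i) (x j) = 0}
        \<in> sets (Pi\<^sub>M {..<Suc k} (\<lambda>_. M))" .
      have "AE x in Pi\<^sub>M {..<k} (\<lambda>_. M). AE y in M. \<exists>i j. i < j \<and> j < Suc k \<and> kdist ((x(k := y)) i) ((x(k := y)) j) = 0"
        by (rule AE_PiM_insert[OF _ _ sets[unfolded lessThan_Suc] AE[unfolded lessThan_Suc]]) simp_all
      then have "AE x in Pi\<^sub>M {..<k} (\<lambda>_. M). \<exists>i j. i < j \<and> j < k \<and> kdist (x i) (x j) = 0"
      proof (rule AE_mono_space)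
        fix x assume x: "x \<in> space (Pi\<^sub>M {..<k} (\<lambda>_. M))"
          and AEy: "AE y in M. \<exists>i j. i < j \<and> j < Suc k \<and> kdist ((x(k := y)) i) ((x(k := y)) j) = 0"
        show "\<exists>i j. i < j \<and> j < k \<and> kdist (x i) (x j) = 0"
        proof (rule ccontr)
          assume non: "\<not> ?thesis"
        from AEy have "AE y in M. \<exists>i<k. kdist (x i) y = 0"
        proof (rule AE_mono_space)
          fix y assume "\<exists>i j. i < j \<and> j < Suc k \<and> kdist ((x(k := y)) i) ((x(k := y)) j) = 0"
          then obtain i j where ij: "i < j" "j < Suc k" "kdist ((x(k := y)) i) ((x(k := y)) j) = 0" by blast
          \<comment> \<open>Since the old coordinates have no coincidence, the new point takes part
            in this one.\<close>
          have "j = k" using non ij by (cases "j = k") auto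
          then show "\<exists>i<k. kdist (x i) y = 0" using ij by auto
        qed
        then show False using no[of k x] x Suc.prems by (auto simp: space_PiM PiE_iff)
        qed
      qed
      then show False using Suc by simp
    qed
  qed
  from this[of "Suc q"] show False using assms by (simp add: less_Suc_eq_le)
qed

text \<open>If \<open>K\<close>, the square of the integral operator \<open>T\<close> with kernel \<open>g\<close>, depends on its first argument
  only through the type, then \<open>\<parallel>T f\<parallel>\<^sup>2 = \<langle>T\<^sup>2 f, f\<rangle> = 0\<close> for every \<open>f\<close> with mean zero on each type.\<close>

lemma orthogonal_to_types:
  assumes \<tau>: "step_type q \<tau>" and \<kappa>: "\<And>i. i < q \<Longrightarrow> p i \<in> space M"
    and K: "AE y in M. kdist (p (\<tau> y)) y = 0"
    and f [measurable]: "f \<in> borel_measurable M" and fb: "\<And>x. x \<in> space M \<Longrightarrow> \<bar>f x\<bar> \<le> B"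
    and f0: "\<And>i. i < q \<Longrightarrow> (\<integral>y. f y * indicator {y. \<tau> y = i} y \<partial>M) = 0"
  shows "AE u in M. (\<integral>y. g (u, y) * f y \<partial>M) = 0"
proof -
  have \<tau>m [measurable]: "\<tau> \<in> measurable M (count_space UNIV)" using \<tau> unfolding step_type_def by auto
  have \<tau>q: "\<tau> y < q" if "y \<in> space M" for y using \<tau> that unfolding step_type_def by auto
  define h where "h u = (\<integral>y. g (u, y) * f y \<partial>M)" for u
  have h_meas [measurable]: "h \<in> borel_measurable M" unfolding h_def by measurable
  have B0: "0 \<le> B" using fb not_empty by (metis abs_ge_zero all_not_in_conv order_trans)
  have gfb: "\<bar>g (u, y) * f y\<bar> \<le> C * B" if "u \<in> space M" "y \<in> space M" for u y
    unfolding abs_mult using that C_nonneg B0 by (intro mult_mono g_bound fb) auto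
  have hb: "\<bar>h u\<bar> \<le> C * B" if "u \<in> space M" for u
    unfolding h_def using that by (intro integral_abs_le gfb) measurable
  have CB: "0 \<le> C * B" using C_nonneg B0 by simp
  \<comment> \<open>The hypothesis gives the identity for almost every \<open>z\<close> at almost
    every fixed \<open>y\<close>. Exchanging the two quantifiers requires measurability of
    \<open>p (\<tau> y)\<close> in \<open>y\<close>, which holds since it factors through the
    labels.\<close>
  have AEK: "AE z in M. AE y in M. K (p (\<tau> y)) z = K y z"
  proof -
    have pt [measurable]: "(\<lambda>y. p (\<tau> y)) \<in> measurable M M"
    proof -
      have "(\<lambda>y. p (\<tau> y)) \<in> measurable M M \<longleftrightarrow> (\<lambda>y. (\<lambda>i. if i < q then p i else p 0) (\<tau> y)) \<in> measurable M M"
        by (rule measurable_cong) (simp add: \<tau>q)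
      moreover have "(\<lambda>i. if i < q then p i else p 0) \<in> measurable (count_space UNIV) M"
      proof -
        obtain y where "y \<in> space M" using not_empty by blast
        then have "0 < q" using \<tau>q[of y] by simp
        then show ?thesis using \<kappa> by auto
      qed
      ultimately show ?thesis using measurable_compose[OF \<tau>m] by blast
    qed
    have "AE y in M. AE z in M. K (p (\<tau> y)) z = K y z"
      using K
    proof (rule AE_mono_space)
      fix y assume "y \<in> space M" "kdist (p (\<tau> y)) y = 0"
      then show "AE z in M. K (p (\<tau> y)) z = K y z"
        using kdist_eq_0_iff[of "p (\<tau> y)" y] \<kappa> \<tau>q by auto
    qed
    moreover have "{x \<in> space (M \<Otimes>\<^sub>M M). K (p (\<tau> (fst x))) (snd x) = K (fst x) (snd x)} \<in> sets (M \<Otimes>\<^sub>M M)"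
      by measurable
    ultimately show ?thesis
      using pair.AE_commute[of "\<lambda>y z. K (p (\<tau> y)) z = K y z"] by simp
  qed
  have zero: "AE z in M. (\<integral>y. f y * K y z \<partial>M) = 0"
    using AEK
  proof (rule AE_mono_space)
    fix z assume z [measurable]: "z \<in> space M" and AEy: "AE y in M. K (p (\<tau> y)) z = K y z"
    have "(\<integral>y. f y * K y z \<partial>M) = (\<integral>y. (\<Sum>i<q. K (p i) z * (f y * indicator {y. \<tau> y = i} y)) \<partial>M)"
    proof (rule integral_cong_AE)
      show "AE y in M. f y * K y z = (\<Sum>i<q. K (p i) z * (f y * indicator {y. \<tau> y = i} y))"
        using AEy
      proof (rule AE_mono_space)
        fix y assume y: "y \<in> space M" and e: "K (p (\<tau> y)) z = K y z"
        have "(\<Sum>i<q. K (p i) z * (f y * indicator {y. \<tau> y = i} y)) = (\<Sum>i<q. if i = \<tau> y then K (p i) z * f y else 0)"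
          by (intro sum.cong refl) (auto simp: indicator_def)
        also have "\<dots> = f y * K y z" using \<tau>q[OF y] e by simp
        finally show "f y * K y z = (\<Sum>i<q. K (p i) z * (f y * indicator {y. \<tau> y = i} y))" by simp
      qed
    qed measurable
    also have "\<dots> = (\<Sum>i<q. K (p i) z * (\<integral>y. f y * indicator {y. \<tau> y = i} y \<partial>M))"
    proof -
      have "integrable M (\<lambda>y. f y * indicator {y. \<tau> y = i} y)" for i
        by (rule bounded_integrable[of _ B]) (use fb B0 in \<open>auto simp: indicator_def\<close>)
      then show ?thesis by (subst Bochner_Integration.integral_sum) auto
    qed
    also have "\<dots> = 0" using f0 by simp
    finally show "(\<integral>y. f y * K y z \<partial>M) = 0" .
  qed
  \<comment> \<open>\<open>h\<close> is \<open>f\<close> after one application of the integral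
    operator; this is the second one, and symmetry of \<open>g\<close> produces
    \<open>K\<close>.\<close>
  have inner: "(\<integral>u. h u * g (u, z) \<partial>M) = (\<integral>y. f y * K y z \<partial>M)" if z [measurable]: "z \<in> space M" for z
  proof -
    have "(\<integral>u. h u * g (u, z) \<partial>M) = (\<integral>u. (\<integral>y. g (u, y) * f y * g (u, z) \<partial>M) \<partial>M)"
      unfolding h_def by simp
    also have "\<dots> = (\<integral>y. (\<integral>u. g (u, y) * f y * g (u, z) \<partial>M) \<partial>M)"
    proof (rule swap_integral)
      show "\<bar>g (u, y) * f y * g (u, z)\<bar> \<le> C * B * C" if "u \<in> space M" "y \<in> space M" for u y
        unfolding abs_mult[of _ "g (u, z)"] using that z C_nonneg CB by (intro mult_mono gfb g_bound) auto
    qed measurable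
    also have "\<dots> = (\<integral>y. f y * K y z \<partial>M)"
    proof (rule Bochner_Integration.integral_cong[OF refl])
      fix y assume y: "y \<in> space M"
      have "(\<integral>u. g (u, y) * f y * g (u, z) \<partial>M) = (\<integral>u. f y * (g (y, u) * g (u, z)) \<partial>M)"
        by (intro Bochner_Integration.integral_cong refl) (simp add: g_sym[OF _ y] mult_ac)
      then show "(\<integral>u. g (u, y) * f y * g (u, z) \<partial>M) = f y * K y z" unfolding K_def by simp
    qed
    finally show ?thesis .
  qed
  have "(\<integral>u. (h u)\<^sup>2 \<partial>M) = (\<integral>u. (\<integral>z. h u * g (u, z) * f z \<partial>M) \<partial>M)"
    unfolding power2_eq_square by (subst (2) h_def) (simp add: mult.assoc)
  also have "\<dots> = (\<integral>z. (\<integral>u. h u * g (u, z) * f z \<partial>M) \<partial>M)"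
  proof (rule swap_integral)
    show "\<bar>h u * g (u, z) * f z\<bar> \<le> C * B * C * B" if "u \<in> space M" "z \<in> space M" for u z
      unfolding abs_mult using that C_nonneg B0 CB by (intro mult_mono hb g_bound fb) auto
  qed measurable
  also have "\<dots> = (\<integral>z. (\<integral>y. f y * K y z \<partial>M) * f z \<partial>M)"
    by (intro Bochner_Integration.integral_cong refl) (simp add: inner)
  also have "\<dots> = (\<integral>z. 0 \<partial>M)"
    by (rule integral_cong_AE) (use zero in \<open>auto elim: eventually_mono\<close>)
  finally have "(\<integral>u. (h u)\<^sup>2 \<partial>M) = 0" by simp
  moreover have "integrable M (\<lambda>u. (h u)\<^sup>2)"
  proof (rule bounded_integrable)
    show "\<bar>(h u)\<^sup>2\<bar> \<le> (C * B)\<^sup>2" if "u \<in> space M" for u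
      using power_mono[OF hb[OF that] abs_ge_zero, of 2] by simp
  qed measurable
  ultimately have "AE u in M. (h u)\<^sup>2 = 0" by (subst (asm) integral_nonneg_eq_0_iff_AE) auto
  then show ?thesis unfolding h_def by simp
qed

end

text \<open>Adding \<open>D\<close> makes both functions densities of finite measures. Rectangles
  form a generator closed under intersection, so these measures coincide, and densities are unique
  almost everywhere.\<close>

lemma (in bounded_kernel) AE_eq_if_rectangles:
  fixes f1 f2 :: "'a \<times> 'a \<Rightarrow> real"
  assumes meas [measurable]: "f1 \<in> borel_measurable (M \<Otimes>\<^sub>M M)" "f2 \<in> borel_measurable (M \<Otimes>\<^sub>M M)"
    and bnd: "\<And>z. z \<in> space (M \<Otimes>\<^sub>M M) \<Longrightarrow> \<bar>f1 z\<bar> \<le> D" "\<And>z. z \<in> space (M \<Otimes>\<^sub>M M) \<Longrightarrow> \<bar>f2 z\<bar> \<le> D"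
    and rect: "\<And>R S. R \<in> sets M \<Longrightarrow> S \<in> sets M \<Longrightarrow>
      (\<integral>z. f1 z * indicator (R \<times> S) z \<partial>(M \<Otimes>\<^sub>M M)) = (\<integral>z. f2 z * indicator (R \<times> S) z \<partial>(M \<Otimes>\<^sub>M M))"
  shows "AE z in M \<Otimes>\<^sub>M M. f1 z = f2 z"
proof -
  let ?P = "M \<Otimes>\<^sub>M M"
  let ?N = "\<lambda>f. density ?P (\<lambda>z. ennreal (f z + D))"
  let ?E = "{R \<times> S | R S. R \<in> sets M \<and> S \<in> sets M}"
  have em: "emeasure (?N f) (R \<times> S) =
      ennreal ((\<integral>z. f z * indicator (R \<times> S) z \<partial>?P) + D * measure ?P (R \<times> S))"
    if f [measurable]: "f \<in> borel_measurable ?P" and b: "\<And>z. z \<in> space ?P \<Longrightarrow> \<bar>f z\<bar> \<le> D"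
      and RS [measurable]: "R \<in> sets M" "S \<in> sets M" for f R S
  proof -
    have int: "integrable ?P (\<lambda>z. f z * indicator (R \<times> S) z)"
    proof (rule pair.P.integrable_const_bound[of _ D])
      show "AE z in ?P. norm (f z * indicator (R \<times> S) z) \<le> D"
      proof (rule AE_I2)
        fix z assume "z \<in> space ?P"
        from b[OF this] show "norm (f z * indicator (R \<times> S) z) \<le> D" by (auto simp: indicator_def)
      qed
    qed measurable
    have int2: "integrable ?P (\<lambda>z. D * indicator (R \<times> S) z)"
      by (intro integrable_mult_right integrable_real_indicator) (auto simp: pair.P.emeasure_eq_measure)
    have "emeasure (?N f) (R \<times> S) = (\<integral>\<^sup>+ z. ennreal (f z + D) * indicator (R \<times> S) z \<partial>?P)"
      by (rule emeasure_density) auto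
    also have "\<dots> = (\<integral>\<^sup>+ z. ennreal (f z * indicator (R \<times> S) z + D * indicator (R \<times> S) z) \<partial>?P)"
      by (intro nn_integral_cong) (auto simp: indicator_def)
    also have "\<dots> = ennreal (\<integral>z. f z * indicator (R \<times> S) z + D * indicator (R \<times> S) z \<partial>?P)"
    proof (rule nn_integral_eq_integral)
      show "AE z in ?P. 0 \<le> f z * indicator (R \<times> S) z + D * indicator (R \<times> S) z"
      proof (rule AE_I2)
        fix z assume "z \<in> space ?P"
        from b[OF this] show "0 \<le> f z * indicator (R \<times> S) z + D * indicator (R \<times> S) z"
          by (auto simp: indicator_def)
      qed
    qed (intro Bochner_Integration.integrable_add int int2)
    also have "(\<integral>z. f z * indicator (R \<times> S) z + D * indicator (R \<times> S) z \<partial>?P) =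
      (\<integral>z. f z * indicator (R \<times> S) z \<partial>?P) + D * measure ?P (R \<times> S)"
      using int int2 by simp
    finally show ?thesis .
  qed
  have "?N f1 = ?N f2"
  proof (rule measure_eqI_generator_eq[OF Int_stable_pair_measure_generator[of M M]])
    show "?E \<subseteq> Pow (space M \<times> space M)" using sets.sets_into_space by fastforce
    show "emeasure (?N f1) X = emeasure (?N f2) X" if "X \<in> ?E" for X
      using that em[OF meas(1) bnd(1)] em[OF meas(2) bnd(2)] rect by auto
    show "range (\<lambda>_::nat. space M \<times> space M) \<subseteq> ?E" by blast
    show "emeasure (?N f1) (space M \<times> space M) \<noteq> \<infinity>"
      by (subst em[OF meas(1) bnd(1)]) auto
  qed (auto simp: sets_pair_measure)
  then have "AE z in ?P. ennreal (f1 z + D) = ennreal (f2 z + D)"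
    by (intro pair.P.density_unique) auto
  then show ?thesis
  proof (rule AE_mono_space)
    fix z assume z: "z \<in> space ?P" and e: "ennreal (f1 z + D) = ennreal (f2 z + D)"
    have "0 \<le> f1 z + D" "0 \<le> f2 z + D" using bnd[OF z] by auto
    then show "f1 z = f2 z" using e by simp
  qed
qed

section \<open>From finitely many types to a step kernel\<close>

context bounded_kernel
begin

text \<open>The operator kills what is left of an indicator after subtracting its averages over the
  types. Applied in both variables, this shows that the integral of \<open>g\<close> over a
  rectangle depends only on how much of each type the sides contain, exactly as for the kernel of
  block averages.\<close>

lemma step_of_types:
  assumes \<tau>: "step_type q \<tau>" and p: "\<And>i. i < q \<Longrightarrow> p i \<in> space M"
    and K: "AE y in M. kdist (p (\<tau> y)) y = 0"
  shows "\<exists>B. (\<forall>i j. B i j = B j i) \<and> (AE z in M \<Otimes>\<^sub>M M. g z = B (\<tau> (fst z)) (\<tau> (snd z)))"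
proof -
  have \<tau>m [measurable]: "\<tau> \<in> measurable M (count_space UNIV)" using \<tau> unfolding step_type_def by auto
  have \<tau>q: "\<tau> y < q" if "y \<in> space M" for y using \<tau> that unfolding step_type_def by auto
  define I :: "nat \<Rightarrow> 'a \<Rightarrow> real" where "I i y = (if \<tau> y = i then 1 else 0)" for i y
  have Im [measurable]: "I i \<in> borel_measurable M" for i unfolding I_def by measurable
  have I_ind: "indicator {y. \<tau> y = i} y = I i y" for i y by (simp add: I_def)
  have Ib: "\<bar>I i y\<bar> \<le> 1" for i y by (simp add: I_def)
  have I_sum: "(\<Sum>i<q. I i y * c i) = c (\<tau> y)" if "y \<in> space M" for c y
  proof -
    have "(\<Sum>i<q. I i y * c i) = (\<Sum>i<q. if i = \<tau> y then c i else 0)"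
      by (intro sum.cong refl) (auto simp: I_def)
    then show ?thesis using \<tau>q[OF that] by simp
  qed
  define w where "w i = (\<integral>y. I i y \<partial>M)" for i
  define m where "m S i = (\<integral>y. indicator S y * I i y \<partial>M)" for S i
  define G where "G i u = (\<integral>y. g (u, y) * I i y \<partial>M)" for i u
  define Q where "Q i j = (\<integral>u. I i u * G j u \<partial>M)" for i j
  \<comment> \<open>Block averages. For a null type the quotient is 0, which is harmless since its
    blocks are null sets.\<close>
  define B where "B i j = Q i j / (w i * w j)" for i j
  have Gm [measurable]: "G i \<in> borel_measurable M" for i unfolding G_def by measurable
  have Gb: "\<bar>G i u\<bar> \<le> C" if "u \<in> space M" for i u
    unfolding G_def
  proof (rule integral_abs_le)
    show "\<bar>g (u, y) * I i y\<bar> \<le> C" if "y \<in> space M" for y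
      using g_bound[OF \<open>u \<in> space M\<close> that] C_nonneg by (simp add: I_def)
  qed (use that in measurable)
  have int_I: "integrable M (\<lambda>y. c * I i y)" for c i
    by (rule integrable_mult_right, rule bounded_integrable[OF Im Ib])
  have Q_sym: "Q i j = Q j i" for i j
  proof -
    have "Q i j = (\<integral>u. (\<integral>y. I i u * (g (u, y) * I j y) \<partial>M) \<partial>M)" unfolding Q_def G_def by simp
    also have "\<dots> = (\<integral>y. (\<integral>u. I i u * (g (u, y) * I j y) \<partial>M) \<partial>M)"
      by (rule swap_integral[of _ C]) (measurable, auto simp: I_def C_nonneg g_bound)
    also have "\<dots> = (\<integral>y. I j y * (\<integral>u. g (y, u) * I i u \<partial>M) \<partial>M)"
    proof (rule Bochner_Integration.integral_cong[OF refl])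
      fix y assume y: "y \<in> space M"
      have "(\<integral>u. I i u * (g (u, y) * I j y) \<partial>M) = (\<integral>u. I j y * (g (y, u) * I i u) \<partial>M)"
        by (intro Bochner_Integration.integral_cong refl) (simp add: g_sym[OF _ y] mult_ac)
      then show "(\<integral>u. I i u * (g (u, y) * I j y) \<partial>M) = I j y * (\<integral>u. g (y, u) * I i u \<partial>M)" by simp
    qed
    finally show ?thesis unfolding Q_def G_def .
  qed
  have int_S: "integrable M (\<lambda>y. indicator S y * I i y)" if [measurable]: "S \<in> sets M" for S i
    by (rule bounded_integrable[of _ 1]) (auto simp: I_def indicator_def)
  \<comment> \<open>Makes \<open>m S i / w i * w i = m S i\<close> true for null types as well,
    where division yields 0.\<close>
  have m_zero: "m S i = 0" if "S \<in> sets M" "w i = 0" for S i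
  proof -
    have "0 \<le> m S i" unfolding m_def by (intro integral_nonneg_AE AE_I2) (simp add: I_def)
    moreover have "m S i \<le> w i" unfolding m_def w_def
      by (intro integral_mono int_S that(1) bounded_integrable[OF Im Ib]) (auto simp: I_def indicator_def)
    ultimately show ?thesis using that(2) by simp
  qed
  have proj: "AE u in M. (\<integral>y. g (u, y) * indicator S y \<partial>M) = (\<Sum>i<q. m S i / w i * G i u)"
    if S [measurable]: "S \<in> sets M" for S
  proof -
    \<comment> \<open>The indicator of \<open>S\<close> minus its conditional expectation given the
      type.\<close>
    define f where "f y = indicator S y - (\<Sum>i<q. m S i / w i * I i y)" for y
    have [measurable]: "f \<in> borel_measurable M" unfolding f_def by measurable
    have fb: "\<bar>f y\<bar> \<le> 1 + (\<Sum>i<q. \<bar>m S i / w i\<bar>)" for y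
    proof -
      have "\<bar>\<Sum>i<q. m S i / w i * I i y\<bar> \<le> (\<Sum>i<q. \<bar>m S i / w i * I i y\<bar>)" by (rule sum_abs)
      also have "\<dots> \<le> (\<Sum>i<q. \<bar>m S i / w i\<bar>)" by (intro sum_mono) (simp add: I_def)
      finally show ?thesis unfolding f_def by (auto simp: indicator_def)
    qed
    have "AE u in M. (\<integral>y. g (u, y) * f y \<partial>M) = 0"
    proof (rule orthogonal_to_types[OF \<tau> p K _ fb])
      fix j assume j: "j < q"
      have "(\<integral>y. f y * indicator {y. \<tau> y = j} y \<partial>M) = (\<integral>y. indicator S y * I j y - m S j / w j * I j y \<partial>M)"
      proof (rule Bochner_Integration.integral_cong[OF refl])
        fix y assume y: "y \<in> space M"
        have "(\<Sum>i<q. m S i / w i * I i y) = m S (\<tau> y) / w (\<tau> y)"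
          using I_sum[OF y, of "\<lambda>i. m S i / w i"] by (simp add: mult.commute)
        then show "f y * indicator {y. \<tau> y = j} y = indicator S y * I j y - m S j / w j * I j y"
          unfolding f_def I_ind by (auto simp: I_def)
      qed
      also have "\<dots> = m S j - m S j / w j * w j"
        unfolding m_def w_def by (subst Bochner_Integration.integral_diff[OF int_S[OF S] int_I]) simp
      also have "\<dots> = 0" using m_zero[OF S, of j] by (cases "w j = 0") auto
      finally show "(\<integral>y. f y * indicator {y. \<tau> y = j} y \<partial>M) = 0" .
    qed auto
    then show ?thesis
    proof (rule AE_mono_space)
      fix u assume u [measurable]: "u \<in> space M" and 0: "(\<integral>y. g (u, y) * f y \<partial>M) = 0"
      have i1: "integrable M (\<lambda>y. g (u, y) * indicator S y)"
        by (rule bounded_integrable[of _ C]) (use g_bound[OF u] C_nonneg in \<open>auto simp: indicator_def\<close>)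
      have i2: "integrable M (\<lambda>y. m S i / w i * (g (u, y) * I i y))" for i
        by (rule integrable_mult_right, rule bounded_integrable[of _ C])
          (use g_bound[OF u] C_nonneg in \<open>auto simp: I_def\<close>)
      have "(\<integral>y. g (u, y) * f y \<partial>M) =
        (\<integral>y. g (u, y) * indicator S y - (\<Sum>i<q. m S i / w i * (g (u, y) * I i y)) \<partial>M)"
        unfolding f_def by (simp add: right_diff_distrib sum_distrib_left mult_ac)
      also have "\<dots> = (\<integral>y. g (u, y) * indicator S y \<partial>M) - (\<integral>y. (\<Sum>i<q. m S i / w i * (g (u, y) * I i y)) \<partial>M)"
        by (rule Bochner_Integration.integral_diff[OF i1 Bochner_Integration.integrable_sum[OF i2]])
      also have "(\<integral>y. (\<Sum>i<q. m S i / w i * (g (u, y) * I i y)) \<partial>M) = (\<Sum>i<q. m S i / w i * G i u)"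
        unfolding G_def by (subst Bochner_Integration.integral_sum[OF i2]) simp
      finally show "(\<integral>y. g (u, y) * indicator S y \<partial>M) = (\<Sum>i<q. m S i / w i * G i u)" using 0 by simp
    qed
  qed
  \<comment> \<open>Symmetry of \<open>g\<close> moves the integration over \<open>R\<close> to the
    second variable, where \<open>proj\<close> applies again.\<close>
  have half: "(\<integral>u. indicator R u * G i u \<partial>M) = (\<Sum>j<q. m R j / w j * Q i j)"
    if R [measurable]: "R \<in> sets M" for R i
  proof -
    have "(\<integral>u. indicator R u * G i u \<partial>M) = (\<integral>u. (\<integral>y. indicator R u * (g (u, y) * I i y) \<partial>M) \<partial>M)"
      unfolding G_def by simp
    also have "\<dots> = (\<integral>y. (\<integral>u. indicator R u * (g (u, y) * I i y) \<partial>M) \<partial>M)"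
      by (rule swap_integral[of _ C]) (measurable, auto simp: I_def indicator_def C_nonneg g_bound)
    also have "\<dots> = (\<integral>y. I i y * (\<integral>u. g (y, u) * indicator R u \<partial>M) \<partial>M)"
    proof (rule Bochner_Integration.integral_cong[OF refl])
      fix y assume y: "y \<in> space M"
      have "(\<integral>u. indicator R u * (g (u, y) * I i y) \<partial>M) = (\<integral>u. I i y * (g (y, u) * indicator R u) \<partial>M)"
        by (intro Bochner_Integration.integral_cong refl) (simp add: g_sym[OF _ y] mult_ac)
      then show "(\<integral>u. indicator R u * (g (u, y) * I i y) \<partial>M) = I i y * (\<integral>u. g (y, u) * indicator R u \<partial>M)" by simp
    qed
    also have "\<dots> = (\<integral>y. (\<Sum>j<q. m R j / w j * (I i y * G j y)) \<partial>M)"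
    proof (rule integral_cong_AE)
      show "AE y in M. I i y * (\<integral>u. g (y, u) * indicator R u \<partial>M) = (\<Sum>j<q. m R j / w j * (I i y * G j y))"
        using proj[OF R]
        by (rule AE_mono_space) (simp add: sum_distrib_left mult_ac)
    qed measurable
    also have "\<dots> = (\<Sum>j<q. m R j / w j * Q i j)"
    proof -
      have "integrable M (\<lambda>y. m R j / w j * (I i y * G j y))" for j
        by (rule integrable_mult_right, rule bounded_integrable[of _ C]) (auto simp: I_def C_nonneg Gb)
      then show ?thesis unfolding Q_def by (subst Bochner_Integration.integral_sum) auto
    qed
    finally show ?thesis .
  qed
  define D where "D = C + (\<Sum>i<q. \<Sum>j<q. \<bar>B i j\<bar>)"
  have D: "\<bar>g z\<bar> \<le> D" "\<bar>B (\<tau> (fst z)) (\<tau> (snd z))\<bar> \<le> D" if z: "z \<in> space (M \<Otimes>\<^sub>M M)" for z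
  proof -
    have mem: "fst z \<in> space M" "snd z \<in> space M" using z by (auto simp: space_pair_measure)
    have "\<bar>g z\<bar> \<le> C" using g_bound[OF mem] by simp
    moreover have "0 \<le> (\<Sum>i<q. \<Sum>j<q. \<bar>B i j\<bar>)" by (intro sum_nonneg) auto
    ultimately show "\<bar>g z\<bar> \<le> D" unfolding D_def by simp
    have "\<bar>B (\<tau> (fst z)) (\<tau> (snd z))\<bar> \<le> (\<Sum>j<q. \<bar>B (\<tau> (fst z)) j\<bar>)"
      by (rule member_le_sum) (use \<tau>q mem in auto)
    also have "\<dots> \<le> (\<Sum>i<q. \<Sum>j<q. \<bar>B i j\<bar>)"
      by (rule member_le_sum[of "\<tau> (fst z)" _ "\<lambda>i. \<Sum>j<q. \<bar>B i j\<bar>"]) (use \<tau>q mem in \<open>auto intro: sum_nonneg\<close>)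
    finally show "\<bar>B (\<tau> (fst z)) (\<tau> (snd z))\<bar> \<le> D" unfolding D_def using C_nonneg by simp
  qed
  have Bm [measurable]: "(\<lambda>z. B (\<tau> (fst z)) (\<tau> (snd z))) \<in> borel_measurable (M \<Otimes>\<^sub>M M)"
    by measurable
  have "AE z in M \<Otimes>\<^sub>M M. g z = B (\<tau> (fst z)) (\<tau> (snd z))"
  proof (rule AE_eq_if_rectangles[OF g_meas Bm D])
    fix R S assume R [measurable]: "R \<in> sets M" and S [measurable]: "S \<in> sets M"
    have fub: "(\<integral>z. f z * indicator (R \<times> S) z \<partial>(M \<Otimes>\<^sub>M M)) =
        (\<integral>u. indicator R u * (\<integral>y. f (u, y) * indicator S y \<partial>M) \<partial>M)"
      if f [measurable]: "f \<in> borel_measurable (M \<Otimes>\<^sub>M M)" and b: "\<And>z. z \<in> space (M \<Otimes>\<^sub>M M) \<Longrightarrow> \<bar>f z\<bar> \<le> D" for f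
    proof -
      have "integrable (M \<Otimes>\<^sub>M M) (\<lambda>z. f z * indicator (R \<times> S) z)"
      proof (rule bounded_integrable_pair[of _ D])
        show "\<bar>f (x, y) * indicator (R \<times> S) (x, y)\<bar> \<le> D" if "x \<in> space M" "y \<in> space M" for x y
          using b[of "(x, y)"] that by (auto simp: indicator_def space_pair_measure)
      qed measurable
      then have "(\<integral>z. f z * indicator (R \<times> S) z \<partial>(M \<Otimes>\<^sub>M M)) =
          (\<integral>u. (\<integral>y. f (u, y) * indicator (R \<times> S) (u, y) \<partial>M) \<partial>M)"
        by (rule pair.integral_fst'[symmetric])
      also have "\<dots> = (\<integral>u. (\<integral>y. indicator R u * (f (u, y) * indicator S y) \<partial>M) \<partial>M)"
        by (simp add: indicator_times mult_ac)
      finally show ?thesis by simp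
    qed
    have "(\<integral>z. g z * indicator (R \<times> S) z \<partial>(M \<Otimes>\<^sub>M M)) =
        (\<integral>u. indicator R u * (\<integral>y. g (u, y) * indicator S y \<partial>M) \<partial>M)"
      by (rule fub[OF g_meas D(1)])
    also have "\<dots> = (\<integral>u. (\<Sum>i<q. m S i / w i * (indicator R u * G i u)) \<partial>M)"
    proof (rule integral_cong_AE)
      show "AE u in M. indicator R u * (\<integral>y. g (u, y) * indicator S y \<partial>M) = (\<Sum>i<q. m S i / w i * (indicator R u * G i u))"
        using proj[OF S] by (rule AE_mono_space) (simp add: sum_distrib_left mult_ac)
    qed measurable
    also have "\<dots> = (\<Sum>i<q. m S i / w i * (\<integral>u. indicator R u * G i u \<partial>M))"
    proof -
      have "integrable M (\<lambda>u. m S i / w i * (indicator R u * G i u))" for i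
        by (rule integrable_mult_right, rule bounded_integrable[of _ C]) (auto simp: indicator_def C_nonneg Gb)
      then show ?thesis by (subst Bochner_Integration.integral_sum) auto
    qed
    also have "\<dots> = (\<Sum>i<q. \<Sum>j<q. m R j * (m S i * B j i))"
      unfolding half[OF R] B_def
      by (simp add: sum_distrib_left Q_sym mult_ac)
    also have "\<dots> = (\<Sum>j<q. m R j * (\<Sum>i<q. m S i * B j i))"
      by (subst sum.swap) (simp add: sum_distrib_left)
    also have "\<dots> = (\<integral>u. (\<Sum>j<q. (indicator R u * I j u) * (\<Sum>i<q. m S i * B j i)) \<partial>M)"
    proof -
      have "integrable M (\<lambda>u. (indicator R u * I j u) * c)" for j c
        by (intro integrable_mult_left int_S R)
      then show ?thesis unfolding m_def[of R] by (subst Bochner_Integration.integral_sum) auto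
    qed
    also have "\<dots> = (\<integral>u. indicator R u * (\<integral>y. B (\<tau> (fst (u, y))) (\<tau> (snd (u, y))) * indicator S y \<partial>M) \<partial>M)"
    proof (rule Bochner_Integration.integral_cong[OF refl])
      fix u assume u: "u \<in> space M"
      have "(\<integral>y. B (\<tau> u) (\<tau> y) * indicator S y \<partial>M) = (\<integral>y. (\<Sum>i<q. (indicator S y * I i y) * B (\<tau> u) i) \<partial>M)"
      proof (rule Bochner_Integration.integral_cong[OF refl])
        fix y assume y: "y \<in> space M"
        have "(\<Sum>i<q. (indicator S y * I i y) * B (\<tau> u) i) = indicator S y * (\<Sum>i<q. I i y * B (\<tau> u) i)"
          by (simp add: sum_distrib_left mult_ac)
        then show "B (\<tau> u) (\<tau> y) * indicator S y = (\<Sum>i<q. (indicator S y * I i y) * B (\<tau> u) i)"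
          using I_sum[OF y] by simp
      qed
      also have "\<dots> = (\<Sum>i<q. m S i * B (\<tau> u) i)"
      proof -
        have "integrable M (\<lambda>y. (indicator S y * I i y) * B (\<tau> u) i)" for i
          by (intro integrable_mult_left int_S S)
        then show ?thesis unfolding m_def by (subst Bochner_Integration.integral_sum) auto
      qed
      finally have e: "(\<integral>y. B (\<tau> u) (\<tau> y) * indicator S y \<partial>M) = (\<Sum>i<q. m S i * B (\<tau> u) i)" .
      have "(\<Sum>j<q. (indicator R u * I j u) * (\<Sum>i<q. m S i * B j i)) =
        indicator R u * (\<Sum>j<q. I j u * (\<Sum>i<q. m S i * B j i))"
        by (simp only: sum_distrib_left[of "indicator R u"] mult.assoc)
      also have "\<dots> = indicator R u * (\<Sum>i<q. m S i * B (\<tau> u) i)" by (simp only: I_sum[OF u])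
      finally show "(\<Sum>j<q. (indicator R u * I j u) * (\<Sum>i<q. m S i * B j i)) =
        indicator R u * (\<integral>y. B (\<tau> (fst (u, y))) (\<tau> (snd (u, y))) * indicator S y \<partial>M)"
        using e by simp
    qed
    also have "\<dots> = (\<integral>z. B (\<tau> (fst z)) (\<tau> (snd z)) * indicator (R \<times> S) z \<partial>(M \<Otimes>\<^sub>M M))"
      by (rule fub[OF Bm D(2), symmetric])
    finally show "(\<integral>z. g z * indicator (R \<times> S) z \<partial>(M \<Otimes>\<^sub>M M)) =
      (\<integral>z. B (\<tau> (fst z)) (\<tau> (snd z)) * indicator (R \<times> S) z \<partial>(M \<Otimes>\<^sub>M M))" .
  qed
  moreover have "B i j = B j i" for i j unfolding B_def by (simp add: Q_sym[of i j] mult.commute)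
  ultimately show ?thesis by blast
qed

lemma step_of_classes:
  assumes k: "k \<le> q" and x: "\<And>i. i < k \<Longrightarrow> x i \<in> space M" and AE: "AE y in M. \<exists>i<k. kdist (x i) y = 0"
  shows "\<exists>\<tau> B. step_type q \<tau> \<and> (\<forall>i j. B i j = B j i) \<and> (AE z in M \<Otimes>\<^sub>M M. g z = B (\<tau> (fst z)) (\<tau> (snd z)))"
proof -
  have k0: "0 < k"
  proof (rule ccontr)
    assume "\<not> 0 < k"
    then show False using AE AE_False by simp
  qed
  \<comment> \<open>All labels below \<open>q\<close> need a representative; those from
    \<open>k\<close> on repeat the first one.\<close>
  define p where "p i = x (if i < k then i else 0)" for i
  have p: "p i \<in> space M" for i unfolding p_def using x k0 by simp
  \<comment> \<open>The first matching class; points in no class form a null set and receive label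
    0.\<close>
  define \<tau> where "\<tau> y = (if \<exists>i<k. kdist (p i) y = 0 then LEAST i. i < k \<and> kdist (p i) y = 0 else 0)" for y
  have [measurable]: "(\<lambda>y. kdist (p i) y) \<in> borel_measurable M" for i using p[of i] by measurable
  have \<tau>m: "\<tau> \<in> measurable M (count_space UNIV)" unfolding \<tau>_def by measurable
  have least: "(LEAST i. i < k \<and> kdist (p i) y = 0) < k \<and> kdist (p (LEAST i. i < k \<and> kdist (p i) y = 0)) y = 0"
    if "\<exists>i<k. kdist (p i) y = 0" for y
    using that by (rule LeastI_ex)
  have st: "step_type q \<tau>"
    unfolding step_type_def using \<tau>m least k k0 by (auto simp: \<tau>_def intro: less_le_trans)
  have "AE y in M. kdist (p (\<tau> y)) y = 0"
    using AE
  proof (rule AE_mono_space)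
    fix y assume "\<exists>i<k. kdist (x i) y = 0"
    then have "\<exists>i<k. kdist (p i) y = 0" unfolding p_def by auto
    then show "kdist (p (\<tau> y)) y = 0" using least[of y] unfolding \<tau>_def by simp
  qed
  from step_of_types[OF st p this] st show ?thesis by blast
qed

end

section \<open>From densities to types\<close>

context bounded_kernel
begin

lemma kernel_value_doubleton:
  assumes "x a \<in> space M" "x b \<in> space M"
  shows "kernel_value g x {a, b} = g (x a, x b)"
  using assms g_sym by (cases "a \<le> b") (auto simp: kernel_value_def min_def max_def)

lemma step_of_densities:
  assumes A_sym: "\<And>i j. A i j = A j i" and q: "q \<ge> 2"
    and dens: "\<And>V E. simple_graph V E \<Longrightarrow> card V \<le> 4 * q\<^sup>2 - q \<Longrightarrow> hom g V E = step_density q a A V E"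
  shows "\<exists>\<tau> B. step_type q \<tau> \<and> (\<forall>i j. B i j = B j i) \<and> (AE z in M \<Otimes>\<^sub>M M. g z = B (\<tau> (fst z)) (\<tau> (snd z)))"
proof -
  \<comment> \<open>Vertices up to \<open>q\<close> are the sampled points. Each pair
    \<open>p\<close> of them owns three private vertices \<open>u p 0\<close>, \<open>u p 1\<close>,
    \<open>u p 2\<close>, encoded above \<open>q\<close>, so that different pairs share at most
    sampled points and no edges.\<close>
  define u where "u = (\<lambda>(i::nat, j::nat) (r::nat). Suc q + to_nat (i, j, r))"
  have u_gt: "q < u p r" for p r unfolding u_def by (cases p) simp
  have u_inj: "u p r = u p' r' \<longleftrightarrow> p = p' \<and> r = r'" for p p' r r'
    unfolding u_def by (cases p; cases p') auto
  define P where "P = {(i, j). i < j \<and> j < Suc q}"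
  have finP: "finite P" unfolding P_def by (rule finite_subset[of _ "{..<Suc q} \<times> {..<Suc q}"]) auto
  define Bl where "Bl p = {u p 0, u p 1, u p 2}" for p
  define W where "W = (\<Union>p\<in>P. Bl p)"
  define V where "V = {..<Suc q} \<union> W"
  have disj: "{..<Suc q} \<inter> W = {}" unfolding W_def Bl_def using u_gt by (auto dest: less_le_trans) (metis not_less_eq u_gt)+
  have finW: "finite W" unfolding W_def Bl_def using finP by auto
  have card_V: "card V \<le> 4 * q\<^sup>2 - q"
  proof -
    have "card W \<le> (\<Sum>p\<in>P. card (Bl p))" unfolding W_def by (rule card_UN_le[OF finP])
    also have "\<dots> \<le> (\<Sum>p\<in>P. 3)"
      by (intro sum_mono) (simp add: Bl_def card_insert_if)
    finally have "2 * card W \<le> 3 * (2 * card P)" by simp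
    also have "2 * card P = Suc q * (Suc q - 1)" unfolding P_def by (rule card_less_pairs)
    finally have "2 * card V \<le> 2 * Suc q + 3 * (Suc q * q)"
      using card_Un_le[of "{..<Suc q}" W] unfolding V_def by simp
    \<comment> \<open>That is, \<open>3 * q\<^sup>2 + 5 * q + 2 \<le> 8 * q\<^sup>2 - 2 * q\<close>,
      which holds from \<open>q = 2\<close> on.\<close>
    also have "\<dots> \<le> 2 * (4 * q\<^sup>2 - q)"
    proof -
      obtain n where "q = Suc (Suc n)" using q by (metis add_2_eq_Suc le_Suc_ex)
      then show ?thesis by (simp add: power2_eq_square algebra_simps)
    qed
    finally show ?thesis by simp
  qed
  \<comment> \<open>The integrand of \<open>kdist_expand\<close> for the pair, over its private
    vertices. Two sampled points of equal type make both differences vanish.\<close>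
  define \<phi> where "\<phi> p X = ((X {fst p, u p 0} - X {snd p, u p 0}) * X {u p 0, u p 1}) *
    (X {u p 1, u p 2} * (X {fst p, u p 2} - X {snd p, u p 2}))" for p and X :: "nat set \<Rightarrow> real"
  define E where "E p = ({{fst p, u p 0}, {snd p, u p 0}} \<union> {{u p 0, u p 1}}) \<union>
    ({{u p 1, u p 2}} \<union> {{fst p, u p 2}, {snd p, u p 2}})" for p
  have P_less: "fst p < Suc q" "snd p < Suc q" "fst p < snd p" if "p \<in> P" for p
    using that unfolding P_def by auto
  have ne: "i \<noteq> u p r" "u p r \<noteq> i" if "i < Suc q" for i p r using u_gt[of p r] that by auto
  have \<phi>: "multiaffine (E p) (\<phi> p)" if "p \<in> P" for p
    unfolding E_def \<phi>_def
    by (intro multiaffine_mult multiaffine_diff multiaffine_var)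
      (use P_less[OF that] in \<open>auto simp: doubleton_eq_iff u_inj ne\<close>)
  have disjE: "disjoint_family_on E P"
    unfolding disjoint_family_on_def E_def
    by (auto simp: doubleton_eq_iff u_inj ne P_less)
  define \<Phi> where "\<Phi> X = (\<Prod>p\<in>P. \<phi> p X)" for X
  let ?E = "\<Union>p\<in>P. E p"
  have \<Phi>: "multiaffine ?E \<Phi>"
    unfolding \<Phi>_def by (rule multiaffine_prod[OF finP \<phi> _ disjE]) (auto simp: E_def)
  have graph: "simple_graph V ?E"
  proof -
    have "e \<subseteq> V \<and> card e = 2" if "p \<in> P" "e \<in> E p" for p e
    proof -
      have "Bl p \<subseteq> V" using that(1) unfolding V_def W_def by auto
      then have "u p 0 \<in> V" "u p 1 \<in> V" "u p 2 \<in> V" unfolding Bl_def by auto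
      moreover have "fst p \<in> V" "snd p \<in> V" using P_less[OF that(1)] unfolding V_def by auto
      ultimately show ?thesis using that(2) P_less[OF that(1)]
        unfolding E_def by (auto simp: card_insert_if u_inj ne)
    qed
    then show ?thesis unfolding simple_graph_def using finW by (auto simp: V_def)
  qed
  have sub: "simple_graph V F" if "F \<subseteq> ?E" for F using graph that unfolding simple_graph_def by auto
  let ?M = "\<lambda>I. Pi\<^sub>M I (\<lambda>_. M)"
  have "(\<integral>x. \<Phi> (kernel_value g x) \<partial>?M V) =
    (\<Sum>\<sigma>\<in>V \<rightarrow>\<^sub>E {..<q}. (\<Prod>v\<in>V. a (\<sigma> v)) * \<Phi> (edge_value A \<sigma>))"
    by (rule integral_multiaffine[OF \<Phi> graph g_meas g_bound dens[OF sub card_V]])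
  also have "\<dots> = 0"
  proof (rule sum.neutral, rule ballI)
    fix \<sigma> assume \<sigma>: "\<sigma> \<in> V \<rightarrow>\<^sub>E {..<q}"
    have "\<not> inj_on \<sigma> {..<Suc q}"
    proof
      assume "inj_on \<sigma> {..<Suc q}"
      moreover have "\<sigma> ` {..<Suc q} \<subseteq> {..<q}" using \<sigma> unfolding V_def by auto
      ultimately have "card {..<Suc q} \<le> card {..<q}" by (rule card_inj_on_le) simp
      then show False by simp
    qed
    then obtain i j where "i < j" "j < Suc q" "\<sigma> i = \<sigma> j"
      unfolding inj_on_def by (metis lessThan_iff linorder_neqE_nat)
    then have "(i, j) \<in> P" "\<phi> (i, j) (edge_value A \<sigma>) = 0"
      unfolding P_def \<phi>_def by (auto simp: edge_value_doubleton[of A, OF A_sym])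
    then have "\<Phi> (edge_value A \<sigma>) = 0" unfolding \<Phi>_def using finP by (intro prod_zero) auto
    then show "(\<Prod>v\<in>V. a (\<sigma> v)) * \<Phi> (edge_value A \<sigma>) = 0" by simp
  qed
  finally have zero: "(\<integral>x. \<Phi> (kernel_value g x) \<partial>?M V) = 0" .
  have intV: "integrable (?M V) (\<lambda>x. \<Phi> (kernel_value g x))"
  proof -
    obtain c where c: "\<And>X. \<Phi> X = (\<Sum>F\<in>Pow ?E. c F * (\<Prod>e\<in>F. X e))"
      using \<Phi> unfolding multiaffine_def by metis
    show ?thesis unfolding c
      by (intro Bochner_Integration.integrable_sum integrable_mult_right kernel_value_prod_integrable[OF sub g_meas g_bound]) auto
  qed
  define h where "h x p v = (g (x (fst p), v (u p 0)) - g (x (snd p), v (u p 0))) * g (v (u p 0), v (u p 1)) *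
    (g (v (u p 1), v (u p 2)) * (g (x (fst p), v (u p 2)) - g (x (snd p), v (u p 2))))" for x p v
  let ?D = "(2 * C) * C * (C * (2 * C))"
  \<comment> \<open>With the sampled points fixed, the private vertices of different pairs are
    independent, so the integral over them factors into values of \<open>kdist\<close>.\<close>
  have inner: "(\<integral>v. \<Phi> (kernel_value g (merge {..<Suc q} W (x, v))) \<partial>?M W) = (\<Prod>p\<in>P. kdist (x (fst p)) (x (snd p)))"
    if x: "x \<in> space (?M {..<Suc q})" for x
  proof -
    have xM: "x i \<in> space M" if "i < Suc q" for i using x that by (auto simp: space_PiM PiE_iff)
    have "(\<integral>v. \<Phi> (kernel_value g (merge {..<Suc q} W (x, v))) \<partial>?M W) = (\<integral>v. (\<Prod>p\<in>P. h x p v) \<partial>?M W)"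
    proof (rule Bochner_Integration.integral_cong[OF refl])
      fix v assume v: "v \<in> space (?M W)"
      have "\<phi> p (kernel_value g (merge {..<Suc q} W (x, v))) = h x p v" if p: "p \<in> P" for p
      proof -
        let ?y = "merge {..<Suc q} W (x, v)"
        have uW: "u p 0 \<in> W" "u p 1 \<in> W" "u p 2 \<in> W" using p unfolding W_def Bl_def by auto
        have y: "?y (u p r) = v (u p r)" if "u p r \<in> W" for r using that disj by (auto simp: merge_def)
        have yi: "?y i = x i" if "i < Suc q" for i using that by (simp add: merge_def)
        have "v (u p r) \<in> space M" if "u p r \<in> W" for r using that v by (auto simp: space_PiM PiE_iff)
        then show ?thesis
          unfolding \<phi>_def h_def
          using uW P_less[OF p] xM by (simp add: kernel_value_doubleton y yi)
      qed
      then show "\<Phi> (kernel_value g (merge {..<Suc q} W (x, v))) = (\<Prod>p\<in>P. h x p v)" unfolding \<Phi>_def by simp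
    qed
    also have "\<dots> = (\<Prod>p\<in>P. \<integral>v. h x p v \<partial>?M (Bl p))"
      unfolding W_def
    proof (rule integral_blocks[OF finP])
      show "disjoint_family_on Bl P" unfolding disjoint_family_on_def Bl_def by (auto simp: u_inj)
      show "h x p v = h x p w" if "p \<in> P" "\<And>i. i \<in> Bl p \<Longrightarrow> v i = w i" for p v w
        unfolding h_def using that(2)[of "u p 0"] that(2)[of "u p 1"] that(2)[of "u p 2"] by (simp add: Bl_def)
      show "h x p \<in> borel_measurable (?M I)" if "p \<in> P" "Bl p \<subseteq> I" for p I
      proof -
        have [measurable]: "u p 0 \<in> I" "u p 1 \<in> I" "u p 2 \<in> I" using that(2) unfolding Bl_def by auto
        have [measurable]: "x (fst p) \<in> space M" "x (snd p) \<in> space M" using xM P_less[OF that(1)] by auto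
        show ?thesis unfolding h_def by measurable
      qed
      show "\<bar>h x p v\<bar> \<le> ?D" if "p \<in> P" "Bl p \<subseteq> I" "v \<in> space (?M I)" for p I v
      proof -
        have v: "v (u p 0) \<in> space M" "v (u p 1) \<in> space M" "v (u p 2) \<in> space M"
          using that(2,3) unfolding Bl_def by (auto simp: space_PiM PiE_iff)
        have x: "x (fst p) \<in> space M" "x (snd p) \<in> space M" using xM P_less[OF that(1)] by auto
        have "\<bar>g (x (fst p), v (u p r)) - g (x (snd p), v (u p r))\<bar> \<le> 2 * C" if "v (u p r) \<in> space M" for r
          using g_bound[OF x(1) that] g_bound[OF x(2) that] by linarith
        then show ?thesis unfolding h_def abs_mult
          using v x C_nonneg g_bound by (intro mult_mono) auto
      qed
    qed (simp add: Bl_def)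
    also have "\<dots> = (\<Prod>p\<in>P. kdist (x (fst p)) (x (snd p)))"
    proof (rule prod.cong[OF refl])
      fix p assume p: "p \<in> P"
      show "(\<integral>v. h x p v \<partial>?M (Bl p)) = kdist (x (fst p)) (x (snd p))"
        unfolding h_def Bl_def by (rule path_integral) (use xM P_less[OF p] in \<open>auto simp: u_inj\<close>)
    qed
    finally show ?thesis .
  qed
  have "(\<integral>x. (\<Prod>p\<in>P. kdist (x (fst p)) (x (snd p))) \<partial>?M {..<Suc q}) =
    (\<integral>x. (\<integral>v. \<Phi> (kernel_value g (merge {..<Suc q} W (x, v))) \<partial>?M W) \<partial>?M {..<Suc q})"
    by (rule Bochner_Integration.integral_cong[OF refl]) (simp add: inner)
  also have "\<dots> = (\<integral>x. \<Phi> (kernel_value g x) \<partial>?M V)"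
    unfolding V_def by (rule product.product_integral_fold[symmetric]) (use disj finW intV in \<open>auto simp: V_def\<close>)
  finally have int0: "(\<integral>x. (\<Prod>p\<in>P. kdist (x (fst p)) (x (snd p))) \<partial>?M {..<Suc q}) = 0" using zero by simp
  have kd_meas: "(\<lambda>x. \<Prod>p\<in>P. kdist (x (fst p)) (x (snd p))) \<in> borel_measurable (?M {..<Suc q})"
  proof (rule borel_measurable_prod)
    fix p assume p: "p \<in> P"
    have [measurable]: "fst p \<in> {..<Suc q}" "snd p \<in> {..<Suc q}" using P_less[OF p] by auto
    show "(\<lambda>x. kdist (x (fst p)) (x (snd p))) \<in> borel_measurable (?M {..<Suc q})" by measurable
  qed
  have kd_int: "integrable (?M {..<Suc q}) (\<lambda>x. \<Prod>p\<in>P. kdist (x (fst p)) (x (snd p)))"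
  proof -
    interpret X: prob_space "?M {..<Suc q}" by (rule prob_space_power)
    show ?thesis
    proof (rule X.integrable_const_bound[OF _ kd_meas])
      show "AE x in ?M {..<Suc q}. norm (\<Prod>p\<in>P. kdist (x (fst p)) (x (snd p))) \<le> (\<Prod>p\<in>P. (2 * (C * C))\<^sup>2)"
      proof (rule AE_I2)
        fix x assume x: "x \<in> space (?M {..<Suc q})"
        have "x i \<in> space M" if "i < Suc q" for i using x that by (auto simp: space_PiM PiE_iff)
        then show "norm (\<Prod>p\<in>P. kdist (x (fst p)) (x (snd p))) \<le> (\<Prod>p\<in>P. (2 * (C * C))\<^sup>2)"
          unfolding real_norm_def abs_prod using P_less kdist_bound by (intro prod_mono) auto
      qed
    qed
  qed
  \<comment> \<open>\<open>kdist\<close> is nonnegative, so a vanishing integral forces the product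
    to vanish almost everywhere.\<close>
  have "AE x in ?M {..<Suc q}. (\<Prod>p\<in>P. kdist (x (fst p)) (x (snd p))) = 0"
    using int0 by (subst (asm) integral_nonneg_eq_0_iff_AE[OF kd_int]) (auto intro!: prod_nonneg kdist_nonneg)
  then have "AE x in ?M {..<Suc q}. \<exists>i j. i < j \<and> j \<le> q \<and> kdist (x i) (x j) = 0"
  proof (rule AE_mono_space)
    fix x assume "(\<Prod>p\<in>P. kdist (x (fst p)) (x (snd p))) = 0"
    then obtain p where "p \<in> P" "kdist (x (fst p)) (x (snd p)) = 0" using finP by auto
    then show "\<exists>i j. i < j \<and> j \<le> q \<and> kdist (x i) (x j) = 0"
      unfolding P_def by (intro exI[of _ "fst p"] exI[of _ "snd p"]) auto
  qed
  from finitely_many_classes[OF this] obtain k x where "k \<le> q" "\<forall>i<k. x i \<in> space M"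
    "AE y in M. \<exists>i<k. kdist (x i) y = 0" by blast
  then show ?thesis by (intro step_of_classes[of k q x]) auto
qed

end

section \<open>Kernels on the unit square\<close>

text \<open>In the completion, agreeing almost everywhere with a measurable function already makes
  \<open>f\<close> measurable. This lets densities of Lebesgue measurable kernels be computed from
  Borel versions.\<close>

lemma integral_completion_cong_AE:
  fixes f g :: "'a \<Rightarrow> real"
  assumes g [measurable]: "g \<in> borel_measurable M" and eq: "AE x in M. f x = g x"
  shows "integral\<^sup>L (completion M) f = integral\<^sup>L M g"
proof -
  have g': "g \<in> borel_measurable (completion M)" by (rule measurable_completion) fact
  have eq': "AE x in completion M. f x = g x" using eq by (rule AE_completion)
  have "f \<in> borel_measurable (completion M)"
  proof (rule measurableI)
    fix A :: "real set" assume "A \<in> sets borel"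
    then have "g -` A \<inter> space (completion M) \<in> sets (completion M)" using g' by (rule measurable_sets[rotated])
    then show "f -` A \<inter> space (completion M) \<in> sets (completion M)"
    proof (rule completion.in_sets_AE[rotated])
      show "AE x in completion M. x \<in> g -` A \<inter> space (completion M) \<longleftrightarrow> x \<in> f -` A \<inter> space (completion M)"
        using eq' by eventually_elim auto
    qed simp
  qed simp
  then have "integral\<^sup>L (completion M) f = integral\<^sup>L (completion M) g"
    using g' eq' by (intro integral_cong_AE)
  then show ?thesis using integral_completion[OF g] by simp
qed

section \<open>Borel versions of kernels\<close>

abbreviation unit_measure :: "real measure" where
  "unit_measure \<equiv> restrict_space lborel {0..1}"

lemma sampling_space_unit: "sampling_space unit_measure"
  unfolding sampling_space_def by (rule prob_space_restrict_space) auto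

interpretation unit: sampling_space unit_measure
  by (rule sampling_space_unit)

lemma space_unit [simp]: "space unit_measure = {0..1}"
  by (simp add: space_restrict_space)

lemma (in sampling_space) AE_swap:
  assumes P: "AE z in M \<Otimes>\<^sub>M M. P z"
  shows "AE z in M \<Otimes>\<^sub>M M. P (snd z, fst z)"
proof -
  have meas: "(\<lambda>(x, y). (y, x)) \<in> measurable (M \<Otimes>\<^sub>M M) (M \<Otimes>\<^sub>M M)" by measurable
  from P obtain N where N: "N \<in> null_sets (M \<Otimes>\<^sub>M M)" "{z \<in> space (M \<Otimes>\<^sub>M M). \<not> P z} \<subseteq> N"
    by (auto elim!: AE_E simp: null_sets_def)
  have "AE z in distr (M \<Otimes>\<^sub>M M) (M \<Otimes>\<^sub>M M) (\<lambda>(x, y). (y, x)). z \<notin> N"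
    unfolding pair.distr_pair_swap[symmetric] using N(1) by (rule AE_not_in)
  then have "AE z in M \<Otimes>\<^sub>M M. (\<lambda>(x, y). (y, x)) z \<notin> N"
    using meas N(1) by (subst (asm) AE_distr_iff) auto
  then show ?thesis
  proof (rule AE_mono_space)
    fix z assume "z \<in> space (M \<Otimes>\<^sub>M M)" "(\<lambda>(x, y). (y, x)) z \<notin> N"
    then show "P (snd z, fst z)" using N(2) by (auto simp: space_pair_measure split: prod.splits)
  qed
qed

text \<open>Iterated integrals over the unit interval are bounded by those over the line, so null
  sets of the plane remain null. This domination is enough to transfer almost everywhere
  statements.\<close>

lemma AE_unit_square:
  assumes "AE z in (lborel :: (real \<times> real) measure). z \<in> {0..1} \<times> {0..1} \<longrightarrow> P z"
  shows "AE z in unit_measure \<Otimes>\<^sub>M unit_measure. P z"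
proof -
  from assms obtain N where N: "N \<in> null_sets (lborel :: (real \<times> real) measure)" "{z. \<not> (z \<in> {0..1} \<times> {0..1} \<longrightarrow> P z)} \<subseteq> N"
    by (auto elim!: AE_E simp: null_sets_def)
  have NB: "N \<in> sets (lborel \<Otimes>\<^sub>M lborel)" using N(1) unfolding lborel_prod by auto
  have fstm [measurable]: "(\<lambda>z. z) \<in> measurable (unit_measure \<Otimes>\<^sub>M unit_measure) (lborel \<Otimes>\<^sub>M lborel)"
  proof (rule measurable_pair)
    have m: "(\<lambda>x. x) \<in> measurable unit_measure lborel" by (simp add: measurable_restrict_space1)
    show "fst \<circ> (\<lambda>z. z) \<in> measurable (unit_measure \<Otimes>\<^sub>M unit_measure) lborel"
      using measurable_compose[OF measurable_fst m] by (simp add: comp_def)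
    show "snd \<circ> (\<lambda>z. z) \<in> measurable (unit_measure \<Otimes>\<^sub>M unit_measure) lborel"
      using measurable_compose[OF measurable_snd m] by (simp add: comp_def)
  qed
  let ?S = "space (unit_measure \<Otimes>\<^sub>M unit_measure)"
  have N': "N \<inter> ?S \<in> sets (unit_measure \<Otimes>\<^sub>M unit_measure)"
    using measurable_sets[OF fstm NB] by simp
  have "emeasure (unit_measure \<Otimes>\<^sub>M unit_measure) (N \<inter> ?S) =
    (\<integral>\<^sup>+ x. \<integral>\<^sup>+ y. indicator (N \<inter> ?S) (x, y) \<partial>unit_measure \<partial>unit_measure)"
    by (rule unit.emeasure_pair_measure[OF N'])
  also have "\<dots> \<le> (\<integral>\<^sup>+ x. \<integral>\<^sup>+ y. indicator N (x, y) \<partial>lborel \<partial>lborel)"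
  proof -
    have le: "(\<integral>\<^sup>+ x. f x \<partial>unit_measure) \<le> (\<integral>\<^sup>+ x. f x \<partial>lborel)" for f :: "real \<Rightarrow> ennreal"
      by (subst nn_integral_restrict_space) (auto intro!: nn_integral_mono simp: indicator_def)
    have "(\<integral>\<^sup>+ y. indicator (N \<inter> ?S) (x, y) \<partial>unit_measure) \<le> (\<integral>\<^sup>+ y. indicator N (x, y) \<partial>lborel)" for x
      by (rule order_trans[OF nn_integral_mono le]) (simp add: indicator_def)
    then show ?thesis by (rule order_trans[OF nn_integral_mono le])
  qed
  also have "\<dots> = emeasure (lborel \<Otimes>\<^sub>M lborel) N"
    by (rule lborel.emeasure_pair_measure[OF NB, symmetric])
  also have "\<dots> = 0" using N(1) unfolding lborel_prod by auto
  finally have "N \<inter> ?S \<in> null_sets (unit_measure \<Otimes>\<^sub>M unit_measure)" using N' by (auto simp: null_sets_def)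
  then show ?thesis
    by (rule AE_I') (use N(2) in \<open>auto simp: space_pair_measure\<close>)
qed

lemma kernel_borel_version:
  assumes U: "is_kernel U"
  shows "\<exists>g C. bounded_kernel unit_measure g C \<and> (AE z in unit_measure \<Otimes>\<^sub>M unit_measure. U z = g z)"
proof -
  let ?sq = "{0..1} \<times> {0..1} :: (real \<times> real) set"
  let ?P = "unit_measure \<Otimes>\<^sub>M unit_measure"
  have sqm: "?sq \<in> sets lebesgue"
    by (intro sets_completionI_sets) (simp add: borel_closed closed_Times)
  obtain C where C: "\<And>z. z \<in> ?sq \<Longrightarrow> \<bar>U z\<bar> \<le> C"
  proof -
    from U obtain C where "\<forall>x\<in>U ` ?sq. norm x \<le> C" unfolding is_kernel_def bounded_iff by blast
    then have "\<bar>U z\<bar> \<le> C" if "z \<in> ?sq" for z using that by (metis image_eqI real_norm_def)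
    then show ?thesis by (rule that)
  qed
  have "(\<lambda>z. if z \<in> ?sq then U z else 0) \<in> borel_measurable lebesgue"
    using U sqm unfolding is_kernel_def by (subst borel_measurable_if) auto
  then obtain g0 where g0: "g0 \<in> borel_measurable lborel" "AE z in lborel. (if z \<in> ?sq then U z else 0) = g0 z"
    using completion_ex_borel_measurable_real by blast
  \<comment> \<open>A Borel version \<open>g0\<close> may violate symmetry and the bound on a null
    set; averaging with the transpose and truncating restores both at every point and changes
    nothing almost everywhere.\<close>
  define g where "g z = max (- C) (min C ((g0 z + g0 (snd z, fst z)) / 2))" for z
  have idm [measurable]: "(\<lambda>x. x) \<in> borel_measurable unit_measure" by (simp add: measurable_restrict_space1)
  have f [measurable]: "fst \<in> borel_measurable ?P" "snd \<in> borel_measurable ?P"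
    using measurable_compose[OF measurable_fst idm] measurable_compose[OF measurable_snd idm] by auto
  have m: "(\<lambda>z. g0 (fst z, snd z)) \<in> borel_measurable ?P" "(\<lambda>z. g0 (snd z, fst z)) \<in> borel_measurable ?P"
  proof -
    have "g0 \<in> borel_measurable borel" using g0(1) by simp
    from measurable_compose[OF borel_measurable_Pair[OF f] this]
      measurable_compose[OF borel_measurable_Pair[OF f(2,1)] this]
    show "(\<lambda>z. g0 (fst z, snd z)) \<in> borel_measurable ?P" "(\<lambda>z. g0 (snd z, fst z)) \<in> borel_measurable ?P"
      by simp_all
  qed
  have gm: "g \<in> borel_measurable ?P" unfolding g_def using m by simp
  have "bounded_kernel unit_measure g C"
  proof (intro bounded_kernel.intro bounded_kernel_axioms.intro sampling_space_unit gm)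
    have "\<bar>max (- C) (min C t)\<bar> \<le> C" for t using C[of "(0, 0)"] by (auto simp: max_def min_def)
    then show "\<bar>g (x, y)\<bar> \<le> C" for x y unfolding g_def .
    show "g (x, y) = g (y, x)" for x y unfolding g_def by (simp add: add.commute)
  qed
  moreover have "AE z in ?P. U z = g z"
  proof -
    have e: "AE z in ?P. U z = g0 z"
      using g0(2) by (intro AE_unit_square) (auto elim!: eventually_mono)
    have "AE z in ?P. U (snd z, fst z) = g0 (snd z, fst z)" by (rule unit.AE_swap[OF e])
    with e AE_space show ?thesis
    proof eventually_elim
      case (elim z)
      then have z: "fst z \<in> {0..1}" "snd z \<in> {0..1}" by (auto simp: space_pair_measure)
      then have "U (snd z, fst z) = U (fst z, snd z)" using U unfolding is_kernel_def by blast
      moreover have "\<bar>U z\<bar> \<le> C" using C[of z] z by (cases z) auto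
      ultimately show ?case using elim unfolding g_def by auto
    qed
  qed
  ultimately show ?thesis by blast
qed

lemma hom_density_eq_hom:
  assumes "simple_graph V E" "bounded_kernel unit_measure g C" "AE z in unit_measure \<Otimes>\<^sub>M unit_measure. U z = g z"
  shows "hom_density V E U = unit.hom g V E"
proof -
  interpret bounded_kernel unit_measure g C by fact
  have "hom_density V E U = (\<integral>x. (\<Prod>e\<in>E. kernel_value U x e) \<partial>completion (Pi\<^sub>M V (\<lambda>_. unit_measure)))"
    unfolding hom_density_def lebesgue_cube_def kernel_value_def ..
  also have "\<dots> = (\<integral>x. (\<Prod>e\<in>E. kernel_value g x e) \<partial>Pi\<^sub>M V (\<lambda>_. unit_measure))"
    by (rule integral_completion_cong_AE)
      (intro borel_measurable_prod unit.kernel_value_measurable[OF assms(1) _ g_meas], simp,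
       rule unit.hom_cong_AE[OF assms(1,3)])
  finally show ?thesis unfolding unit.hom_def .
qed

text \<open>Lebesgue measurable classes are replaced by Borel sets up to null sets, which gives a
  Borel labelling. Absence of twins in \<open>A\<close> comes from minimality of the partition:
  classes with equal columns could be merged.\<close>

lemma step_kernel_types:
  assumes U: "step_kernel q U"
  shows "\<exists>\<tau> A. unit.step_type q \<tau> \<and> (\<forall>i j. A i j = A j i) \<and>
    (AE z in unit_measure \<Otimes>\<^sub>M unit_measure. U z = A (\<tau> (fst z)) (\<tau> (snd z))) \<and>
    (\<forall>i<q. 0 < unit.type_weight \<tau> i) \<and> (\<forall>i<q. \<forall>j<q. i \<noteq> j \<longrightarrow> (\<exists>w<q. A w i \<noteq> A w j))"
proof -
  from U obtain P where P: "step_partition U P" "card P = q" and ker: "is_kernel U"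
    and min: "\<not> (\<exists>P. step_partition U P \<and> card P = q - 1)" unfolding step_kernel_def by blast
  have part: "partition_on {0..1} P" and finP: "finite P"
    and lm: "\<And>S. S \<in> P \<Longrightarrow> S \<in> sets lebesgue \<and> 0 < emeasure lebesgue S"
    and const: "\<And>S T. S \<in> P \<Longrightarrow> T \<in> P \<Longrightarrow> U constant_on (S \<times> T)"
    using P(1) unfolding step_partition_def by auto
  obtain e where e: "bij_betw e {..<q} P"
    using finP P(2) ex_bij_betw_nat_finite[OF finP] by (auto simp: atLeast0LessThan)
  have eP: "e i \<in> P" if "i < q" for i using e that unfolding bij_betw_def by auto
  have e_sub: "e i \<subseteq> {0..1}" if "i < q" for i using partition_onD1[OF part] eP[OF that] by auto
  have e_ne: "e i \<noteq> {}" if "i < q" for i using partition_onD3[OF part] eP[OF that] by metis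
  have e_disj: "i = j" if "i < q" "j < q" "x \<in> e i" "x \<in> e j" for i j x
  proof -
    have "e i = e j" using partition_onD2[OF part] eP that unfolding disjoint_def by blast
    then show ?thesis using e that unfolding bij_betw_def inj_on_def by auto
  qed
  have e_cover: "\<exists>i<q. x \<in> e i" if "x \<in> {0..1}" for x
    using partition_onD1[OF part] that e unfolding bij_betw_def by auto
  define pt where "pt i = (SOME x. x \<in> e i)" for i
  have pt: "pt i \<in> e i" if "i < q" for i unfolding pt_def using e_ne[OF that] by (simp add: some_in_eq)
  \<comment> \<open>The value 0 outside the range makes \<open>A\<close> symmetric at all indices,
    as \<open>edge_value_doubleton\<close> expects.\<close>
  define A where "A i j = (if i < q \<and> j < q then U (pt i, pt j) else 0)" for i j
  have A_val: "U (x, y) = A i j" if "i < q" "j < q" "x \<in> e i" "y \<in> e j" for i j x y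
    using const[OF eP[OF that(1)] eP[OF that(2)]] that pt unfolding constant_on_def A_def by fastforce
  have A_sym: "A i j = A j i" for i j
  proof (cases "i < q \<and> j < q")
    case True
    then have "pt i \<in> {0..1}" "pt j \<in> {0..1}" using pt e_sub by blast+
    then show ?thesis using ker True unfolding A_def is_kernel_def by auto
  qed (auto simp: A_def)
  have "\<exists>S N N'. e i = S \<union> N \<and> N \<subseteq> N' \<and> N' \<in> null_sets lborel \<and> S \<in> sets lborel" if "i < q" for i
    by (rule sets_completionE[OF conjunct1[OF lm[OF eP[OF that]]]]) blast
  then obtain S N N' where SN: "\<And>i. i < q \<Longrightarrow> e i = S i \<union> N i" "\<And>i. i < q \<Longrightarrow> N i \<subseteq> N' i"
    "\<And>i. i < q \<Longrightarrow> N' i \<in> null_sets lborel" "\<And>i. i < q \<Longrightarrow> S i \<in> sets lborel" by metis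
  have q0: "0 < q" using e_cover[of 0] by auto
  \<comment> \<open>Points of the interval outside every \<open>S i\<close> form a null set; label 0
    is a placeholder there.\<close>
  define \<tau> where "\<tau> x = (if \<exists>i. i < q \<and> x \<in> S i then LEAST i. i < q \<and> x \<in> S i else 0)" for x
  have \<tau>S: "\<tau> x = i" if "i < q" "x \<in> S i" for x i
  proof -
    have "(LEAST i. i < q \<and> x \<in> S i) < q \<and> x \<in> S (LEAST i. i < q \<and> x \<in> S i)"
      by (rule LeastI[of "\<lambda>i. i < q \<and> x \<in> S i" i]) (use that in auto)
    then have "(LEAST i. i < q \<and> x \<in> S i) = i"
      using that SN(1) by (intro e_disj[of _ i x]) auto
    then show ?thesis using that unfolding \<tau>_def by auto
  qed
  have sm: "{x \<in> space unit_measure. x \<in> S i} \<in> sets unit_measure" if "i < q" for i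
    using SN(4)[OF that] by (auto simp: sets_restrict_space Int_def conj_commute intro!: image_eqI[of _ _ "S i"])
  have pm: "Measurable.pred unit_measure (\<lambda>x. i < q \<and> x \<in> S i)" for i
    using sm[of i] by (cases "i < q") (auto simp: pred_def)
  have \<tau>m: "\<tau> \<in> measurable unit_measure (count_space UNIV)"
    unfolding \<tau>_def using pm by measurable
  have \<tau>q: "\<tau> x < q" for x
  proof (cases "\<exists>i. i < q \<and> x \<in> S i")
    case True
    then show ?thesis using \<tau>S by blast
  qed (auto simp: \<tau>_def q0)
  have st: "unit.step_type q \<tau>" unfolding unit.step_type_def using \<tau>m \<tau>q by auto
  define Gd where "Gd = (\<Union>i<q. {x \<in> space unit_measure. x \<in> S i})"
  have Gd [measurable]: "Gd \<in> sets unit_measure" unfolding Gd_def using sm by auto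
  have AEx: "AE x in unit_measure. x \<in> Gd"
  proof -
    have "(\<Union>i<q. N' i) \<in> null_sets lborel" using SN(3) by (intro null_sets.finite_UN) auto
    then have "AE x in lborel. x \<notin> (\<Union>i<q. N' i)" by (rule AE_not_in)
    then have "AE x in lborel. x \<in> {0..1} \<longrightarrow> x \<in> Gd"
    proof (rule AE_mono_space, intro impI)
      fix x :: real assume x: "x \<notin> (\<Union>i<q. N' i)" "x \<in> {0..1}"
      obtain i where i: "i < q" "x \<in> e i" using e_cover[OF x(2)] by auto
      then have "x \<in> S i" using SN(1,2)[OF i(1)] x(1) by auto
      then show "x \<in> Gd" unfolding Gd_def using i x by auto
    qed
    then show ?thesis by (subst AE_restrict_space_iff) auto
  qed
  have AEz: "AE z in unit_measure \<Otimes>\<^sub>M unit_measure. fst z \<in> Gd \<and> snd z \<in> Gd"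
  proof (rule unit.pair.AE_pair_measure)
    show "AE x in unit_measure. AE y in unit_measure. fst (x, y) \<in> Gd \<and> snd (x, y) \<in> Gd"
      using AEx by (auto elim!: eventually_mono)
  qed measurable
  have "AE z in unit_measure \<Otimes>\<^sub>M unit_measure. U z = A (\<tau> (fst z)) (\<tau> (snd z))"
    using AEz
  proof (rule AE_mono_space)
    fix z assume z: "fst z \<in> Gd \<and> snd z \<in> Gd"
    then obtain i j where "i < q" "j < q" "fst z \<in> S i" "snd z \<in> S j" unfolding Gd_def by auto
    moreover from this have "U (fst z, snd z) = A i j" using SN(1) by (intro A_val) auto
    ultimately show "U z = A (\<tau> (fst z)) (\<tau> (snd z))" using \<tau>S by simp
  qed
  moreover have "0 < unit.type_weight \<tau> i" if i: "i < q" for i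
  proof -
    have N0: "N i \<in> null_sets lebesgue"
      using SN(2,3)[OF i] by (meson null_sets_completion_iff2)
    have S_leb: "S i \<in> sets lebesgue" using SN(4)[OF i] by simp
    have "0 < emeasure lebesgue (e i)" by (rule conjunct2[OF lm[OF eP[OF i]]])
    also have "\<dots> = emeasure lebesgue (S i)"
      unfolding SN(1)[OF i] by (rule emeasure_Un_null_set[OF S_leb N0])
    also have "\<dots> = emeasure lborel (S i)" using SN(4)[OF i] by simp
    also have "S i = {x \<in> space unit_measure. x \<in> S i}" using SN(1)[OF i] e_sub[OF i] by auto
    also have "emeasure lborel \<dots> = emeasure unit_measure \<dots>"
      by (rule emeasure_restrict_space[symmetric]) auto
    also have "\<dots> \<le> emeasure unit_measure {x \<in> space unit_measure. \<tau> x = i}"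
    proof (rule emeasure_mono)
      have "{x \<in> space unit_measure. \<tau> x = i} = \<tau> -` {i} \<inter> space unit_measure" by auto
      then show "{x \<in> space unit_measure. \<tau> x = i} \<in> sets unit_measure"
        using measurable_sets[OF \<tau>m, of "{i}"] by simp
    qed (use \<tau>S[OF i] in auto)
    finally show ?thesis
      unfolding unit.type_weight_def unit.emeasure_eq_measure by simp
  qed
  moreover have "\<exists>w<q. A w i \<noteq> A w j" if ij: "i < q" "j < q" "i \<noteq> j" for i j
  proof (rule ccontr)
    assume "\<not> ?thesis"
    then have same: "A w i = A w j" if "w < q" for w using that by auto
    \<comment> \<open>Types \<open>i\<close> and \<open>j\<close> are identified. By symmetry of
      \<open>A\<close>, equality of the columns gives equality of the rows, so values depend only on
      the images under \<open>r\<close>.\<close>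
    define r where "r l = (if l = j then i else l)" for l
    have Ar: "A k l = A (r k) (r l)" if "k < q" "l < q" for k l
    proof -
      have *: "A k l = A k (r l)" if "k < q" for k l using same[OF that] unfolding r_def by simp
      have "A k l = A (r l) k" using *[OF that(1), of l] A_sym[of k "r l"] by (rule trans)
      also have "\<dots> = A (r l) (r k)" using that(2) ij(1) by (intro *) (simp add: r_def)
      finally show ?thesis using A_sym[of "r l" "r k"] by (rule trans)
    qed
    define Q where "Q = insert (e i \<union> e j) (P - {e i, e j})"
    have eij: "e i \<noteq> e j" using e ij unfolding bij_betw_def inj_on_def by auto
    \<comment> \<open>Otherwise inserting the union would not add a class, and the count of
      \<open>Q\<close> would be off by one.\<close>
    have notin: "e i \<union> e j \<notin> P"
    proof
      assume "e i \<union> e j \<in> P"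
      then obtain l where l: "l < q" "e l = e i \<union> e j" using e unfolding bij_betw_def by auto
      have "l = i" by (rule e_disj[of _ _ "pt i"]) (use l ij pt in auto)
      moreover have "l = j" by (rule e_disj[of _ _ "pt j"]) (use l ij pt in auto)
      ultimately show False using ij(3) by simp
    qed
    have rep: "\<exists>c. \<forall>x\<in>T. \<exists>l<q. x \<in> e l \<and> r l = c" if "T \<in> Q" for T
    proof (cases "T = e i \<union> e j")
      case True
      then show ?thesis using ij by (intro exI[of _ i]) (auto simp: r_def)
    next
      case False
      then have T: "T \<in> P" "T \<noteq> e i" "T \<noteq> e j" using that unfolding Q_def by blast+
      then obtain l where "l < q" "T = e l" using e unfolding bij_betw_def by blast
      moreover from this T have "l \<noteq> i" "l \<noteq> j" by blast+
      ultimately show ?thesis by (intro exI[of _ l]) (auto simp: r_def)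
    qed
    have "step_partition U Q"
      unfolding step_partition_def
    proof (intro conjI ballI)
      show "partition_on {0..1} Q"
      proof (rule partition_onI)
        show "\<Union>Q = {0..1}"
          unfolding Q_def partition_onD1[OF part] using eP ij by auto
        show "disjnt S T" if "S \<in> Q" "T \<in> Q" "S \<noteq> T" for S T
          using that partition_onD2[OF part] eP[OF ij(1)] eP[OF ij(2)] unfolding Q_def disjoint_def disjnt_def
          by auto
        show "{} \<notin> Q"
          using partition_onD3[OF part] e_ne[OF ij(1)] unfolding Q_def by auto
      qed
      show "finite Q" unfolding Q_def using finP by auto
      show "T \<in> sets lebesgue" if "T \<in> Q" for T
        using that lm eP ij unfolding Q_def by auto
      show "0 < emeasure lebesgue T" if "T \<in> Q" for T
      proof (cases "T = e i \<union> e j")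
        case True
        have "0 < emeasure lebesgue (e i)" by (rule conjunct2[OF lm[OF eP[OF ij(1)]]])
        also have "\<dots> \<le> emeasure lebesgue T" unfolding True using lm eP ij by (intro emeasure_mono) auto
        finally show ?thesis .
      next
        case False
        then have "T \<in> P" using that unfolding Q_def by blast
        then show ?thesis using lm by blast
      qed
      show "U constant_on (T \<times> T')" if TT: "T \<in> Q" "T' \<in> Q" for T T'
      proof -
        obtain c where c: "\<forall>x\<in>T. \<exists>l<q. x \<in> e l \<and> r l = c" using rep[OF TT(1)] by blast
        obtain c' where c': "\<forall>x\<in>T'. \<exists>l<q. x \<in> e l \<and> r l = c'" using rep[OF TT(2)] by blast
        have "U (x, y) = A c c'" if xy: "x \<in> T" "y \<in> T'" for x y
        proof -
          obtain k l where kl: "k < q" "x \<in> e k" "r k = c" "l < q" "y \<in> e l" "r l = c'"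
            using c c' xy by blast
          then show ?thesis using A_val[of k l x y] Ar[of k l] by simp
        qed
        then show ?thesis unfolding constant_on_def by auto
      qed
    qed
    moreover have "card Q = q - 1"
    proof -
      have "card (P - {e i, e j}) = q - 2"
        using eP ij eij finP P(2) by (subst card_Diff_subset) auto
      moreover have "2 \<le> q" using ij by auto
      ultimately show ?thesis unfolding Q_def using notin finP by (subst card_insert_disjoint) auto
    qed
    ultimately show False using min by blast
  qed
  ultimately show ?thesis using st A_sym by blast
qed

lemma step_density_iso:
  assumes VE: "simple_graph V E" and \<pi>: "bij_betw \<pi> {..<q} {..<q}"
    and B: "\<And>i j. i < q \<Longrightarrow> j < q \<Longrightarrow> B (\<pi> i) (\<pi> j) = A i j" and b: "\<And>i. i < q \<Longrightarrow> b (\<pi> i) = a i"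
  shows "step_density q b B V E = step_density q a A V E"
proof -
  have \<pi>q: "\<pi> i < q" if "i < q" for i using bij_betwE[OF \<pi>] that by auto
  let ?\<pi>' = "inv_into {..<q} \<pi>"
  have inv: "?\<pi>' i < q" "\<pi> (?\<pi>' i) = i" if "i < q" for i
    using bij_betw_inv_into_right[OF \<pi>] bij_betwE[OF bij_betw_inv_into[OF \<pi>]] that by auto
  have inv2: "?\<pi>' (\<pi> i) = i" if "i < q" for i using bij_betw_inv_into_left[OF \<pi>] that by simp
  show ?thesis unfolding step_density_def
  proof (rule sum.reindex_bij_witness[where i = "\<lambda>\<sigma>. \<lambda>v\<in>V. \<pi> (\<sigma> v)" and j = "\<lambda>\<sigma>. \<lambda>v\<in>V. ?\<pi>' (\<sigma> v)"])
    fix \<sigma> assume \<sigma>: "\<sigma> \<in> V \<rightarrow>\<^sub>E {..<q}"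
    then have s: "\<sigma> v < q" if "v \<in> V" for v using that by auto
    show "(\<lambda>v\<in>V. \<pi> ((\<lambda>v\<in>V. ?\<pi>' (\<sigma> v)) v)) = \<sigma>"
      by (rule PiE_ext[OF _ \<sigma>]) (use s inv in auto)
    show "(\<lambda>v\<in>V. ?\<pi>' ((\<lambda>v\<in>V. \<pi> (\<sigma> v)) v)) = \<sigma>"
      by (rule PiE_ext[OF _ \<sigma>]) (use s inv2 in auto)
    show "(\<lambda>v\<in>V. ?\<pi>' (\<sigma> v)) \<in> V \<rightarrow>\<^sub>E {..<q}" "(\<lambda>v\<in>V. \<pi> (\<sigma> v)) \<in> V \<rightarrow>\<^sub>E {..<q}"
      using s inv \<pi>q by auto
    have "a (?\<pi>' i) = b i" if "i < q" for i using b[OF inv(1)[OF that]] inv(2)[OF that] by simp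
    moreover have "A (?\<pi>' i) (?\<pi>' j) = B i j" if "i < q" "j < q" for i j
      using B[OF inv(1)[OF that(1)] inv(1)[OF that(2)]] inv(2) that by simp
    moreover have "Min e \<in> V" "Max e \<in> V" if "e \<in> E" for e
      using VE that unit.min_max_edge[of e V] unfolding simple_graph_def by auto
    ultimately show "(\<Prod>v\<in>V. a ((\<lambda>v\<in>V. ?\<pi>' (\<sigma> v)) v)) * (\<Prod>e\<in>E. edge_value A (\<lambda>v\<in>V. ?\<pi>' (\<sigma> v)) e) =
      (\<Prod>v\<in>V. b (\<sigma> v)) * (\<Prod>e\<in>E. edge_value B \<sigma> e)"
      unfolding edge_value_def using s by (intro arg_cong2[where f = "(*)"] prod.cong refl) auto
  qed
qed

theorem theorem10:
  fixes q :: nat and U U' :: "real \<times> real \<Rightarrow> real"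
  assumes "q \<ge> 2"
    and "step_kernel q U"
    and "is_kernel U'"
    and "\<And>V E. simple_graph V E \<Longrightarrow> card V \<le> 4 * q\<^sup>2 - q \<Longrightarrow>
           hom_density V E U' = hom_density V E U"
  shows "weakly_isomorphic U U'"
proof -
  obtain g C where g: "bounded_kernel unit_measure g C" "AE z in unit_measure \<Otimes>\<^sub>M unit_measure. U z = g z"
    using kernel_borel_version[of U] assms(2) unfolding step_kernel_def by blast
  obtain g' C' where g': "bounded_kernel unit_measure g' C'" "AE z in unit_measure \<Otimes>\<^sub>M unit_measure. U' z = g' z"
    using kernel_borel_version[OF assms(3)] by blast
  interpret U: bounded_kernel unit_measure g C by fact
  interpret U': bounded_kernel unit_measure g' C' by fact
  obtain \<tau> A where \<tau>: "unit.step_type q \<tau>" and A_sym: "\<forall>i j. A i j = A j i"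
    and A: "AE z in unit_measure \<Otimes>\<^sub>M unit_measure. U z = A (\<tau> (fst z)) (\<tau> (snd z))"
    and pos: "\<forall>i<q. 0 < unit.type_weight \<tau> i"
    and dist: "\<forall>i<q. \<forall>j<q. i \<noteq> j \<longrightarrow> (\<exists>w<q. A w i \<noteq> A w j)"
    using step_kernel_types[OF assms(2)] by blast
  have "AE z in unit_measure \<Otimes>\<^sub>M unit_measure. g z = A (\<tau> (fst z)) (\<tau> (snd z))"
    using A g(2) by eventually_elim simp
  from unit.hom_step[OF _ \<tau> this U.g_meas]
  have hU: "hom_density V E U = step_density q (unit.type_weight \<tau>) A V E" if "simple_graph V E" for V E
    using hom_density_eq_hom[OF that g] that by simp
  have homU': "unit.hom g' V E = step_density q (unit.type_weight \<tau>) A V E"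
    if "simple_graph V E" "card V \<le> 4 * q\<^sup>2 - q" for V E
    using hom_density_eq_hom[OF that(1) g'] assms(4)[OF that] hU[OF that(1)] by simp
  obtain \<tau>' B where \<tau>': "unit.step_type q \<tau>'" and B_sym: "\<forall>i j. B i j = B j i"
    and B: "AE z in unit_measure \<Otimes>\<^sub>M unit_measure. g' z = B (\<tau>' (fst z)) (\<tau>' (snd z))"
    using U'.step_of_densities[of A q "unit.type_weight \<tau>"] A_sym assms(1) homU' by blast
  have hU': "hom_density V E U' = step_density q (unit.type_weight \<tau>') B V E" if "simple_graph V E" for V E
    using hom_density_eq_hom[OF that g'] unit.hom_step[OF that \<tau>' B U'.g_meas] by simp
  have eq: "step_density q (unit.type_weight \<tau>') B V E = step_density q (unit.type_weight \<tau>) A V E"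
    if "simple_graph V E" "card V \<le> 4 * q\<^sup>2 - q" for V E
    using hU[OF that(1)] hU'[OF that(1)] assms(4)[OF that] by simp
  obtain \<pi> where \<pi>: "bij_betw \<pi> {..<q} {..<q}" "\<And>i j. i < q \<Longrightarrow> j < q \<Longrightarrow> B (\<pi> i) (\<pi> j) = A i j"
    "\<And>i. i < q \<Longrightarrow> unit.type_weight \<tau>' (\<pi> i) = unit.type_weight \<tau> i"
  proof (rule step_data_determined[of q "unit.type_weight \<tau>" "unit.type_weight \<tau>'" A B])
    show "(\<Sum>i<q. unit.type_weight \<tau> i) = 1" "(\<Sum>i<q. unit.type_weight \<tau>' i) = 1"
      by (rule unit.type_weight_sum[OF \<tau>], rule unit.type_weight_sum[OF \<tau>'])
    show "0 \<le> unit.type_weight \<tau>' i" for i unfolding unit.type_weight_def by simp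
  qed (use assms(1) pos A_sym B_sym dist eq in \<open>auto\<close>)
  \<comment> \<open>An isomorphism of weighted matrices preserves all densities, which removes the
    bound on the number of vertices.\<close>
  have "step_density q (unit.type_weight \<tau>') B V E = step_density q (unit.type_weight \<tau>) A V E"
    if "simple_graph V E" for V E
    by (rule step_density_iso[OF that \<pi>(1)]) (use \<pi>(2,3) in auto)
  then show ?thesis
    unfolding weakly_isomorphic_def using hU hU' by simp
qed

end
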